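(* The system $\mathsf{RCA}_0^\omega+\mathsf{NCC}$ proves $\mathsf{WKL}\leftrightarrow\mathsf{PIT}_o$.
   Context: $\mathsf{RCA}_0^\omega$ is Kohlenbach's base theory of higher-order reverse mathematics: a theory in the language of all finite types (type $0$ = natural numbers, $\sigma\to\tau$ = mappings), with constants $0,1,<,+,\times,=_0$, combinators and Gödel's recursors; axioms: ordered semiring axioms, combinator axioms, defining axioms of the recursor $\mathbf R_0$, extensionality at all finite types, quantifier-free induction, and $\mathsf{QF\text{-}AC}^{1,0}$. $C=2^{\mathbb N}$ is Cantor space; for a finite binary sequence $\sigma$, $[\sigma]$ is the set of $f\in C$ extending $\sigma$, and $\overline f n=\langle f(0),\dots,f(n-1)\rangle$. $\mathsf{NCC}$: for every $Y^2$, with $A(n,m)\equiv(\exists f\in 2^{\mathbb N})(Y(f,m,n)=0)$, if $(\forall n^0)(\exists m^0)A(n,m)$ then $(\exists g^1)(\forall n^0)A(n,g(n))$. $\mathsf{WKL}$ (weak König's lemma): every infinite binary tree has an infinite path. $\mathsf{PIT}_o$: for all $F,G:C\to\mathbb N$, if $(\forall f,g\in C)[g\in[\overline f G(f)]\to F(g)\le G(f)]$, then $(\exists N\in\mathbb N)(\forall g\in C)(F(g)\le N)$. *)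

theory Defs
  imports Main
begin

section \<open>Finite types, terms and formulas\<close>

datatype ty = N | Fun ty ty  (infixr "\<Rrightarrow>" 65)

abbreviation ty1 :: ty where "ty1 \<equiv> N \<Rrightarrow> N"
abbreviation ty2 :: ty where "ty2 \<equiv> ty1 \<Rrightarrow> N"

datatype const =
    CZero | COne | CPlus | CTimes
  | CK ty ty
  | CS ty ty ty
  | CRec ty

primrec const_ty :: "const \<Rightarrow> ty" where
  "const_ty CZero = N"
| "const_ty COne = N"
| "const_ty CPlus = N \<Rrightarrow> N \<Rrightarrow> N"
| "const_ty CTimes = N \<Rrightarrow> N \<Rrightarrow> N"
| "const_ty (CK \<sigma> \<tau>) = \<sigma> \<Rrightarrow> \<tau> \<Rrightarrow> \<sigma>"
| "const_ty (CS \<rho> \<sigma> \<tau>) = (\<rho> \<Rrightarrow> \<sigma> \<Rrightarrow> \<tau>) \<Rrightarrow> (\<rho> \<Rrightarrow> \<sigma>) \<Rrightarrow> \<rho> \<Rrightarrow> \<tau>"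
| "const_ty (CRec \<sigma>) = (N \<Rrightarrow> \<sigma> \<Rrightarrow> \<sigma>) \<Rrightarrow> \<sigma> \<Rrightarrow> N \<Rrightarrow> \<sigma>"

type_synonym var = "string \<times> ty"

text \<open>Locally nameless syntax: free variables carry a name and a type, bound variables are
  de Bruijn indices. Only the quantifier binds; there is no primitive \<open>\<lambda>\<close>.\<close>

datatype tm = Bv nat | Fv var | Con const | App tm tm  (infixl "\<cdot>" 90)

datatype fm =
    Eq tm tm  (infix "\<^bold>=" 55)
  | Less tm tm  (infix "\<^bold><" 55)
  | Falsum  ("\<^bold>\<bottom>")
  | Imp fm fm  (infixr "\<^bold>\<longrightarrow>" 35)
  | All ty fm

abbreviation Neg :: "fm \<Rightarrow> fm"  ("\<^bold>\<not> _" [53] 53) where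
  "\<^bold>\<not> A \<equiv> A \<^bold>\<longrightarrow> \<^bold>\<bottom>"
abbreviation Or :: "fm \<Rightarrow> fm \<Rightarrow> fm"  (infixr "\<^bold>\<or>" 40) where
  "A \<^bold>\<or> B \<equiv> \<^bold>\<not> A \<^bold>\<longrightarrow> B"
abbreviation And :: "fm \<Rightarrow> fm \<Rightarrow> fm"  (infixr "\<^bold>\<and>" 45) where
  "A \<^bold>\<and> B \<equiv> \<^bold>\<not> (A \<^bold>\<longrightarrow> \<^bold>\<not> B)"
abbreviation Iff :: "fm \<Rightarrow> fm \<Rightarrow> fm"  (infix "\<^bold>\<longleftrightarrow>" 30) where
  "A \<^bold>\<longleftrightarrow> B \<equiv> (A \<^bold>\<longrightarrow> B) \<^bold>\<and> (B \<^bold>\<longrightarrow> A)"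
abbreviation Ex :: "ty \<Rightarrow> fm \<Rightarrow> fm" where
  "Ex \<sigma> A \<equiv> \<^bold>\<not> All \<sigma> (\<^bold>\<not> A)"

abbreviation Zero :: tm  ("\<^bold>0") where "\<^bold>0 \<equiv> Con CZero"
abbreviation One :: tm  ("\<^bold>1") where "\<^bold>1 \<equiv> Con COne"
abbreviation Plus :: "tm \<Rightarrow> tm \<Rightarrow> tm"  (infixl "\<^bold>+" 65) where
  "s \<^bold>+ t \<equiv> Con CPlus \<cdot> s \<cdot> t"
abbreviation Times :: "tm \<Rightarrow> tm \<Rightarrow> tm"  (infixl "\<^bold>*" 70) where
  "s \<^bold>* t \<equiv> Con CTimes \<cdot> s \<cdot> t"
abbreviation Leq :: "tm \<Rightarrow> tm \<Rightarrow> fm"  (infix "\<^bold>\<le>" 55) where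
  "s \<^bold>\<le> t \<equiv> s \<^bold>< t \<^bold>\<or> s \<^bold>= t"

text \<open>Typing relative to the types of the enclosing binders, innermost first.\<close>

primrec has_ty :: "ty list \<Rightarrow> tm \<Rightarrow> ty \<Rightarrow> bool" where
  "has_ty \<Delta> (Bv i) \<tau> \<longleftrightarrow> i < length \<Delta> \<and> \<Delta> ! i = \<tau>"
| "has_ty \<Delta> (Fv v) \<tau> \<longleftrightarrow> snd v = \<tau>"
| "has_ty \<Delta> (Con c) \<tau> \<longleftrightarrow> const_ty c = \<tau>"
| "has_ty \<Delta> (s \<cdot> t) \<tau> \<longleftrightarrow> (\<exists>\<sigma>. has_ty \<Delta> s (\<sigma> \<Rrightarrow> \<tau>) \<and> has_ty \<Delta> t \<sigma>)"

primrec wff :: "ty list \<Rightarrow> fm \<Rightarrow> bool" where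
  "wff \<Delta> (s \<^bold>= t) \<longleftrightarrow> has_ty \<Delta> s N \<and> has_ty \<Delta> t N"
| "wff \<Delta> (s \<^bold>< t) \<longleftrightarrow> has_ty \<Delta> s N \<and> has_ty \<Delta> t N"
| "wff \<Delta> \<^bold>\<bottom> \<longleftrightarrow> True"
| "wff \<Delta> (A \<^bold>\<longrightarrow> B) \<longleftrightarrow> wff \<Delta> A \<and> wff \<Delta> B"
| "wff \<Delta> (All \<sigma> A) \<longleftrightarrow> wff (\<sigma> # \<Delta>) A"

primrec quantifier_free :: "fm \<Rightarrow> bool" where
  "quantifier_free (s \<^bold>= t) \<longleftrightarrow> True"
| "quantifier_free (s \<^bold>< t) \<longleftrightarrow> True"
| "quantifier_free \<^bold>\<bottom> \<longleftrightarrow> True"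
| "quantifier_free (A \<^bold>\<longrightarrow> B) \<longleftrightarrow> quantifier_free A \<and> quantifier_free B"
| "quantifier_free (All \<sigma> A) \<longleftrightarrow> False"

primrec fv_tm :: "tm \<Rightarrow> var set" where
  "fv_tm (Bv i) = {}"
| "fv_tm (Fv v) = {v}"
| "fv_tm (Con c) = {}"
| "fv_tm (s \<cdot> t) = fv_tm s \<union> fv_tm t"

primrec fv :: "fm \<Rightarrow> var set" where
  "fv (s \<^bold>= t) = fv_tm s \<union> fv_tm t"
| "fv (s \<^bold>< t) = fv_tm s \<union> fv_tm t"
| "fv \<^bold>\<bottom> = {}"
| "fv (A \<^bold>\<longrightarrow> B) = fv A \<union> fv B"
| "fv (All \<sigma> A) = fv A"

text \<open>\<open>inst k t\<close> replaces the bound variable of index \<open>k\<close> by \<open>t\<close>. It is only used for terms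
  \<open>t\<close> without loose indices, so that no index ever has to be shifted.\<close>

primrec inst_tm :: "nat \<Rightarrow> tm \<Rightarrow> tm \<Rightarrow> tm" where
  "inst_tm k u (Bv i) = (if i = k then u else Bv i)"
| "inst_tm k u (Fv v) = Fv v"
| "inst_tm k u (Con c) = Con c"
| "inst_tm k u (s \<cdot> t) = inst_tm k u s \<cdot> inst_tm k u t"

primrec inst :: "nat \<Rightarrow> tm \<Rightarrow> fm \<Rightarrow> fm" where
  "inst k u (s \<^bold>= t) = (inst_tm k u s \<^bold>= inst_tm k u t)"
| "inst k u (s \<^bold>< t) = (inst_tm k u s \<^bold>< inst_tm k u t)"
| "inst k u \<^bold>\<bottom> = \<^bold>\<bottom>"
| "inst k u (A \<^bold>\<longrightarrow> B) = (inst k u A \<^bold>\<longrightarrow> inst k u B)"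
| "inst k u (All \<sigma> A) = All \<sigma> (inst (Suc k) u A)"

text \<open>\<open>subst v t\<close> replaces the free variable \<open>v\<close> by \<open>t\<close>.\<close>

primrec subst_tm :: "var \<Rightarrow> tm \<Rightarrow> tm \<Rightarrow> tm" where
  "subst_tm v u (Bv i) = Bv i"
| "subst_tm v u (Fv w) = (if w = v then u else Fv w)"
| "subst_tm v u (Con c) = Con c"
| "subst_tm v u (s \<cdot> t) = subst_tm v u s \<cdot> subst_tm v u t"

primrec subst :: "var \<Rightarrow> tm \<Rightarrow> fm \<Rightarrow> fm" where
  "subst v u (s \<^bold>= t) = (subst_tm v u s \<^bold>= subst_tm v u t)"
| "subst v u (s \<^bold>< t) = (subst_tm v u s \<^bold>< subst_tm v u t)"
| "subst v u \<^bold>\<bottom> = \<^bold>\<bottom>"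
| "subst v u (A \<^bold>\<longrightarrow> B) = (subst v u A \<^bold>\<longrightarrow> subst v u B)"
| "subst v u (All \<sigma> A) = All \<sigma> (subst v u A)"

text \<open>\<open>bind v k\<close> turns the free variable \<open>v\<close> into the bound variable of index \<open>k\<close>.\<close>

primrec bind_tm :: "var \<Rightarrow> nat \<Rightarrow> tm \<Rightarrow> tm" where
  "bind_tm v k (Bv i) = Bv i"
| "bind_tm v k (Fv w) = (if w = v then Bv k else Fv w)"
| "bind_tm v k (Con c) = Con c"
| "bind_tm v k (s \<cdot> t) = bind_tm v k s \<cdot> bind_tm v k t"

primrec bind :: "var \<Rightarrow> nat \<Rightarrow> fm \<Rightarrow> fm" where
  "bind v k (s \<^bold>= t) = (bind_tm v k s \<^bold>= bind_tm v k t)"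
| "bind v k (s \<^bold>< t) = (bind_tm v k s \<^bold>< bind_tm v k t)"
| "bind v k \<^bold>\<bottom> = \<^bold>\<bottom>"
| "bind v k (A \<^bold>\<longrightarrow> B) = (bind v k A \<^bold>\<longrightarrow> bind v k B)"
| "bind v k (All \<sigma> A) = All \<sigma> (bind v (Suc k) A)"

text \<open>Quantifiers with named variables: \<open>all ''x'' \<sigma> (\<lambda>x. A x)\<close> is the formula
  $\forall x^\sigma\, A(x)$.\<close>

definition all :: "string \<Rightarrow> ty \<Rightarrow> (tm \<Rightarrow> fm) \<Rightarrow> fm" where
  "all x \<sigma> F = All \<sigma> (bind (x, \<sigma>) 0 (F (Fv (x, \<sigma>))))"

definition ex :: "string \<Rightarrow> ty \<Rightarrow> (tm \<Rightarrow> fm) \<Rightarrow> fm" where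
  "ex x \<sigma> F = Ex \<sigma> (bind (x, \<sigma>) 0 (F (Fv (x, \<sigma>))))"

section \<open>Classical predicate logic\<close>

text \<open>\<open>T; \<Gamma> \<turnstile> A\<close>: from the axioms \<open>T\<close> and the assumptions \<open>\<Gamma>\<close> one derives \<open>A\<close>. Free variables
  of an axiom count as universally quantified; hence the eigenvariable condition
  in \<open>AllI\<close> concerns \<open>\<Gamma>\<close> only. Equality has no logical rules; its axioms are below.\<close>

inductive derives :: "fm set \<Rightarrow> fm set \<Rightarrow> fm \<Rightarrow> bool"  ("_; _ \<turnstile> _" [51, 51, 30] 30) for T where
  Axiom: "A \<in> T \<Longrightarrow> wff [] A \<Longrightarrow> T; \<Gamma> \<turnstile> A"
| Assume: "A \<in> \<Gamma> \<Longrightarrow> wff [] A \<Longrightarrow> T; \<Gamma> \<turnstile> A"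
| ImpI: "T; insert A \<Gamma> \<turnstile> B \<Longrightarrow> wff [] A \<Longrightarrow> T; \<Gamma> \<turnstile> A \<^bold>\<longrightarrow> B"
| ImpE: "T; \<Gamma> \<turnstile> A \<^bold>\<longrightarrow> B \<Longrightarrow> T; \<Gamma> \<turnstile> A \<Longrightarrow> T; \<Gamma> \<turnstile> B"
| Contr: "T; insert (\<^bold>\<not> A) \<Gamma> \<turnstile> \<^bold>\<bottom> \<Longrightarrow> wff [] A \<Longrightarrow> T; \<Gamma> \<turnstile> A"
| AllI: "T; \<Gamma> \<turnstile> inst 0 (Fv (x, \<sigma>)) A \<Longrightarrow> (x, \<sigma>) \<notin> fv A \<Longrightarrow> \<forall>B\<in>\<Gamma>. (x, \<sigma>) \<notin> fv B \<Longrightarrow>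
    T; \<Gamma> \<turnstile> All \<sigma> A"
| AllE: "T; \<Gamma> \<turnstile> All \<sigma> A \<Longrightarrow> has_ty [] t \<sigma> \<Longrightarrow> T; \<Gamma> \<turnstile> inst 0 t A"

definition proves :: "fm set \<Rightarrow> fm \<Rightarrow> bool"  (infix "\<turnstile>" 30) where
  "T \<turnstile> A \<longleftrightarrow> (T; {} \<turnstile> A)"

section \<open>The base theory\<close>

text \<open>Equality at type $\tau = \tau_1 \to \dots \to \tau_k \to 0$ abbreviates
  $\forall z_1^{\tau_1} \dots z_k^{\tau_k}\, (s z_1 \dots z_k =_0 t z_1 \dots z_k)$.
  Like the other formula abbreviations below that quantify by index, it is applied only to terms
  without loose indices.\<close>

primrec arg_tys :: "ty \<Rightarrow> ty list" where
  "arg_tys N = []"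
| "arg_tys (\<sigma> \<Rrightarrow> \<tau>) = \<sigma> # arg_tys \<tau>"

definition eq :: "ty \<Rightarrow> tm \<Rightarrow> tm \<Rightarrow> fm" where
  "eq \<tau> s t = (let zs = map Bv (rev [0..<length (arg_tys \<tau>)])
     in foldr All (arg_tys \<tau>) (foldl App s zs \<^bold>= foldl App t zs))"

definition arithmetic_axioms :: "fm set" where
  "arithmetic_axioms = (let x = Fv (''x'', N); y = Fv (''y'', N); z = Fv (''z'', N); u = Fv (''u'', N) in {
     x \<^bold>= x,
     x \<^bold>= y \<^bold>\<longrightarrow> y \<^bold>= x,
     x \<^bold>= y \<^bold>\<longrightarrow> y \<^bold>= z \<^bold>\<longrightarrow> x \<^bold>= z,
     x \<^bold>= y \<^bold>\<longrightarrow> z \<^bold>= u \<^bold>\<longrightarrow> x \<^bold>< z \<^bold>\<longrightarrow> y \<^bold>< u,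
     x \<^bold>+ (y \<^bold>+ z) \<^bold>= (x \<^bold>+ y) \<^bold>+ z,
     x \<^bold>+ y \<^bold>= y \<^bold>+ x,
     x \<^bold>+ \<^bold>0 \<^bold>= x,
     x \<^bold>* (y \<^bold>* z) \<^bold>= (x \<^bold>* y) \<^bold>* z,
     x \<^bold>* y \<^bold>= y \<^bold>* x,
     x \<^bold>* \<^bold>1 \<^bold>= x,
     x \<^bold>* \<^bold>0 \<^bold>= \<^bold>0,
     x \<^bold>* (y \<^bold>+ z) \<^bold>= x \<^bold>* y \<^bold>+ x \<^bold>* z,
     \<^bold>\<not> x \<^bold>< x,
     x \<^bold>< y \<^bold>\<longrightarrow> y \<^bold>< z \<^bold>\<longrightarrow> x \<^bold>< z,
     x \<^bold>< y \<^bold>\<or> x \<^bold>= y \<^bold>\<or> y \<^bold>< x,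
     x \<^bold>< y \<^bold>\<longrightarrow> x \<^bold>+ z \<^bold>< y \<^bold>+ z,
     \<^bold>0 \<^bold>< z \<^bold>\<longrightarrow> x \<^bold>< y \<^bold>\<longrightarrow> x \<^bold>* z \<^bold>< y \<^bold>* z,
     \<^bold>0 \<^bold>< \<^bold>1,
     \<^bold>0 \<^bold>\<le> x,
     \<^bold>0 \<^bold>< x \<^bold>\<longrightarrow> \<^bold>1 \<^bold>\<le> x })"

definition combinator_axioms :: "fm set" where
  "combinator_axioms =
     {eq \<sigma> (Con (CK \<sigma> \<tau>) \<cdot> x \<cdot> y) x | \<sigma> \<tau> x y. x = Fv (''x'', \<sigma>) \<and> y = Fv (''y'', \<tau>)} \<union>
     {eq \<tau> (Con (CS \<rho> \<sigma> \<tau>) \<cdot> x \<cdot> y \<cdot> z) (x \<cdot> z \<cdot> (y \<cdot> z)) | \<rho> \<sigma> \<tau> x y z.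
        x = Fv (''x'', \<rho> \<Rrightarrow> \<sigma> \<Rrightarrow> \<tau>) \<and> y = Fv (''y'', \<rho> \<Rrightarrow> \<sigma>) \<and> z = Fv (''z'', \<rho>)}"

text \<open>As in Kohlenbach's system, only the recursor for type \<open>0\<close> is axiomatised.\<close>

definition recursor_axioms :: "fm set" where
  "recursor_axioms =
     (let f = Fv (''f'', N \<Rrightarrow> N \<Rrightarrow> N); m = Fv (''m'', N); n = Fv (''n'', N); R = Con (CRec N) in {
        R \<cdot> f \<cdot> m \<cdot> \<^bold>0 \<^bold>= m,
        R \<cdot> f \<cdot> m \<cdot> (n \<^bold>+ \<^bold>1) \<^bold>= f \<cdot> n \<cdot> (R \<cdot> f \<cdot> m \<cdot> n) })"

definition extensionality_axioms :: "fm set" where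
  "extensionality_axioms =
     {eq \<rho> x y \<^bold>\<longrightarrow> eq \<tau> (\<phi> \<cdot> x) (\<phi> \<cdot> y) | \<rho> \<tau> x y \<phi>.
        x = Fv (''x'', \<rho>) \<and> y = Fv (''y'', \<rho>) \<and> \<phi> = Fv (''phi'', \<rho> \<Rrightarrow> \<tau>)}"

text \<open>In the two schemas, \<open>A\<close> may contain further free variables as parameters.\<close>

definition QF_IND :: "fm set" where
  "QF_IND =
     {subst n \<^bold>0 A \<^bold>\<longrightarrow>
        all x N (\<lambda>_. A \<^bold>\<longrightarrow> subst n (Fv n \<^bold>+ \<^bold>1) A) \<^bold>\<longrightarrow>
        all x N (\<lambda>_. A) | A x n.
        n = (x, N) \<and> quantifier_free A \<and> wff [] A}"

definition QF_AC_10 :: "fm set" where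
  "QF_AC_10 =
     {all x ty1 (\<lambda>_. ex y N (\<lambda>_. A)) \<^bold>\<longrightarrow>
        ex Y ty2 (\<lambda>Y. all x ty1 (\<lambda>x. subst (y, N) (Y \<cdot> x) A)) | A x y Y.
        quantifier_free A \<and> wff [] A \<and> (Y, ty2) \<notin> fv A}"

definition RCA0\<omega> :: "fm set" where
  "RCA0\<omega> = arithmetic_axioms \<union> combinator_axioms \<union> recursor_axioms \<union>
     extensionality_axioms \<union> QF_IND \<union> QF_AC_10"

section \<open>Finite binary sequences\<close>

fun ty_of :: "tm \<Rightarrow> ty" where
  "ty_of (Bv i) = N"
| "ty_of (Fv v) = snd v"
| "ty_of (Con c) = const_ty c"
| "ty_of (s \<cdot> t) = (case ty_of s of N \<Rightarrow> N | \<sigma> \<Rrightarrow> \<tau> \<Rightarrow> \<tau>)"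

text \<open>\<open>\<lambda>\<close>-abstraction in terms of the combinators (bracket abstraction).\<close>

fun lam :: "var \<Rightarrow> tm \<Rightarrow> tm" where
  "lam v (s \<cdot> t) = (if v \<in> fv_tm (s \<cdot> t)
     then Con (CS (snd v) (ty_of t) (ty_of (s \<cdot> t))) \<cdot> lam v s \<cdot> lam v t
     else Con (CK (ty_of (s \<cdot> t)) (snd v)) \<cdot> (s \<cdot> t))"
| "lam v t = (if t = Fv v
     then let \<sigma> = snd v in Con (CS \<sigma> (\<sigma> \<Rrightarrow> \<sigma>) \<sigma>) \<cdot> Con (CK \<sigma> (\<sigma> \<Rrightarrow> \<sigma>)) \<cdot> Con (CK \<sigma> \<sigma>)
     else Con (CK (ty_of t) (snd v)) \<cdot> t)"

text \<open>The finite binary sequence $\langle b_0, \dots, b_{n-1} \rangle$ is coded by the number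
  with binary expansion $1 b_0 \dots b_{n-1}$. So the codes are the positive numbers, and
  $\overline f 0 = 1$, $\overline f (k+1) = 2 \cdot \overline f k + f(k)$.\<close>

definition Bar :: tm where
  "Bar = (let f = (''f'', ty1); n = (''n'', N); k = (''k'', N); c = (''c'', N) in
     lam f (lam n (Con (CRec N) \<cdot> lam k (lam c (Fv c \<^bold>+ Fv c \<^bold>+ Fv f \<cdot> Fv k)) \<cdot> \<^bold>1 \<cdot> Fv n)))"

abbreviation bar :: "tm \<Rightarrow> tm \<Rightarrow> tm" where
  "bar f n \<equiv> Bar \<cdot> f \<cdot> n"

definition Pow2 :: tm where
  "Pow2 = (let k = (''k'', N); c = (''c'', N) in
     Con (CRec N) \<cdot> lam k (lam c (Fv c \<^bold>+ Fv c)) \<cdot> \<^bold>1)"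

definition in_Cantor :: "tm \<Rightarrow> fm" where
  "in_Cantor f = All N (f \<cdot> Bv 0 \<^bold>\<le> \<^bold>1)"

text \<open>$g \in [\sigma]$\<close>

definition in_nbhd :: "tm \<Rightarrow> tm \<Rightarrow> fm" where
  "in_nbhd g \<sigma> = (in_Cantor g \<^bold>\<and> Ex N (bar g (Bv 0) \<^bold>= \<sigma>))"

definition is_seq :: "tm \<Rightarrow> fm" where
  "is_seq \<sigma> = (\<^bold>1 \<^bold>\<le> \<sigma>)"

text \<open>\<open>\<sigma>\<close> is an initial segment of \<open>\<tau>\<close>: $\tau = \sigma \cdot 2^k + r$ with $r < 2^k$, where \<open>k\<close>
  is the number of bits by which \<open>\<tau>\<close> is longer and \<open>r\<close> is formed by these bits.\<close>

definition is_initial_seg :: "tm \<Rightarrow> tm \<Rightarrow> fm" where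
  "is_initial_seg \<sigma> \<tau> = (is_seq \<sigma> \<^bold>\<and> is_seq \<tau> \<^bold>\<and>
     Ex N (Ex N (Bv 0 \<^bold>< Pow2 \<cdot> Bv 1 \<^bold>\<and> \<tau> \<^bold>= \<sigma> \<^bold>* (Pow2 \<cdot> Bv 1) \<^bold>+ Bv 0)))"

section \<open>The principles\<close>

text \<open>Sets of numbers are given by characteristic functions.\<close>

definition member :: "tm \<Rightarrow> tm \<Rightarrow> fm" where
  "member n X = (X \<cdot> n \<^bold>= \<^bold>1)"

definition is_binary_tree :: "tm \<Rightarrow> fm" where
  "is_binary_tree T = (in_Cantor T \<^bold>\<and>
     all ''sigma'' N (\<lambda>\<sigma>. member \<sigma> T \<^bold>\<longrightarrow> is_seq \<sigma>) \<^bold>\<and>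
     all ''tau'' N (\<lambda>\<tau>. member \<tau> T \<^bold>\<longrightarrow>
       all ''sigma'' N (\<lambda>\<sigma>. is_initial_seg \<sigma> \<tau> \<^bold>\<longrightarrow> member \<sigma> T)))"

definition is_infinite :: "tm \<Rightarrow> fm" where
  "is_infinite X = all ''k'' N (\<lambda>k. ex ''n'' N (\<lambda>n. k \<^bold>< n \<^bold>\<and> member n X))"

definition WKL :: fm where
  "WKL = all ''T'' ty1 (\<lambda>T. is_binary_tree T \<^bold>\<and> is_infinite T \<^bold>\<longrightarrow>
     ex ''f'' ty1 (\<lambda>f. in_Cantor f \<^bold>\<and> all ''n'' N (\<lambda>n. member (bar f n) T)))"

definition NCC :: fm where
  "NCC = all ''Y'' (ty1 \<Rrightarrow> N \<Rrightarrow> N \<Rrightarrow> N) (\<lambda>Y.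
     let A = (\<lambda>n m. ex ''f'' ty1 (\<lambda>f. in_Cantor f \<^bold>\<and> Y \<cdot> f \<cdot> m \<cdot> n \<^bold>= \<^bold>0)) in
     all ''n'' N (\<lambda>n. ex ''m'' N (\<lambda>m. A n m)) \<^bold>\<longrightarrow>
     ex ''g'' ty1 (\<lambda>g. all ''n'' N (\<lambda>n. A n (g \<cdot> n))))"

text \<open>Functions $C \to \mathbb N$ are given by objects of type \<open>2\<close>, of which only the values on
  \<open>C\<close> are used.\<close>

definition PIT\<^sub>o :: fm where
  "PIT\<^sub>o = all ''F'' ty2 (\<lambda>F. all ''G'' ty2 (\<lambda>G.
     all ''f'' ty1 (\<lambda>f. in_Cantor f \<^bold>\<longrightarrow> all ''g'' ty1 (\<lambda>g. in_Cantor g \<^bold>\<longrightarrow>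
       in_nbhd g (bar f (G \<cdot> f)) \<^bold>\<longrightarrow> F \<cdot> g \<^bold>\<le> G \<cdot> f)) \<^bold>\<longrightarrow>
     ex ''N'' N (\<lambda>n. all ''g'' ty1 (\<lambda>g. in_Cantor g \<^bold>\<longrightarrow> F \<cdot> g \<^bold>\<le> n))))"

lemma has_ty_Bar: "has_ty \<Delta> Bar (ty1 \<Rrightarrow> N \<Rrightarrow> N)"
  by (simp add: Bar_def Let_def)

lemma has_ty_Pow2: "has_ty \<Delta> Pow2 (N \<Rrightarrow> N)"
  by (simp add: Pow2_def Let_def)

lemmas principle_defs = WKL_def NCC_def PIT\<^sub>o_def is_binary_tree_def is_infinite_def member_def
  is_initial_seg_def is_seq_def in_nbhd_def in_Cantor_def all_def ex_def Let_def

lemma sentences: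
  "wff [] WKL" "fv WKL = {}"
  "wff [] NCC" "fv NCC = {}"
  "wff [] PIT\<^sub>o" "fv PIT\<^sub>o = {}"
  by (simp_all add: principle_defs Bar_def Pow2_def)

end

theory Submission
  imports Defs "HOL-Library.Countable_Set"
begin

text \<open>By a Henkin completeness theorem it suffices to show that \<open>WKL\<close> and \<open>PIT\<^sub>o\<close> are equivalent in
  every extensional model of the base theory and \<open>NCC\<close>.

  If a tree \<open>T\<close> has no path, then \<open>QF_AC_10\<close> yields an \<open>F\<close> such that every $f \in C$ leaves \<open>T\<close> after
  exactly \<open>F(f)\<close> steps. \<open>F\<close> and \<open>G = F + 1\<close> satisfy the hypothesis of \<open>PIT\<^sub>o\<close>, and a bound on \<open>F\<close>
  bounds the height of \<open>T\<close>.

  Conversely, given \<open>F\<close> and \<open>G\<close>, consider the tree of all \<open>s\<close> such that $|u| < G(u000\dots)$ for every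
  initial segment \<open>u\<close> of \<open>s\<close>. If it is finite, its height bounds \<open>F\<close>. Otherwise \<open>WKL\<close> gives a path
  \<open>f\<close>, and \<open>G\<close> is discontinuous at \<open>f\<close>; by Grilliot's trick some functional decides
  $\exists n\, h(n) = 0$. If \<open>F\<close> were unbounded, \<open>NCC\<close> would give sequences \<open>g(n)\<close> of length \<open>n\<close>, each
  with an extension \<open>f\<^sub>n\<close> such that $F(f_n) > n$. The tree of all \<open>s\<close> that are an initial segment of
  \<open>g(n)\<close> for some $n \ge |s|$ is now decidable and has a path \<open>q\<close>. For some $n \ge G(q)$ the
  sequence \<open>f\<^sub>n\<close> lies in the neighbourhood of \<open>q\<close> given by \<open>G(q)\<close>, so $n < F(f_n) \le G(q) \le n$.\<close>

section \<open>Syntax\<close>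

text \<open>Working in models avoids carrying the coding through bare natural deduction, but the
  models may be nonstandard. Their numbers satisfy induction only for quantifier-free formulas, so
  each induction exhibits such a formula, and every auxiliary function has to come from the
  combinators, the recursor for numbers or \<open>QF_AC_10\<close>. A set is a characteristic
  function, so \<open>WKL\<close> applies only to decidable trees. The first tree needs just a
  bounded quantifier. Membership in the tree of approximations g(n) is an unbounded existential
  statement, and only the infinite case of the first tree supplies the discontinuity, hence the test
  for zeros, that makes it a set. This forces the case distinction. \<open>NCC\<close> returns
  numbers only. Hence it selects codes of initial segments and never the sequences f_n, which are
  recovered separately for each n. In the other direction G is F + 1 because the neighbourhood of f
  must fix the first segment of f outside the tree; fixing F(f) bits would not exclude sequences
  that stay in the tree longer.\<close>

lemma has_ty_unique: "has_ty \<Delta> t \<sigma> \<Longrightarrow> has_ty \<Delta> t \<tau> \<Longrightarrow> \<sigma> = \<tau>"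
  by (induction t arbitrary: \<sigma> \<tau>) (fastforce+)

lemma has_ty_append: "has_ty \<Delta> t \<sigma> \<Longrightarrow> has_ty (\<Delta> @ \<Delta>') t \<sigma>"
  by (induction t arbitrary: \<sigma>) (auto simp: nth_append)

lemma has_ty_weaken: "has_ty [] t \<sigma> \<Longrightarrow> has_ty \<Delta> t \<sigma>"
  using has_ty_append[of "[]"] by simp

lemma has_ty_ty_of: "has_ty [] t \<sigma> \<Longrightarrow> ty_of t = \<sigma>"
  by (induction t arbitrary: \<sigma>) auto

lemma inst_tm_closed: "has_ty \<Delta> t \<sigma> \<Longrightarrow> length \<Delta> \<le> k \<Longrightarrow> inst_tm k u t = t"
  by (induction t arbitrary: \<sigma>) auto

lemma inst_closed: "wff \<Delta> A \<Longrightarrow> length \<Delta> \<le> k \<Longrightarrow> inst k u A = A"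
  by (induction A arbitrary: \<Delta> k) (auto simp: inst_tm_closed)

text \<open>The instantiated index belongs to the outermost binder, so its type stands at the end of
  the context; this position is stable when a quantifier is entered.\<close>

lemma has_ty_inst:
  "has_ty (\<Delta> @ [\<tau>]) t \<sigma> \<Longrightarrow> has_ty [] u \<tau> \<Longrightarrow> has_ty \<Delta> (inst_tm (length \<Delta>) u t) \<sigma>"
  by (induction t arbitrary: \<sigma>)
    (auto simp: nth_append less_Suc_eq intro: has_ty_weaken)

lemma wff_inst:
  "wff (\<Delta> @ [\<tau>]) A \<Longrightarrow> has_ty [] u \<tau> \<Longrightarrow> wff \<Delta> (inst (length \<Delta>) u A)"
proof (induction A arbitrary: \<Delta>)
  case (All \<sigma> A)
  then show ?case using All.IH[of "\<sigma> # \<Delta>"] by simp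
qed (auto simp: has_ty_inst)

lemma wff_inst0: "wff [\<tau>] A \<Longrightarrow> has_ty [] u \<tau> \<Longrightarrow> wff [] (inst 0 u A)"
  using wff_inst[of "[]"] by simp

lemma size_inst [simp]: "size (inst k u A) = size A"
  by (induction A arbitrary: k) auto

lemma finite_fv_tm [simp]: "finite (fv_tm t)"
  by (induction t) auto

lemma finite_fv [simp]: "finite (fv A)"
  by (induction A) auto

lemma has_ty_bind:
  "has_ty \<Delta> t \<sigma> \<Longrightarrow> has_ty (\<Delta> @ [snd v]) (bind_tm v (length \<Delta>) t) \<sigma>"
  by (induction t arbitrary: \<sigma>) (auto simp: nth_append)

lemma wff_bind: "wff \<Delta> A \<Longrightarrow> wff (\<Delta> @ [snd v]) (bind v (length \<Delta>) A)"
proof (induction A arbitrary: \<Delta>)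
  case (All \<sigma> A)
  then show ?case using All.IH[of "\<sigma> # \<Delta>"] by simp
qed (auto simp: has_ty_bind)

lemma wff_bind0: "wff [] A \<Longrightarrow> wff [snd v] (bind v 0 A)"
  using wff_bind[of "[]"] by simp

lemma fv_tm_bind: "fv_tm (bind_tm v k t) = fv_tm t - {v}"
  by (induction t) auto

lemma fv_bind: "fv (bind v k A) = fv A - {v}"
  by (induction A arbitrary: k) (auto simp: fv_tm_bind)

text \<open>Acts on all variables at once: replacing the variables of an axiom one after the other
  by \<open>subst\<close> could hit variables inside terms already inserted.\<close>

primrec msubst_tm :: "(var \<Rightarrow> tm) \<Rightarrow> tm \<Rightarrow> tm" where
  "msubst_tm \<theta> (Bv i) = Bv i"
| "msubst_tm \<theta> (Fv w) = \<theta> w"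
| "msubst_tm \<theta> (Con c) = Con c"
| "msubst_tm \<theta> (s \<cdot> t) = msubst_tm \<theta> s \<cdot> msubst_tm \<theta> t"

primrec msubst :: "(var \<Rightarrow> tm) \<Rightarrow> fm \<Rightarrow> fm" where
  "msubst \<theta> (s \<^bold>= t) = (msubst_tm \<theta> s \<^bold>= msubst_tm \<theta> t)"
| "msubst \<theta> (s \<^bold>< t) = (msubst_tm \<theta> s \<^bold>< msubst_tm \<theta> t)"
| "msubst \<theta> \<^bold>\<bottom> = \<^bold>\<bottom>"
| "msubst \<theta> (A \<^bold>\<longrightarrow> B) = (msubst \<theta> A \<^bold>\<longrightarrow> msubst \<theta> B)"
| "msubst \<theta> (All \<sigma> A) = All \<sigma> (msubst \<theta> A)"

definition typed_subst :: "(var \<Rightarrow> tm) \<Rightarrow> bool" where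
  "typed_subst \<theta> \<longleftrightarrow> (\<forall>v. has_ty [] (\<theta> v) (snd v))"

lemma typed_subst_Fv [simp]: "typed_subst Fv"
  by (simp add: typed_subst_def)

lemma typed_subst_upd: "typed_subst \<theta> \<Longrightarrow> has_ty [] u (snd v) \<Longrightarrow> typed_subst (\<theta>(v := u))"
  by (auto simp: typed_subst_def)

lemma msubst_tm_Fv [simp]: "msubst_tm Fv t = t"
  by (induction t) auto

lemma msubst_Fv [simp]: "msubst Fv A = A"
  by (induction A) auto

lemma has_ty_msubst: "typed_subst \<theta> \<Longrightarrow> has_ty \<Delta> t \<sigma> \<Longrightarrow> has_ty \<Delta> (msubst_tm \<theta> t) \<sigma>"
  by (induction t arbitrary: \<sigma>) (auto simp: typed_subst_def intro: has_ty_weaken)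

lemma wff_msubst: "typed_subst \<theta> \<Longrightarrow> wff \<Delta> A \<Longrightarrow> wff \<Delta> (msubst \<theta> A)"
  by (induction A arbitrary: \<Delta>) (auto simp: has_ty_msubst)

text \<open>Generalising over \<open>v\<close> and then instantiating amounts to redirecting the
  substitution at \<open>v\<close>. The values of a typed substitution have no loose indices, so
  \<open>inst_tm\<close> leaves them alone.\<close>

lemma inst_msubst_bind_tm:
  "typed_subst \<theta> \<Longrightarrow> has_ty \<Delta> t \<sigma> \<Longrightarrow> length \<Delta> = k \<Longrightarrow>
    inst_tm k u (msubst_tm \<theta> (bind_tm v k t)) = msubst_tm (\<theta>(v := u)) t"
  by (induction t arbitrary: \<sigma>) (auto simp: typed_subst_def intro!: inst_tm_closed)

lemma inst_msubst_bind:
  "typed_subst \<theta> \<Longrightarrow> wff \<Delta> A \<Longrightarrow> length \<Delta> = k \<Longrightarrow>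
    inst k u (msubst \<theta> (bind v k A)) = msubst (\<theta>(v := u)) A"
  by (induction A arbitrary: \<Delta> k) (auto simp: inst_msubst_bind_tm)

lemma inst_bind_Fv: "wff [] A \<Longrightarrow> inst 0 (Fv v) (bind v 0 A) = A"
  using inst_msubst_bind[of Fv "[]" A 0 "Fv v" v] by (simp add: fun_upd_idem)

lemma msubst_tm_cong: "(\<And>v. v \<in> fv_tm t \<Longrightarrow> \<theta> v = \<theta>' v) \<Longrightarrow> msubst_tm \<theta> t = msubst_tm \<theta>' t"
  by (induction t) auto

lemma msubst_cong: "(\<And>v. v \<in> fv A \<Longrightarrow> \<theta> v = \<theta>' v) \<Longrightarrow> msubst \<theta> A = msubst \<theta>' A"
  by (induction A) (auto intro: msubst_tm_cong)

section \<open>Equality formulas at higher types\<close>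

lemma foldl_App_inst:
  "inst_tm k u (foldl App s ts) = foldl App (inst_tm k u s) (map (inst_tm k u) ts)"
  by (induction ts arbitrary: s) auto

lemma foldr_All_inst:
  "inst k u (foldr All ts A) = foldr All ts (inst (k + length ts) u A)"
  by (induction ts arbitrary: k) auto

text \<open>Peels off the outermost quantifier for inductions on types; inside the \<open>n\<close>
  remaining ones its variable has index \<open>n\<close>.\<close>

lemma eq_Fun:
  "eq (\<sigma> \<Rrightarrow> \<tau>) s t = All \<sigma> (let n = length (arg_tys \<tau>); zs = map Bv (rev [0..<n]) in
     foldr All (arg_tys \<tau>) (foldl App (s \<cdot> Bv n) zs \<^bold>= foldl App (t \<cdot> Bv n) zs))"
  by (simp add: eq_def Let_def)

lemma inst_eq_body:
  assumes "has_ty [] s \<rho>" "has_ty [] t \<rho>'"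
  shows "inst 0 u (let n = length (arg_tys \<tau>); zs = map Bv (rev [0..<n]) in
     foldr All (arg_tys \<tau>) (foldl App (s \<cdot> Bv n) zs \<^bold>= foldl App (t \<cdot> Bv n) zs)) =
     eq \<tau> (s \<cdot> u) (t \<cdot> u)"
proof -
  have "map (inst_tm n u) (map Bv (rev [0..<n])) = map Bv (rev [0..<n])" for n
    by (simp add: comp_def) 
  then show ?thesis
    using assms
    by (simp add: Let_def foldr_All_inst foldl_App_inst eq_def inst_tm_closed del: map_map)
qed

lemma foldl_App_msubst:
  "msubst_tm \<theta> (foldl App s (map Bv is)) = foldl App (msubst_tm \<theta> s) (map Bv is)"
  by (induction "is" arbitrary: s) auto

lemma foldr_All_msubst: "msubst \<theta> (foldr All ts A) = foldr All ts (msubst \<theta> A)"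
  by (induction ts) auto

lemma msubst_eq: "msubst \<theta> (eq \<sigma> s t) = eq \<sigma> (msubst_tm \<theta> s) (msubst_tm \<theta> t)"
  by (simp add: eq_def Let_def foldr_All_msubst foldl_App_msubst)


lemma wff_foldr_All: "wff \<Delta> (foldr All ts A) \<longleftrightarrow> wff (rev ts @ \<Delta>) A"
  by (induction ts arbitrary: \<Delta>) auto

lemma has_ty_foldl_App:
  "has_ty \<Delta> s \<tau> \<Longrightarrow> list_all2 (has_ty \<Delta>) ts (arg_tys \<tau>) \<Longrightarrow> has_ty \<Delta> (foldl App s ts) N"
proof (induction \<tau> arbitrary: s ts)
  case (Fun \<sigma> \<tau>)
  obtain z zs where "ts = z # zs" "has_ty \<Delta> z \<sigma>" "list_all2 (has_ty \<Delta>) zs (arg_tys \<tau>)"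
    using Fun.prems(2) by (auto simp: list_all2_Cons2)
  moreover have "has_ty \<Delta> (s \<cdot> z) \<tau>" using Fun.prems(1) calculation(2) by auto
  ultimately show ?case using Fun.IH(2) by simp
qed auto

lemma wff_eq: "has_ty [] s \<tau> \<Longrightarrow> has_ty [] t \<tau> \<Longrightarrow> wff [] (eq \<tau> s t)"
  unfolding eq_def Let_def wff_foldr_All
  by (auto intro!: has_ty_foldl_App has_ty_weaken[of _ \<tau>] list_all2_all_nthI simp: rev_nth)

section \<open>Derivations from the empty context\<close>

text \<open>Weakening is not admissible: once \<open>x\<close> is free in the context, an axiom in which \<open>x\<close> is free
  can no longer be generalised. So contexts are lists that are turned into premises of
  implications proved in the empty context.\<close>

abbreviation imps :: "fm list \<Rightarrow> fm \<Rightarrow> fm" where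
  "imps \<Gamma> B \<equiv> foldr Imp \<Gamma> B"

lemma wff_imps: "wff \<Delta> (imps \<Gamma> B) \<longleftrightarrow> (\<forall>A\<in>set \<Gamma>. wff \<Delta> A) \<and> wff \<Delta> B"
  by (induction \<Gamma>) auto


lemma imps_intro:
  "T; set \<Gamma> \<union> \<Delta> \<turnstile> B \<Longrightarrow> \<forall>A\<in>set \<Gamma>. wff [] A \<Longrightarrow> T; \<Delta> \<turnstile> imps \<Gamma> B"
proof (induction \<Gamma> arbitrary: \<Delta>)
  case (Cons A \<Gamma>)
  then show ?case using Cons.IH[of "insert A \<Delta>"] by (auto intro: ImpI)
qed simp

lemma imps_elim:
  "T; \<Delta> \<turnstile> imps \<Gamma> B \<Longrightarrow> set \<Gamma> \<subseteq> \<Delta> \<Longrightarrow> \<forall>A\<in>set \<Gamma>. wff [] A \<Longrightarrow> T; \<Delta> \<turnstile> B"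
proof (induction \<Gamma>)
  case (Cons A \<Gamma>)
  then have "T; \<Delta> \<turnstile> A" by (auto intro: Assume)
  then show ?case using Cons ImpE[of T \<Delta> A "imps \<Gamma> B"] by simp
qed simp

text \<open>Replaces weakening: theorems of the empty context become premises of an implication and
  are detached afterwards, so no axiom is ever generalised under assumptions that mention its
  variables.\<close>

lemma cut:
  assumes "\<And>P. P \<in> set Ps \<Longrightarrow> T; {} \<turnstile> P" and "\<And>P. P \<in> set Ps \<Longrightarrow> wff [] P"
    and "\<forall>A\<in>set \<Gamma>. wff [] A" and "T; set Ps \<union> set \<Gamma> \<turnstile> B"
  shows "T; {} \<turnstile> imps \<Gamma> B"
proof -
  have "T; {} \<turnstile> imps Ps (imps \<Gamma> B)"
    using imps_intro[of T "Ps @ \<Gamma>" "{}" B] assms by auto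
  then show ?thesis
    using assms(1) by (induction Ps) (auto intro: ImpE)
qed

section \<open>Henkin sets\<close>

instance ty :: countable by countable_datatype
instance const :: countable by countable_datatype
instance tm :: countable by countable_datatype
instance fm :: countable by countable_datatype

text \<open>Weakening does hold for implications: the old one serves as a premise in a derivation
  that applies no quantifier rule.\<close>

lemma imps_mono:
  assumes "T; {} \<turnstile> imps L B" "set L \<subseteq> set \<Gamma>" "\<forall>A\<in>set \<Gamma>. wff [] A" "wff [] B"
  shows "T; {} \<turnstile> imps \<Gamma> B"
proof (rule cut[of "[imps L B]"])
  have "wff [] (imps L B)" using assms by (auto simp: wff_imps)
  then have "T; set [imps L B] \<union> set \<Gamma> \<turnstile> imps L B" by (auto intro: Assume)
  then show "T; set [imps L B] \<union> set \<Gamma> \<turnstile> B"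
    by (rule imps_elim) (use assms in auto)
qed (use assms in \<open>auto simp: wff_imps\<close>)

definition consistent :: "fm set \<Rightarrow> fm list \<Rightarrow> bool" where
  "consistent T \<Gamma> \<longleftrightarrow> \<not> (T; {} \<turnstile> imps \<Gamma> \<^bold>\<bottom>)"

lemma consistent_Neg:
  assumes con: "consistent T \<Gamma>" and wff: "\<forall>A\<in>set \<Gamma>. wff [] A" "wff [] B"
    and B: "\<not> consistent T (B # \<Gamma>)"
  shows "consistent T ((\<^bold>\<not> B) # \<Gamma>)"
proof (rule ccontr)
  assume nB: "\<not> consistent T ((\<^bold>\<not> B) # \<Gamma>)"
  let ?Ps = "[imps (B # \<Gamma>) \<^bold>\<bottom>, imps ((\<^bold>\<not> B) # \<Gamma>) \<^bold>\<bottom>]"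
  let ?\<Delta> = "set ?Ps \<union> set \<Gamma>"
  have wffP: "\<forall>P\<in>set ?Ps. wff [] P" using wff by (auto simp: wff_imps)
  have "T; insert (\<^bold>\<not> B) ?\<Delta> \<turnstile> imps ((\<^bold>\<not> B) # \<Gamma>) \<^bold>\<bottom>"
    by (rule Assume) (use wffP in auto)
  then have "T; insert (\<^bold>\<not> B) ?\<Delta> \<turnstile> \<^bold>\<bottom>"
    by (rule imps_elim) (use wff in auto)
  then have *: "T; ?\<Delta> \<turnstile> B" using wff(2) by (rule Contr)
  have "T; ?\<Delta> \<turnstile> B \<^bold>\<longrightarrow> imps \<Gamma> \<^bold>\<bottom>" by (rule Assume) (use wffP in auto)
  then have "T; ?\<Delta> \<turnstile> imps \<Gamma> \<^bold>\<bottom>" using * by (rule ImpE)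
  then have "T; ?\<Delta> \<turnstile> \<^bold>\<bottom>" by (rule imps_elim) (use wff in auto)
  then have "T; {} \<turnstile> imps \<Gamma> \<^bold>\<bottom>"
    by (rule cut[rotated 3]) (use B nB wff wffP in \<open>auto simp: consistent_def\<close>)
  then show False using con by (simp add: consistent_def)
qed

text \<open>A refutation of the new counterexample proves the instance at a fresh variable, hence
  the universal formula, against the assumption that it fails.\<close>

lemma consistent_witness:
  assumes con: "consistent T ((\<^bold>\<not> All \<sigma> C) # \<Gamma>)"
    and wff: "\<forall>A\<in>set \<Gamma>. wff [] A" "wff [] (All \<sigma> C)"
    and fresh: "\<forall>B\<in>set \<Gamma>. (x, \<sigma>) \<notin> fv B" "(x, \<sigma>) \<notin> fv C"
  shows "consistent T ((\<^bold>\<not> inst 0 (Fv (x, \<sigma>)) C) # (\<^bold>\<not> All \<sigma> C) # \<Gamma>)"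
proof (rule ccontr)
  let ?L = "(\<^bold>\<not> All \<sigma> C) # \<Gamma>"
  let ?C = "inst 0 (Fv (x, \<sigma>)) C"
  let ?P = "(\<^bold>\<not> C) \<^bold>\<longrightarrow> imps ?L \<^bold>\<bottom>"
  let ?\<Delta> = "set [All \<sigma> ?P] \<union> set ?L"
  assume "\<not> consistent T ((\<^bold>\<not> ?C) # ?L)"
  then have 1: "T; {} \<turnstile> (\<^bold>\<not> ?C) \<^bold>\<longrightarrow> imps ?L \<^bold>\<bottom>" by (simp add: consistent_def)
  have wffC: "wff [] ?C" using wff(2) by (auto intro: wff_inst0)
  have wffL: "\<forall>A\<in>set ?L. wff [] A" using wff by auto
  then have wfL: "wff [] (imps ?L \<^bold>\<bottom>)" by (simp only: wff_imps) simp
  have instP: "inst 0 (Fv (x, \<sigma>)) ?P = ((\<^bold>\<not> ?C) \<^bold>\<longrightarrow> imps ?L \<^bold>\<bottom>)"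
    using inst_closed[OF wfL, of 0 "Fv (x, \<sigma>)"] by (simp del: foldr.simps)
  have "fv (imps L \<^bold>\<bottom>) = (\<Union>B\<in>set L. fv B)" for L by (induction L) auto
  then have freshP: "(x, \<sigma>) \<notin> fv ?P" using fresh by auto
  \<comment> \<open>The refutation may contain \<open>x\<close> freely. It is generalised in the
    empty context before it serves as an assumption; otherwise \<open>x\<close> would be free in the
    context and block the later \<open>AllI\<close>.\<close>
  have "T; {} \<turnstile> All \<sigma> ?P"
    by (rule AllI[where x = x]) (use 1 instP freshP in \<open>simp_all del: foldr.simps\<close>)
  have wffP: "wff [] (All \<sigma> ?P)" 
  proof -
    have "wff [\<sigma>] A" if "wff [] A" for A
    proof -
      have "wff (\<Delta> @ [\<sigma>]) A" if "wff \<Delta> A" for \<Delta> using that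
        by (induction A arbitrary: \<Delta>) (auto intro: has_ty_append simp flip: append_Cons)
      from this[OF \<open>wff [] A\<close>] show ?thesis by simp
    qed
    from this[OF wfL] show ?thesis using wff(2) by simp
  qed
  have 2: "T; insert (\<^bold>\<not> ?C) ?\<Delta> \<turnstile> All \<sigma> ?P" by (rule Assume) (use wffP in auto)
  have "T; insert (\<^bold>\<not> ?C) ?\<Delta> \<turnstile> imps ((\<^bold>\<not> ?C) # ?L) \<^bold>\<bottom>"
    using AllE[OF 2, of "Fv (x, \<sigma>)"] instP by simp
  then have "T; insert (\<^bold>\<not> ?C) ?\<Delta> \<turnstile> \<^bold>\<bottom>"
    by (rule imps_elim) (use wffL wffC in auto)
  then have "T; ?\<Delta> \<turnstile> ?C" using wffC by (rule Contr)
  then have 3: "T; ?\<Delta> \<turnstile> All \<sigma> C"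
    by (rule AllI) (use fresh freshP in auto)
  have "T; ?\<Delta> \<turnstile> \<^bold>\<not> All \<sigma> C" by (rule Assume) (use wff in auto)
  then have "T; ?\<Delta> \<turnstile> \<^bold>\<bottom>" using 3 by (rule ImpE)
  then have "T; {} \<turnstile> imps ?L \<^bold>\<bottom>"
    by (rule cut[rotated 3]) (use \<open>T; {} \<turnstile> All \<sigma> ?P\<close> wffL wffP in auto)
  then show False using con by (simp add: consistent_def)
qed

lemma ex_fresh: "\<exists>x. \<forall>B\<in>set \<Gamma>. (x, \<sigma>) \<notin> fv B"
proof -
  have "finite {x. (x, \<sigma>) \<in> (\<Union>B\<in>set \<Gamma>. fv B)}"
    using finite_vimageI[of "\<Union>B\<in>set \<Gamma>. fv B" "\<lambda>x. (x, \<sigma>)"] by (simp add: vimage_def inj_on_def)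
  from ex_new_if_finite[OF infinite_UNIV_listI this] show ?thesis by auto
qed

text \<open>The truth conditions that a term model needs. Quantifiers range over all terms without
  loose indices. These may contain free variables, and the witnesses are variables too, so the
  language needs no new constants.\<close>

locale henkin =
  fixes T H :: "fm set"
  assumes H_wff: "B \<in> H \<Longrightarrow> wff [] B"
    and H_Falsum: "\<^bold>\<bottom> \<notin> H"
    and H_Imp: "wff [] B \<Longrightarrow> wff [] C \<Longrightarrow> (B \<^bold>\<longrightarrow> C) \<in> H \<longleftrightarrow> (B \<in> H \<longrightarrow> C \<in> H)"
    and H_All: "wff [\<sigma>] B \<Longrightarrow> All \<sigma> B \<in> H \<longleftrightarrow> (\<forall>t. has_ty [] t \<sigma> \<longrightarrow> inst 0 t B \<in> H)"
    and H_theorem: "T; {} \<turnstile> B \<Longrightarrow> wff [] B \<Longrightarrow> B \<in> H"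

lemma henkin_exists:
  assumes "\<not> (T; {} \<turnstile> A)" "wff [] A"
  shows "\<exists>H. henkin T H \<and> A \<notin> H"
proof -
  define good where "good \<Gamma> \<longleftrightarrow> consistent T \<Gamma> \<and> (\<forall>B\<in>set \<Gamma>. wff [] B)" for \<Gamma>
  \<comment> \<open>A formula that cannot be added is refuted, and a refuted universal formula
    receives a variable as counterexample at the same stage.\<close>
  define step where "step B \<Gamma> \<Gamma>' \<longleftrightarrow> set \<Gamma> \<subseteq> set \<Gamma>' \<and>
    (wff [] B \<longrightarrow> B \<in> set \<Gamma>' \<or> (\<^bold>\<not> B) \<in> set \<Gamma>' \<and>
      (\<forall>\<sigma> C. B = All \<sigma> C \<longrightarrow> (\<exists>x. (\<^bold>\<not> inst 0 (Fv (x, \<sigma>)) C) \<in> set \<Gamma>')))" for B \<Gamma> \<Gamma>'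
  have base: "good [\<^bold>\<not> A]"
  proof -
    have "T; {} \<turnstile> A" if *: "T; {} \<turnstile> \<^bold>\<not> \<^bold>\<not> A"
    proof -
      have "T; insert (\<^bold>\<not> A) {\<^bold>\<not> \<^bold>\<not> A} \<turnstile> \<^bold>\<bottom>"
        by (rule ImpE[of _ _ "\<^bold>\<not> A"]; rule Assume) (use assms in auto)
      then have "T; {\<^bold>\<not> \<^bold>\<not> A} \<turnstile> A" using assms(2) by (rule Contr)
      then have "T; {} \<turnstile> \<^bold>\<not> \<^bold>\<not> A \<^bold>\<longrightarrow> A" by (rule ImpI) (use assms in auto)
      then show ?thesis using * by (rule ImpE)
    qed
    then show ?thesis using assms by (auto simp: good_def consistent_def)
  qed
  have "\<exists>\<Gamma>'. good \<Gamma>' \<and> step B \<Gamma> \<Gamma>'" if good: "good \<Gamma>" for \<Gamma> B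
  proof (cases "wff [] B \<and> \<not> consistent T (B # \<Gamma>)")
    case False
    then show ?thesis using good
      by (intro exI[of _ "if wff [] B then B # \<Gamma> else \<Gamma>"]) (auto simp: good_def step_def)
  next
    case True
    then have con: "consistent T ((\<^bold>\<not> B) # \<Gamma>)"
      using good consistent_Neg by (auto simp: good_def)
    show ?thesis
    proof (cases "\<exists>\<sigma> C. B = All \<sigma> C")
      case False
      then show ?thesis using good con True
        by (intro exI[of _ "(\<^bold>\<not> B) # \<Gamma>"]) (auto simp: good_def step_def)
    next
      case BAll: True
      then obtain \<sigma> C where B: "B = All \<sigma> C" by auto
      obtain x where x: "\<forall>D\<in>set (C # \<Gamma>). (x, \<sigma>) \<notin> fv D" using ex_fresh by blast
      have "consistent T ((\<^bold>\<not> inst 0 (Fv (x, \<sigma>)) C) # (\<^bold>\<not> All \<sigma> C) # \<Gamma>)"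
        using consistent_witness[of T \<sigma> C \<Gamma> x] con x good True B by (auto simp: good_def)
      then show ?thesis using good True B wff_inst0[of \<sigma> C "Fv (x, \<sigma>)"]
        by (intro exI[of _ "(\<^bold>\<not> inst 0 (Fv (x, \<sigma>)) C) # (\<^bold>\<not> All \<sigma> C) # \<Gamma>"])
          (auto simp: good_def step_def)
    qed
  qed
  then have next_ex: "\<exists>\<Gamma>'. (good \<Gamma>' \<and> (Suc n = 0 \<longrightarrow> \<Gamma>' = [\<^bold>\<not> A])) \<and> step (from_nat n) \<Gamma> \<Gamma>'"
    if "good \<Gamma> \<and> (n = 0 \<longrightarrow> \<Gamma> = [\<^bold>\<not> A])" for \<Gamma> n
    using that by blast
  have "\<exists>\<Gamma>. good \<Gamma> \<and> (0 = (0::nat) \<longrightarrow> \<Gamma> = [\<^bold>\<not> A])" using base by blast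
  from dependent_nat_choice[of "\<lambda>n \<Gamma>. good \<Gamma> \<and> (n = 0 \<longrightarrow> \<Gamma> = [\<^bold>\<not> A])"
      "\<lambda>n. step (from_nat n)", OF this next_ex]
  obtain f where good: "\<And>n. good (f n)" and f0: "f 0 = [\<^bold>\<not> A]"
    and step: "\<And>n. step (from_nat n) (f n) (f (Suc n))" by blast
  define H where "H = (\<Union>n. set (f n))"
  have mono: "set (f m) \<subseteq> set (f n)" if "m \<le> n" for m n
    by (rule lift_Suc_mono_le[of "\<lambda>n. set (f n)"]) (use step that in \<open>auto simp: step_def\<close>)
  have wffH: "wff [] B" if "B \<in> H" for B using that good by (auto simp: H_def good_def)
  have fin: "\<exists>n. set L \<subseteq> set (f n)" if "set L \<subseteq> H" for L
    using that
  proof (induction L)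
    case (Cons B L)
    then obtain m n where "set L \<subseteq> set (f m)" "B \<in> set (f n)" by (auto simp: H_def)
    then have "set (B # L) \<subseteq> set (f (max m n))"
      using mono[of m "max m n"] mono[of n "max m n"] by auto
    then show ?case by blast
  qed simp
  have cons: "consistent T L" if "set L \<subseteq> H" for L
  proof (rule ccontr)
    obtain n where "set L \<subseteq> set (f n)" using fin[OF \<open>set L \<subseteq> H\<close>] by blast
    moreover assume "\<not> consistent T L"
    ultimately have "\<not> consistent T (f n)"
      using imps_mono[of T L "\<^bold>\<bottom>" "f n"] good[of n] by (auto simp: consistent_def good_def)
    then show False using good[of n] by (simp add: good_def)
  qed
  have compl: "B \<in> H \<or> (\<^bold>\<not> B) \<in> H \<and>
      (\<forall>\<sigma> C. B = All \<sigma> C \<longrightarrow> (\<exists>x. (\<^bold>\<not> inst 0 (Fv (x, \<sigma>)) C) \<in> H))" if "wff [] B" for B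
  proof -
    have "set (f (Suc (to_nat B))) \<subseteq> H" by (auto simp: H_def)
    then show ?thesis using step[of "to_nat B"] that unfolding step_def from_nat_to_nat by blast
  qed
  have ded: "B \<in> H" if "set L \<subseteq> H" "T; set L \<turnstile> B" "wff [] B" for L B
  proof (rule ccontr)
    assume "B \<notin> H"
    then have nB: "(\<^bold>\<not> B) \<in> H" using compl that by blast
    have L: "\<forall>A\<in>set L. wff [] A" using that wffH by auto
    have imp: "T; {} \<turnstile> imps L B" using imps_intro[of T L "{}" B] that L by simp
    let ?\<Delta> = "set [imps L B] \<union> set ((\<^bold>\<not> B) # L)"
    have wffi: "wff [] (imps L B)" using L that by (simp add: wff_imps)
    have "T; ?\<Delta> \<turnstile> imps L B" by (rule Assume) (use wffi in auto)
    then have 1: "T; ?\<Delta> \<turnstile> B" by (rule imps_elim) (use L in auto)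
    have "T; ?\<Delta> \<turnstile> \<^bold>\<not> B" by (rule Assume) (use that in auto)
    then have "T; ?\<Delta> \<turnstile> \<^bold>\<bottom>" using 1 by (rule ImpE)
    then have "T; {} \<turnstile> imps ((\<^bold>\<not> B) # L) \<^bold>\<bottom>"
      by (rule cut[rotated 3]) (use imp wffi L that in auto)
    moreover have "consistent T ((\<^bold>\<not> B) # L)" using cons[of "(\<^bold>\<not> B) # L"] that nB by simp
    ultimately show False by (simp add: consistent_def)
  qed
  have as: "T; set L \<turnstile> B" if "set L \<subseteq> H" "B \<in> set L" for L B
    using that wffH by (intro Assume) blast+
  have F: "\<^bold>\<bottom> \<notin> H" 
  proof
    assume "\<^bold>\<bottom> \<in> H"
    then have "consistent T [\<^bold>\<bottom>]" using cons[of "[\<^bold>\<bottom>]"] by simp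
    moreover have "T; {} \<turnstile> imps [\<^bold>\<bottom>] \<^bold>\<bottom>" by (simp add: ImpI Assume)
    ultimately show False by (simp add: consistent_def)
  qed
  have mp: "C \<in> H" if "(B \<^bold>\<longrightarrow> C) \<in> H" "B \<in> H" for B C
  proof (rule ded)
    show "T; set [B \<^bold>\<longrightarrow> C, B] \<turnstile> C" by (rule ImpE[of _ _ B]; rule as) (use that in auto)
  qed (use that wffH[of "B \<^bold>\<longrightarrow> C"] in auto)
  have "henkin T H"
  proof
    show "wff [] B" if "B \<in> H" for B using that by (rule wffH)
    show "\<^bold>\<bottom> \<notin> H" by (rule F)
    show "(B \<^bold>\<longrightarrow> C) \<in> H \<longleftrightarrow> (B \<in> H \<longrightarrow> C \<in> H)" if wff: "wff [] B" "wff [] C" for B C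
    proof (intro iffI impI)
      assume BC: "B \<in> H \<longrightarrow> C \<in> H"
      show "(B \<^bold>\<longrightarrow> C) \<in> H"
      proof (cases "C \<in> H")
        case True
        have "T; insert B {C} \<turnstile> C" using wff by (auto intro: Assume)
        then have "T; set [C] \<turnstile> B \<^bold>\<longrightarrow> C" using wff by (auto intro: ImpI)
        then show ?thesis using True wff by (intro ded[of "[C]"]) auto
      next
        case False
        then have "(\<^bold>\<not> B) \<in> H" using BC compl wff by blast
        have "T; insert (\<^bold>\<not> C) (insert B {\<^bold>\<not> B}) \<turnstile> \<^bold>\<bottom>"
          by (rule ImpE[of _ _ B]; rule Assume) (use wff in auto)
        then have "T; insert B {\<^bold>\<not> B} \<turnstile> C" using wff by (auto intro: Contr)
        then have "T; set [\<^bold>\<not> B] \<turnstile> B \<^bold>\<longrightarrow> C" using wff by (auto intro: ImpI)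
        then show ?thesis using \<open>(\<^bold>\<not> B) \<in> H\<close> wff by (intro ded[of "[\<^bold>\<not> B]"]) auto
      qed
    qed (use mp in blast)
    show "B \<in> H" if "T; {} \<turnstile> B" "wff [] B" for B using ded[of "[]"] that by simp
    show "All \<sigma> B \<in> H \<longleftrightarrow> (\<forall>t. has_ty [] t \<sigma> \<longrightarrow> inst 0 t B \<in> H)" if wff: "wff [\<sigma>] B" for \<sigma> B
    proof
      assume All: "All \<sigma> B \<in> H"
      show "\<forall>t. has_ty [] t \<sigma> \<longrightarrow> inst 0 t B \<in> H"
      proof (intro allI impI)
        fix t assume t: "has_ty [] t \<sigma>"
        have "T; set [All \<sigma> B] \<turnstile> All \<sigma> B" by (rule as) (use All in auto)
        then have "T; set [All \<sigma> B] \<turnstile> inst 0 t B" using t by (rule AllE)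
        then show "inst 0 t B \<in> H" using All wff t by (intro ded[of "[All \<sigma> B]"]) (auto intro: wff_inst0)
      qed
    next
      assume inst: "\<forall>t. has_ty [] t \<sigma> \<longrightarrow> inst 0 t B \<in> H"
      show "All \<sigma> B \<in> H"
      proof (rule ccontr)
        assume "All \<sigma> B \<notin> H"
        then obtain x where x: "(\<^bold>\<not> inst 0 (Fv (x, \<sigma>)) B) \<in> H"
          using compl[of "All \<sigma> B"] wff by auto
        have "inst 0 (Fv (x, \<sigma>)) B \<in> H" using inst by simp
        then show False using mp[OF x] F by blast
      qed
    qed
  qed
  moreover have "A \<notin> H"
  proof
    assume "A \<in> H"
    moreover have "(\<^bold>\<not> A) \<in> H" using f0 by (auto simp: H_def intro!: exI[of _ 0])
    ultimately show False using mp F by blast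
  qed
  ultimately show ?thesis by blast
qed

lemma eq_Fun_ex:
  assumes "has_ty [] s (\<sigma> \<Rrightarrow> \<tau>)" "has_ty [] t (\<sigma> \<Rrightarrow> \<tau>)"
  shows "\<exists>X. eq (\<sigma> \<Rrightarrow> \<tau>) s t = All \<sigma> X \<and> (\<forall>u. inst 0 u X = eq \<tau> (s \<cdot> u) (t \<cdot> u))"
  unfolding eq_Fun using inst_eq_body[OF assms] by blast

section \<open>Extensional structures and completeness\<close>

text \<open>An applicative structure whose elements need not be functions.
  \<open>extensional\<close> identifies functionals that agree everywhere, so the defined equality
  at each type means identity.\<close>

locale ext_model =
  fixes D :: "ty \<Rightarrow> 'a set" and ap :: "'a \<Rightarrow> 'a \<Rightarrow> 'a"  (infixl "\<odot>" 90)
    and cst :: "const \<Rightarrow> 'a" and lt :: "'a \<Rightarrow> 'a \<Rightarrow> bool"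
  assumes ap_D: "f \<in> D (\<sigma> \<Rrightarrow> \<tau>) \<Longrightarrow> a \<in> D \<sigma> \<Longrightarrow> f \<odot> a \<in> D \<tau>"
    and cst_D: "cst c \<in> D (const_ty c)"
    and D_nonempty: "D \<sigma> \<noteq> {}"
    and extensional: "f \<in> D (\<sigma> \<Rrightarrow> \<tau>) \<Longrightarrow> g \<in> D (\<sigma> \<Rrightarrow> \<tau>) \<Longrightarrow>
      (\<And>a. a \<in> D \<sigma> \<Longrightarrow> f \<odot> a = g \<odot> a) \<Longrightarrow> f = g"
begin

primrec eval :: "'a list \<Rightarrow> (var \<Rightarrow> 'a) \<Rightarrow> tm \<Rightarrow> 'a" where
  "eval e \<rho> (Bv i) = e ! i"
| "eval e \<rho> (Fv v) = \<rho> v"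
| "eval e \<rho> (Con c) = cst c"
| "eval e \<rho> (s \<cdot> t) = eval e \<rho> s \<odot> eval e \<rho> t"

primrec sat :: "'a list \<Rightarrow> (var \<Rightarrow> 'a) \<Rightarrow> fm \<Rightarrow> bool" where
  "sat e \<rho> (s \<^bold>= t) \<longleftrightarrow> eval e \<rho> s = eval e \<rho> t"
| "sat e \<rho> (s \<^bold>< t) \<longleftrightarrow> lt (eval e \<rho> s) (eval e \<rho> t)"
| "sat e \<rho> \<^bold>\<bottom> \<longleftrightarrow> False"
| "sat e \<rho> (A \<^bold>\<longrightarrow> B) \<longleftrightarrow> (sat e \<rho> A \<longrightarrow> sat e \<rho> B)"
| "sat e \<rho> (All \<sigma> A) \<longleftrightarrow> (\<forall>a\<in>D \<sigma>. sat (a # e) \<rho> A)"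

definition typed :: "(var \<Rightarrow> 'a) \<Rightarrow> bool" where
  "typed \<rho> \<longleftrightarrow> (\<forall>v. \<rho> v \<in> D (snd v))"

lemma typed_upd [simp]: "typed \<rho> \<Longrightarrow> a \<in> D (snd v) \<Longrightarrow> typed (\<rho>(v := a))"
  by (auto simp: typed_def)

lemma eval_D: "typed \<rho> \<Longrightarrow> has_ty [] t \<tau> \<Longrightarrow> eval [] \<rho> t \<in> D \<tau>"
  by (induction t arbitrary: \<tau>) (auto simp: typed_def cst_D intro: ap_D)

lemma eval_closed: "has_ty [] t \<tau> \<Longrightarrow> eval e \<rho> t = eval [] \<rho> t"
  by (induction t arbitrary: \<tau>) auto

lemma eval_cong: "(\<And>v. v \<in> fv_tm t \<Longrightarrow> \<rho> v = \<rho>' v) \<Longrightarrow> eval e \<rho> t = eval e \<rho>' t"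
  by (induction t) auto

lemma sat_cong: "(\<And>v. v \<in> fv A \<Longrightarrow> \<rho> v = \<rho>' v) \<Longrightarrow> sat e \<rho> A = sat e \<rho>' A"
proof (induction A arbitrary: e)
  case (Eq s t)
  then show ?case using eval_cong[of s \<rho> \<rho>'] eval_cong[of t \<rho> \<rho>'] by simp
next
  case (Less s t)
  then show ?case using eval_cong[of s \<rho> \<rho>'] eval_cong[of t \<rho> \<rho>'] by simp
qed auto

lemma eval_bind:
  "has_ty \<Delta> t \<tau> \<Longrightarrow> length \<Delta> = length e \<Longrightarrow>
    eval (e @ [a]) \<rho> (bind_tm v (length e) t) = eval e (\<rho>(v := a)) t"
  by (induction t arbitrary: \<tau>) (auto simp: nth_append)

lemma sat_bind:
  "wff \<Delta> A \<Longrightarrow> length \<Delta> = length e \<Longrightarrow>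
    sat (e @ [a]) \<rho> (bind v (length e) A) = sat e (\<rho>(v := a)) A"
proof (induction A arbitrary: \<Delta> e)
  case (All \<sigma> A)
  then have "sat ((b # e) @ [a]) \<rho> (bind v (length (b # e)) A) = sat (b # e) (\<rho>(v := a)) A" for b
    by (intro All.IH[of "\<sigma> # \<Delta>"]) auto
  then show ?case by (simp del: fun_upd_apply)
qed (auto simp: eval_bind simp del: fun_upd_apply)

lemma sat_bind0: "wff [] A \<Longrightarrow> sat [a] \<rho> (bind v 0 A) = sat [] (\<rho>(v := a)) A"
  using sat_bind[of "[]" A "[]"] by simp

lemma eval_subst: 
  "has_ty [] u \<tau> \<Longrightarrow> eval e \<rho> (subst_tm v u t) = eval e (\<rho>(v := eval [] \<rho> u)) t"
  by (induction t) (auto intro: eval_closed)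

lemma sat_subst:
  "has_ty [] u \<tau> \<Longrightarrow> sat e \<rho> (subst v u A) = sat e (\<rho>(v := eval [] \<rho> u)) A"
  by (induction A arbitrary: e) (auto simp: eval_subst)

lemma eval_inst:
  assumes "has_ty (\<Delta> @ [\<sigma>]) t \<tau>" "length \<Delta> = length e" "has_ty [] u \<sigma>"
  shows "eval (e @ [eval [] \<rho> u]) \<rho> t = eval e \<rho> (inst_tm (length e) u t)"
  using assms
  by (induction t arbitrary: \<tau>) (auto simp: nth_append less_Suc_eq intro: eval_closed[symmetric])

lemma sat_inst:
  assumes "wff (\<Delta> @ [\<sigma>]) A" "length \<Delta> = length e" "has_ty [] u \<sigma>"
  shows "sat (e @ [eval [] \<rho> u]) \<rho> A = sat e \<rho> (inst (length e) u A)"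
  using assms
proof (induction A arbitrary: \<Delta> e)
  case (All \<tau> A)
  then have "sat ((b # e) @ [eval [] \<rho> u]) \<rho> A = sat (b # e) \<rho> (inst (length (b # e)) u A)" for b
    by (intro All.IH[of "\<tau> # \<Delta>"]) auto
  then show ?case by simp
qed (auto simp: eval_inst)

lemma sat_inst0:
  "wff [\<sigma>] A \<Longrightarrow> has_ty [] u \<sigma> \<Longrightarrow> sat [eval [] \<rho> u] \<rho> A = sat [] \<rho> (inst 0 u A)"
  using sat_inst[of "[]" \<sigma> A "[]"] by simp

lemma eval_msubst:
  "typed_subst \<theta> \<Longrightarrow> eval e \<rho> (msubst_tm \<theta> t) = eval e (\<lambda>v. eval [] \<rho> (\<theta> v)) t"
  by (induction t) (auto simp: typed_subst_def intro: eval_closed)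

lemma sat_msubst:
  "typed_subst \<theta> \<Longrightarrow> sat e \<rho> (msubst \<theta> A) = sat e (\<lambda>v. eval [] \<rho> (\<theta> v)) A"
  by (induction A arbitrary: e) (auto simp: eval_msubst)

text \<open>A fresh variable replaces the outermost index, so the induction hypothesis applies to
  both terms applied to it; extensionality of the structure then combines the values.\<close>

lemma sat_eq:
  assumes "typed \<rho>" "has_ty [] s \<sigma>" "has_ty [] t \<sigma>"
  shows "sat [] \<rho> (eq \<sigma> s t) \<longleftrightarrow> eval [] \<rho> s = eval [] \<rho> t"
  using assms
proof (induction \<sigma> arbitrary: s t \<rho>)
  case N
  then show ?case by (simp add: eq_def)
next
  case (Fun \<sigma> \<tau>)
  obtain X where X: "eq (\<sigma> \<Rrightarrow> \<tau>) s t = All \<sigma> X" "inst 0 u X = eq \<tau> (s \<cdot> u) (t \<cdot> u)" for u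
    using eq_Fun_ex[OF Fun.prems(2,3)] by blast
  have wff: "wff [\<sigma>] X" using wff_eq[OF Fun.prems(2,3)] X(1) by simp
  obtain x where "\<forall>B\<in>set [s \<^bold>= t, X]. (x, \<sigma>) \<notin> fv B" using ex_fresh by blast
  then have x: "(x, \<sigma>) \<notin> fv_tm s" "(x, \<sigma>) \<notin> fv_tm t" "(x, \<sigma>) \<notin> fv X" by auto
  have ty: "has_ty [] (s \<cdot> Fv (x, \<sigma>)) \<tau>" "has_ty [] (t \<cdot> Fv (x, \<sigma>)) \<tau>"
    using Fun.prems by auto
  have "sat [a] \<rho> X \<longleftrightarrow> eval [] \<rho> s \<odot> a = eval [] \<rho> t \<odot> a" if "a \<in> D \<sigma>" for a
  proof -
    let ?\<rho> = "\<rho>((x, \<sigma>) := a)"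
    have "sat [a] \<rho> X = sat [a] ?\<rho> X" by (rule sat_cong) (use x in auto)
    also have "\<dots> = sat [] ?\<rho> (eq \<tau> (s \<cdot> Fv (x, \<sigma>)) (t \<cdot> Fv (x, \<sigma>)))"
      using sat_inst0[OF wff, of "Fv (x, \<sigma>)" ?\<rho>] X(2) by simp
    also have "\<dots> \<longleftrightarrow> eval [] ?\<rho> s \<odot> a = eval [] ?\<rho> t \<odot> a"
      using Fun.IH(2)[OF _ ty, of ?\<rho>] Fun.prems(1) that by (simp del: fun_upd_apply) (simp)
    also have "eval [] ?\<rho> s = eval [] \<rho> s" by (rule eval_cong) (use x in auto)
    also have "eval [] ?\<rho> t = eval [] \<rho> t" by (rule eval_cong) (use x in auto)
    finally show ?thesis .
  qed
  then show ?case
    using extensional[OF eval_D eval_D, OF Fun.prems(1,2,1,3)] by (auto simp: X(1))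
qed

end

section \<open>The term model of a Henkin set\<close>

locale henkin_eq = henkin +
  assumes arithmetic: "arithmetic_axioms \<subseteq> T" and extensionality: "extensionality_axioms \<subseteq> T"
begin

text \<open>In the empty context every free variable may be generalised by \<open>AllI\<close>; the
  universal formula lies in \<open>H\<close> and can be instantiated there by arbitrary
  terms.\<close>

lemma theorem_instance:
  assumes "T; {} \<turnstile> B" "wff [] B" "typed_subst \<theta>"
  shows "msubst \<theta> B \<in> H"
proof -
  have "msubst \<theta> B \<in> H" if "T; {} \<turnstile> B" "wff [] B" "{v \<in> fv B. \<theta> v \<noteq> Fv v} \<subseteq> set vs" for vs B
    using that
  proof (induction vs arbitrary: B)
    case Nil
    then have "msubst \<theta> B = msubst Fv B" by (intro msubst_cong) auto
    then show ?case using Nil by (simp add: H_theorem)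
  next
    case (Cons v vs)
    have "T; {} \<turnstile> All (snd v) (bind v 0 B)"
      by (rule AllI[where x = "fst v"]) (use Cons.prems in \<open>auto simp: inst_bind_Fv fv_bind\<close>)
    then have "msubst \<theta> (All (snd v) (bind v 0 B)) \<in> H"
      using Cons.prems by (intro Cons.IH) (auto simp: wff_bind0 fv_bind)
    moreover have "wff [snd v] (msubst \<theta> (bind v 0 B))"
      using Cons.prems assms(3) by (simp add: wff_msubst wff_bind0)
    moreover have "has_ty [] (\<theta> v) (snd v)" using assms(3) unfolding typed_subst_def by blast
    ultimately have "inst 0 (\<theta> v) (msubst \<theta> (bind v 0 B)) \<in> H" by (simp add: H_All)
    then show ?case
      using inst_msubst_bind[OF assms(3) Cons.prems(2), of 0 "\<theta> v" v] by simp
  qed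
  moreover obtain vs where "set vs = fv B" using finite_list[of "fv B"] by auto
  ultimately show ?thesis using assms by blast
qed

lemma axiom_instance: "A \<in> T \<Longrightarrow> wff [] A \<Longrightarrow> typed_subst \<theta> \<Longrightarrow> msubst \<theta> A \<in> H"
  by (intro theorem_instance Axiom)

text \<open>Equality in \<open>H\<close> unfolded along the type, so that the laws of an equivalence
  can be proved by induction on types.\<close>

primrec sim :: "ty \<Rightarrow> tm \<Rightarrow> tm \<Rightarrow> bool" where
  "sim N s t \<longleftrightarrow> (s \<^bold>= t) \<in> H"
| "sim (\<sigma> \<Rrightarrow> \<tau>) s t \<longleftrightarrow> (\<forall>u. has_ty [] u \<sigma> \<longrightarrow> sim \<tau> (s \<cdot> u) (t \<cdot> u))"

lemma eq_iff_sim: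
  "has_ty [] s \<sigma> \<Longrightarrow> has_ty [] t \<sigma> \<Longrightarrow> eq \<sigma> s t \<in> H \<longleftrightarrow> sim \<sigma> s t"
proof (induction \<sigma> arbitrary: s t)
  case (Fun \<sigma> \<tau>)
  obtain X where X: "eq (\<sigma> \<Rrightarrow> \<tau>) s t = All \<sigma> X" "inst 0 u X = eq \<tau> (s \<cdot> u) (t \<cdot> u)" for u
    using eq_Fun_ex[OF Fun.prems] by blast
  have "wff [\<sigma>] X" using wff_eq[OF Fun.prems] X(1) by simp
  then have "eq (\<sigma> \<Rrightarrow> \<tau>) s t \<in> H \<longleftrightarrow> (\<forall>u. has_ty [] u \<sigma> \<longrightarrow> eq \<tau> (s \<cdot> u) (t \<cdot> u) \<in> H)"
    unfolding X by (simp add: H_All X)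
  moreover have "eq \<tau> (s \<cdot> u) (t \<cdot> u) \<in> H \<longleftrightarrow> sim \<tau> (s \<cdot> u) (t \<cdot> u)" if "has_ty [] u \<sigma>" for u
    using that Fun.prems by (intro Fun.IH(2)) auto
  ultimately show ?case by simp
qed (simp add: eq_def)

lemma eq_axioms_H:
  assumes "has_ty [] s N" "has_ty [] t N" "has_ty [] r N" "has_ty [] u N"
  shows "(s \<^bold>= s) \<in> H" "(s \<^bold>= t) \<in> H \<Longrightarrow> (t \<^bold>= s) \<in> H"
    "(s \<^bold>= t) \<in> H \<Longrightarrow> (t \<^bold>= r) \<in> H \<Longrightarrow> (s \<^bold>= r) \<in> H"
    "(s \<^bold>= t) \<in> H \<Longrightarrow> (r \<^bold>= u) \<in> H \<Longrightarrow> (s \<^bold>< r) \<in> H \<Longrightarrow> (t \<^bold>< u) \<in> H"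
proof -
  let ?x = "Fv (''x'', N)" and ?y = "Fv (''y'', N)" and ?z = "Fv (''z'', N)" and ?u = "Fv (''u'', N)"
  let ?\<theta> = "Fv((''x'', N) := s, (''y'', N) := t, (''z'', N) := r, (''u'', N) := u)"
  have \<theta>: "typed_subst ?\<theta>" using assms by (intro typed_subst_upd) auto
  have *: "msubst ?\<theta> A \<in> H" if "A \<in> arithmetic_axioms" "wff [] A" for A
    using axiom_instance[OF _ that(2) \<theta>] that(1) arithmetic by auto
  show "(s \<^bold>= s) \<in> H" using *[of "?x \<^bold>= ?x"] by (simp add: arithmetic_axioms_def Let_def)
  show "(s \<^bold>= t) \<in> H \<Longrightarrow> (t \<^bold>= s) \<in> H"
    using *[of "?x \<^bold>= ?y \<^bold>\<longrightarrow> ?y \<^bold>= ?x"] assms by (simp add: arithmetic_axioms_def Let_def H_Imp)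
  show "(s \<^bold>= t) \<in> H \<Longrightarrow> (t \<^bold>= r) \<in> H \<Longrightarrow> (s \<^bold>= r) \<in> H"
    using *[of "?x \<^bold>= ?y \<^bold>\<longrightarrow> ?y \<^bold>= ?z \<^bold>\<longrightarrow> ?x \<^bold>= ?z"] assms
    by (simp add: arithmetic_axioms_def Let_def H_Imp)
  show "(s \<^bold>= t) \<in> H \<Longrightarrow> (r \<^bold>= u) \<in> H \<Longrightarrow> (s \<^bold>< r) \<in> H \<Longrightarrow> (t \<^bold>< u) \<in> H"
    using *[of "?x \<^bold>= ?y \<^bold>\<longrightarrow> ?z \<^bold>= ?u \<^bold>\<longrightarrow> ?x \<^bold>< ?z \<^bold>\<longrightarrow> ?y \<^bold>< ?u"] assms
    by (simp add: arithmetic_axioms_def Let_def H_Imp)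
qed

lemma sim_refl: "has_ty [] s \<sigma> \<Longrightarrow> sim \<sigma> s s"
proof (induction \<sigma> arbitrary: s)
  case N
  then show ?case using eq_axioms_H(1)[of s s s s] by simp
next
  case (Fun \<sigma> \<tau>)
  show ?case unfolding sim.simps
  proof (intro allI impI)
    fix u assume "has_ty [] u \<sigma>"
    then show "sim \<tau> (s \<cdot> u) (s \<cdot> u)" using Fun.prems by (intro Fun.IH(2)) auto
  qed
qed

lemma sim_sym: "has_ty [] s \<sigma> \<Longrightarrow> has_ty [] t \<sigma> \<Longrightarrow> sim \<sigma> s t \<Longrightarrow> sim \<sigma> t s"
proof (induction \<sigma> arbitrary: s t)
  case N
  then show ?case using eq_axioms_H(2)[of s t s s] by simp
next
  case (Fun \<sigma> \<tau>)
  show ?case unfolding sim.simps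
  proof (intro allI impI)
    fix u assume "has_ty [] u \<sigma>"
    then show "sim \<tau> (t \<cdot> u) (s \<cdot> u)"
      using Fun.prems by (intro Fun.IH(2)[of "s \<cdot> u" "t \<cdot> u"]) auto
  qed
qed

lemma sim_trans:
  "has_ty [] s \<sigma> \<Longrightarrow> has_ty [] t \<sigma> \<Longrightarrow> has_ty [] r \<sigma> \<Longrightarrow> sim \<sigma> s t \<Longrightarrow> sim \<sigma> t r \<Longrightarrow> sim \<sigma> s r"
proof (induction \<sigma> arbitrary: s t r)
  case N
  then show ?case using eq_axioms_H(3)[of s t r s] by simp
next
  case (Fun \<sigma> \<tau>)
  show ?case unfolding sim.simps
  proof (intro allI impI)
    fix u assume "has_ty [] u \<sigma>"
    then show "sim \<tau> (s \<cdot> u) (r \<cdot> u)"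
      using Fun.prems by (intro Fun.IH(2)[of "s \<cdot> u" "t \<cdot> u" "r \<cdot> u"]) auto
  qed
qed

text \<open>Here the extensionality axioms enter: \<open>sim\<close> compares operators pointwise
  and by itself says nothing about applying one operator to equal arguments.\<close>

lemma sim_app:
  assumes "has_ty [] s \<sigma>" "has_ty [] t \<sigma>" "has_ty [] r (\<sigma> \<Rrightarrow> \<tau>)" "sim \<sigma> s t"
  shows "sim \<tau> (r \<cdot> s) (r \<cdot> t)"
proof -
  let ?x = "Fv (''x'', \<sigma>)" and ?y = "Fv (''y'', \<sigma>)" and ?f = "Fv (''phi'', \<sigma> \<Rrightarrow> \<tau>)"
  let ?\<theta> = "Fv((''x'', \<sigma>) := s, (''y'', \<sigma>) := t, (''phi'', \<sigma> \<Rrightarrow> \<tau>) := r)"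
  let ?A = "eq \<sigma> ?x ?y \<^bold>\<longrightarrow> eq \<tau> (?f \<cdot> ?x) (?f \<cdot> ?y)"
  have "?A \<in> T" using extensionality by (auto simp: extensionality_axioms_def)
  moreover have "wff [] ?A" by (auto intro!: wff_eq)
  moreover have "typed_subst ?\<theta>" using assms by (intro typed_subst_upd) auto
  ultimately have "msubst ?\<theta> ?A \<in> H" by (rule axiom_instance)
  then have "(eq \<sigma> s t \<^bold>\<longrightarrow> eq \<tau> (r \<cdot> s) (r \<cdot> t)) \<in> H" by (simp add: msubst_eq)
  moreover have ty: "has_ty [] (r \<cdot> s) \<tau>" "has_ty [] (r \<cdot> t) \<tau>" using assms by auto
  ultimately show ?thesis using assms by (simp add: H_Imp wff_eq eq_iff_sim del: has_ty.simps)
qed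

definition cls :: "tm \<Rightarrow> tm set" where
  "cls t = {u. \<exists>\<sigma>. has_ty [] t \<sigma> \<and> has_ty [] u \<sigma> \<and> sim \<sigma> t u}"

text \<open>Application of classes is not told any type, so the representative is chosen without
  one; the type is recovered from the class, all of whose terms share it.\<close>

definition rep :: "tm set \<Rightarrow> tm" where
  "rep a = (SOME t. cls t = a \<and> (\<exists>\<sigma>. has_ty [] t \<sigma>))"

definition "mD \<sigma> = cls ` {t. has_ty [] t \<sigma>}"
definition "mapp a b = cls (rep a \<cdot> rep b)"
definition "mcst c = cls (Con c)"
definition "mlt a b \<longleftrightarrow> (rep a \<^bold>< rep b) \<in> H"

lemma cls_eq: 
  assumes "has_ty [] s \<sigma>" "has_ty [] t \<sigma>"
  shows "cls s = cls t \<longleftrightarrow> sim \<sigma> s t"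
proof
  assume "cls s = cls t"
  moreover have "t \<in> cls t" using assms sim_refl by (auto simp: cls_def)
  ultimately have "t \<in> cls s" by simp
  then show "sim \<sigma> s t" using assms by (auto simp: cls_def dest: has_ty_unique[OF assms(1)])
next
  assume st: "sim \<sigma> s t"
  have "u \<in> cls s \<longleftrightarrow> u \<in> cls t" for u
  proof -
    have "u \<in> cls r \<longleftrightarrow> has_ty [] u \<sigma> \<and> sim \<sigma> r u" if "has_ty [] r \<sigma>" for r
      using that by (auto simp: cls_def dest: has_ty_unique[OF that])
    then show ?thesis
      using assms st sim_sym[of s \<sigma> t] sim_trans[of s \<sigma> t u] sim_trans[of t \<sigma> s u] by blast
  qed
  then show "cls s = cls t" by blast
qed

lemma rep_cls:
  assumes "has_ty [] t \<sigma>"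
  shows "has_ty [] (rep (cls t)) \<sigma>" "sim \<sigma> (rep (cls t)) t" "cls (rep (cls t)) = cls t"
proof -
  have *: "cls (rep (cls t)) = cls t \<and> (\<exists>\<sigma>. has_ty [] (rep (cls t)) \<sigma>)"
    unfolding rep_def by (rule someI[of _ t]) (use assms in auto)
  then show "cls (rep (cls t)) = cls t" by simp
  have "t \<in> cls (rep (cls t))" using * assms sim_refl by (auto simp: cls_def)
  then show "has_ty [] (rep (cls t)) \<sigma>" "sim \<sigma> (rep (cls t)) t"
    using assms by (auto simp: cls_def dest: has_ty_unique[OF assms])
qed

lemma mapp_cls:
  assumes "has_ty [] s (\<sigma> \<Rrightarrow> \<tau>)" "has_ty [] t \<sigma>"
  shows "mapp (cls s) (cls t) = cls (s \<cdot> t)"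
proof -
  let ?s = "rep (cls s)" and ?t = "rep (cls t)"
  note s = rep_cls(1,2)[OF assms(1)] and t = rep_cls(1,2)[OF assms(2)]
  have "sim \<tau> (?s \<cdot> ?t) (s \<cdot> ?t)" using s t by simp
  moreover have "sim \<tau> (s \<cdot> ?t) (s \<cdot> t)" using sim_app t assms by blast
  ultimately have "sim \<tau> (?s \<cdot> ?t) (s \<cdot> t)"
    using s t assms by (intro sim_trans[of "?s \<cdot> ?t" \<tau> "s \<cdot> ?t" "s \<cdot> t"]) auto
  then show ?thesis
    unfolding mapp_def using s t assms by (subst cls_eq[of _ \<tau>]) auto
qed

lemma mlt_cls:
  assumes "has_ty [] s N" "has_ty [] t N"
  shows "mlt (cls s) (cls t) \<longleftrightarrow> (s \<^bold>< t) \<in> H"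
proof -
  let ?s = "rep (cls s)" and ?t = "rep (cls t)"
  note s = rep_cls(1,2)[OF assms(1)] and t = rep_cls(1,2)[OF assms(2)]
  have st: "(?s \<^bold>= s) \<in> H" "(?t \<^bold>= t) \<in> H" using s(2) t(2) by auto
  then have "(s \<^bold>= ?s) \<in> H" "(t \<^bold>= ?t) \<in> H"
    using sim_sym[OF s(1) assms(1)] sim_sym[OF t(1) assms(2)] by auto
  then show ?thesis
    unfolding mlt_def
    using st eq_axioms_H(4)[OF s(1) assms(1) t(1) assms(2)]
      eq_axioms_H(4)[OF assms(1) s(1) assms(2) t(1)] by blast
qed

sublocale M: ext_model mD mapp mcst mlt
proof
  show "mapp f a \<in> mD \<tau>" if f: "f \<in> mD (\<sigma> \<Rrightarrow> \<tau>)" and a: "a \<in> mD \<sigma>" for f a \<sigma> \<tau>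
  proof -
    obtain s t where *: "f = cls s" "has_ty [] s (\<sigma> \<Rrightarrow> \<tau>)" "a = cls t" "has_ty [] t \<sigma>"
      using f a by (auto simp: mD_def)
    then have "has_ty [] (s \<cdot> t) \<tau>" by auto
    then show ?thesis using * by (auto simp: mD_def mapp_cls)
  qed
  show "mcst c \<in> mD (const_ty c)" for c by (simp add: mcst_def mD_def)
  have "has_ty [] (Fv ([], \<sigma>)) \<sigma>" for \<sigma> by simp
  then show "mD \<sigma> \<noteq> {}" for \<sigma> unfolding mD_def by blast
  show "f = g" if f: "f \<in> mD (\<sigma> \<Rrightarrow> \<tau>)" and g: "g \<in> mD (\<sigma> \<Rrightarrow> \<tau>)"
    and eq: "\<And>a. a \<in> mD \<sigma> \<Longrightarrow> mapp f a = mapp g a" for f g \<sigma> \<tau>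
  proof -
    obtain s t where st: "f = cls s" "has_ty [] s (\<sigma> \<Rrightarrow> \<tau>)" "g = cls t" "has_ty [] t (\<sigma> \<Rrightarrow> \<tau>)"
      using f g by (auto simp: mD_def)
    have "sim \<tau> (s \<cdot> u) (t \<cdot> u)" if u: "has_ty [] u \<sigma>" for u
    proof -
      have "cls (s \<cdot> u) = cls (t \<cdot> u)"
        using eq[of "cls u"] u st by (simp add: mD_def mapp_cls[of _ \<sigma> \<tau>])
      then show ?thesis using u st by (subst (asm) cls_eq[of _ \<tau>]) auto
    qed
    then show ?thesis using st by (simp add: cls_eq[of s "\<sigma> \<Rrightarrow> \<tau>" t])
  qed
qed

abbreviation "\<rho>H \<equiv> \<lambda>v. cls (Fv v)"

lemma eval_cls: "has_ty [] t \<sigma> \<Longrightarrow> M.eval [] \<rho>H t = cls t"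
  by (induction t arbitrary: \<sigma>) (auto simp: mcst_def mapp_cls)

text \<open>By induction on size: an instance of a quantified formula is smaller, though not a
  subformula. The elements of the model are exactly the classes of terms.\<close>

lemma truth: "wff [] A \<Longrightarrow> M.sat [] \<rho>H A \<longleftrightarrow> A \<in> H"
proof (induction "size A" arbitrary: A rule: less_induct)
  case less
  show ?case
  proof (cases A)
    case (Eq s t)
    then show ?thesis using less.prems by (simp add: eval_cls[of _ N] cls_eq[of _ N])
  next
    case (Less s t)
    then show ?thesis using less.prems by (simp add: eval_cls[of _ N] mlt_cls)
  next
    case Falsum
    then show ?thesis by (simp add: H_Falsum)
  next
    case (Imp B C)
    then show ?thesis using less by (simp add: H_Imp)
  next
    case (All \<sigma> B)
    then have wff: "wff [\<sigma>] B" using less.prems by simp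
    have "M.sat [] \<rho>H A \<longleftrightarrow> (\<forall>t. has_ty [] t \<sigma> \<longrightarrow> M.sat [cls t] \<rho>H B)"
      by (auto simp: All mD_def)
    also have "\<dots> \<longleftrightarrow> (\<forall>t. has_ty [] t \<sigma> \<longrightarrow> inst 0 t B \<in> H)"
    proof -
      have "M.sat [cls t] \<rho>H B \<longleftrightarrow> inst 0 t B \<in> H" if "has_ty [] t \<sigma>" for t
        using M.sat_inst0[OF wff that, of \<rho>H] eval_cls[OF that] less.hyps[of "inst 0 t B"]
          wff_inst0[OF wff that] by (simp add: All)
      then show ?thesis by blast
    qed
    also have "\<dots> \<longleftrightarrow> A \<in> H" by (simp add: All H_All[OF wff])
    finally show ?thesis .
  qed
qed

text \<open>Every environment is named by a substitution of terms, under which the axiom becomes an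
  instance lying in \<open>H\<close>.\<close>

lemma axiom_valid:
  assumes "A \<in> T" "wff [] A" "M.typed \<rho>"
  shows "M.sat [] \<rho> A"
proof -
  have "\<exists>t. has_ty [] t (snd v) \<and> \<rho> v = cls t" for v :: var
  proof -
    have "\<rho> v \<in> mD (snd v)" using assms(3) unfolding M.typed_def by blast
    then show ?thesis by (auto simp: mD_def)
  qed
  then obtain \<theta> where \<theta>: "has_ty [] (\<theta> v) (snd v)" "\<rho> v = cls (\<theta> v)" for v by metis
  then have ts: "typed_subst \<theta>" by (simp add: typed_subst_def)
  have "\<rho> = (\<lambda>v. M.eval [] \<rho>H (\<theta> v))" using \<theta>(2) eval_cls[OF \<theta>(1)] by presburger
  then have "M.sat [] \<rho> A = M.sat [] \<rho>H (msubst \<theta> A)" using M.sat_msubst[OF ts] by simp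
  then show ?thesis using axiom_instance[OF assms(1,2) ts] truth wff_msubst[OF ts assms(2)] by simp
qed

end

text \<open>The countermodel consists of classes of terms. This fixes the carrier
  \<open>tm set\<close> and makes the domain of numbers countable, so that it can later be
  enumerated.\<close>

theorem completeness:
  assumes "arithmetic_axioms \<subseteq> T" "extensionality_axioms \<subseteq> T" "wff [] A"
    and valid: "\<And>(D :: ty \<Rightarrow> tm set set) ap cst lt \<rho>. ext_model D ap cst \<Longrightarrow> countable (D N) \<Longrightarrow>
      (\<And>B \<rho>. B \<in> T \<Longrightarrow> wff [] B \<Longrightarrow> ext_model.typed D \<rho> \<Longrightarrow> ext_model.sat D ap cst lt [] \<rho> B) \<Longrightarrow>
      ext_model.typed D \<rho> \<Longrightarrow> ext_model.sat D ap cst lt [] \<rho> A"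
  shows "T \<turnstile> A"
  unfolding proves_def
proof (rule ccontr)
  assume "\<not> (T; {} \<turnstile> A)"
  then obtain H where "henkin T H" and A: "A \<notin> H" using henkin_exists assms(3) by blast
  then interpret henkin_eq T H
    using assms(1,2) by (simp add: henkin_eq_def henkin_eq_axioms_def)
  have "M.typed \<rho>H" by (auto simp: M.typed_def mD_def)
  moreover have "countable (mD N)" by (simp add: mD_def)
  ultimately have "M.sat [] \<rho>H A"
    using valid[OF M.ext_model_axioms] axiom_valid by blast
  then show False using A truth[OF assms(3)] by simp
qed

text \<open>Unfolding \<open>fun_upd_apply\<close> under eta-expansion would turn environments into conditionals that
  no longer match the facts about \<open>sat\<close>.\<close>

declare fun_upd_apply [simp del] fun_upd_same [simp] fun_upd_other [simp]

section \<open>Models of the base theory\<close>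

lemma has_ty_subst: "has_ty \<Delta> t \<tau> \<Longrightarrow> has_ty [] u (snd v) \<Longrightarrow> has_ty \<Delta> (subst_tm v u t) \<tau>"
  by (induction t arbitrary: \<tau>) (auto intro: has_ty_weaken)

lemma wff_subst: "wff \<Delta> A \<Longrightarrow> has_ty [] u (snd v) \<Longrightarrow> wff \<Delta> (subst v u A)"
  by (induction A arbitrary: \<Delta>) (auto simp: has_ty_subst)

lemma quantifier_free_subst: "quantifier_free (subst v u A) = quantifier_free A"
  by (induction A) auto

lemma fv_tm_subst: "fv_tm (subst_tm v u t) \<subseteq> fv_tm t \<union> fv_tm u"
  by (induction t) auto

lemma fv_subst: "fv (subst v u A) \<subseteq> fv A \<union> fv_tm u"
proof (induction A)
  case (Eq s t)
  then show ?case using fv_tm_subst[of v u s] fv_tm_subst[of v u t] by auto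
next
  case (Less s t)
  then show ?case using fv_tm_subst[of v u s] fv_tm_subst[of v u t] by auto
qed auto

text \<open>An equivalence suits the simplifier: an abstraction is well typed only if its body is,
  although \<open>ty_of\<close> assigns a type to every term.\<close>

lemma has_ty_lam:
  "has_ty [] (lam v t) \<tau>' \<longleftrightarrow> (\<exists>\<tau>. \<tau>' = snd v \<Rrightarrow> \<tau> \<and> has_ty [] t \<tau>)"
proof (induction t arbitrary: \<tau>')
  case (App s t)
  show ?case
  proof (cases "v \<in> fv_tm (s \<cdot> t)")
    case True
    have "has_ty [] (lam v (s \<cdot> t)) \<tau>' \<longleftrightarrow>
        \<tau>' = snd v \<Rrightarrow> ty_of (s \<cdot> t) \<and> has_ty [] s (ty_of t \<Rrightarrow> ty_of (s \<cdot> t)) \<and> has_ty [] t (ty_of t)"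
      using True App by auto
    also have "\<dots> \<longleftrightarrow> (\<exists>\<tau>. \<tau>' = snd v \<Rrightarrow> \<tau> \<and> has_ty [] (s \<cdot> t) \<tau>)"
    proof (intro iffI; elim exE conjE)
      fix \<tau> assume \<tau>: "\<tau>' = snd v \<Rrightarrow> \<tau>" "has_ty [] (s \<cdot> t) \<tau>"
      then obtain \<sigma> where \<sigma>: "has_ty [] s (\<sigma> \<Rrightarrow> \<tau>)" "has_ty [] t \<sigma>" by auto
      then show "\<tau>' = snd v \<Rrightarrow> ty_of (s \<cdot> t) \<and> has_ty [] s (ty_of t \<Rrightarrow> ty_of (s \<cdot> t)) \<and>
          has_ty [] t (ty_of t)"
        using \<tau> has_ty_ty_of[OF \<tau>(2)] has_ty_ty_of[OF \<sigma>(2)] by simp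
    qed (auto simp del: ty_of.simps)
    finally show ?thesis .
  next
    case False
    then have "has_ty [] (lam v (s \<cdot> t)) \<tau>' \<longleftrightarrow>
        \<tau>' = snd v \<Rrightarrow> ty_of (s \<cdot> t) \<and> has_ty [] (s \<cdot> t) (ty_of (s \<cdot> t))"
      by auto
    then show ?thesis using has_ty_ty_of[of "s \<cdot> t"] by (auto simp del: ty_of.simps has_ty.simps)
  qed
qed (auto simp: Let_def)

locale rca_model = ext_model D ap cst lt
  for D :: "ty \<Rightarrow> 'a set" and ap (infixl "\<odot>" 90) and cst lt +
  assumes axiom_valid: "B \<in> RCA0\<omega> \<Longrightarrow> wff [] B \<Longrightarrow> typed \<rho> \<Longrightarrow> sat [] \<rho> B"
begin

definition \<rho>0 :: "var \<Rightarrow> 'a" where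
  "\<rho>0 v = (SOME a. a \<in> D (snd v))"

lemma typed_\<rho>0 [simp]: "typed \<rho>0"
  unfolding typed_def \<rho>0_def using D_nonempty by (simp add: some_in_eq)

lemma K_app:
  assumes "a \<in> D \<sigma>" "b \<in> D \<tau>"
  shows "cst (CK \<sigma> \<tau>) \<odot> a \<odot> b = a"
proof -
  let ?l = "Con (CK \<sigma> \<tau>) \<cdot> Fv (''x'', \<sigma>) \<cdot> Fv (''y'', \<tau>)" and ?r = "Fv (''x'', \<sigma>)"
  let ?\<rho> = "\<rho>0((''x'', \<sigma>) := a, (''y'', \<tau>) := b)"
  have "eq \<sigma> ?l ?r \<in> RCA0\<omega>" unfolding RCA0\<omega>_def combinator_axioms_def by blast
  moreover have "wff [] (eq \<sigma> ?l ?r)" by (rule wff_eq) auto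
  moreover have "typed ?\<rho>" using assms by simp
  ultimately have "sat [] ?\<rho> (eq \<sigma> ?l ?r)" by (rule axiom_valid)
  then have "eval [] ?\<rho> ?l = eval [] ?\<rho> ?r" using \<open>typed ?\<rho>\<close> by (subst (asm) sat_eq) auto
  then show ?thesis by simp
qed

lemma S_app:
  assumes "a \<in> D (\<rho> \<Rrightarrow> \<sigma> \<Rrightarrow> \<tau>)" "b \<in> D (\<rho> \<Rrightarrow> \<sigma>)" "c \<in> D \<rho>"
  shows "cst (CS \<rho> \<sigma> \<tau>) \<odot> a \<odot> b \<odot> c = a \<odot> c \<odot> (b \<odot> c)"
proof -
  let ?x = "(''x'', \<rho> \<Rrightarrow> \<sigma> \<Rrightarrow> \<tau>)" and ?y = "(''y'', \<rho> \<Rrightarrow> \<sigma>)" and ?z = "(''z'', \<rho>)"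
  let ?l = "Con (CS \<rho> \<sigma> \<tau>) \<cdot> Fv ?x \<cdot> Fv ?y \<cdot> Fv ?z" and ?r = "Fv ?x \<cdot> Fv ?z \<cdot> (Fv ?y \<cdot> Fv ?z)"
  let ?\<rho> = "\<rho>0(?x := a, ?y := b, ?z := c)"
  have "eq \<tau> ?l ?r \<in> RCA0\<omega>" unfolding RCA0\<omega>_def combinator_axioms_def by blast
  moreover have "wff [] (eq \<tau> ?l ?r)" by (rule wff_eq) auto
  moreover have "typed ?\<rho>" using assms by simp
  ultimately have "sat [] ?\<rho> (eq \<tau> ?l ?r)" by (rule axiom_valid)
  then have "eval [] ?\<rho> ?l = eval [] ?\<rho> ?r" using \<open>typed ?\<rho>\<close> by (subst (asm) sat_eq) auto
  then show ?thesis by simp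
qed

text \<open>Combinatory completeness: parts without \<open>v\<close> are handled by
  \<open>K_app\<close>, the variable itself by the combination S K K, applications by
  \<open>S_app\<close>.\<close>

lemma eval_lam:
  assumes "typed \<rho>" "has_ty [] t \<tau>" "a \<in> D (snd v)"
  shows "eval [] \<rho> (lam v t) \<odot> a = eval [] (\<rho>(v := a)) t"
proof -
  have K: "cst (CK \<tau> (snd v)) \<odot> eval [] \<rho> t \<odot> a = eval [] (\<rho>(v := a)) t"
    if "v \<notin> fv_tm t" "has_ty [] t \<tau>" for t \<tau>
  proof -
    have "eval [] \<rho> t = eval [] (\<rho>(v := a)) t"
      by (rule eval_cong) (use that in \<open>auto simp: fun_upd_apply\<close>)
    then show ?thesis using that assms by (simp add: K_app eval_D)
  qed
  show ?thesis using assms(2)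
  proof (induction t arbitrary: \<tau>)
    case (Fv w)
    show ?case
    proof (cases "w = v")
      case True
      let ?\<sigma> = "snd v"
      have "cst (CK ?\<sigma> (?\<sigma> \<Rrightarrow> ?\<sigma>)) \<in> D (?\<sigma> \<Rrightarrow> (?\<sigma> \<Rrightarrow> ?\<sigma>) \<Rrightarrow> ?\<sigma>)" "cst (CK ?\<sigma> ?\<sigma>) \<in> D (?\<sigma> \<Rrightarrow> ?\<sigma> \<Rrightarrow> ?\<sigma>)"
        using cst_D[of "CK _ _"] by auto
      then show ?thesis using True assms
        by (simp add: Let_def S_app[of _ ?\<sigma> "?\<sigma> \<Rrightarrow> ?\<sigma>"] K_app[of _ ?\<sigma> _ "?\<sigma> \<Rrightarrow> ?\<sigma>"] ap_D[of _ ?\<sigma>])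
    next
      case False
      then show ?thesis using K[of "Fv w" "snd w"] by simp
    qed
  next
    case (Con c)
    then show ?case using K[of "Con c" "const_ty c"] by simp
  next
    case (App s t)
    show ?case
    proof (cases "v \<in> fv_tm (s \<cdot> t)")
      case True
      obtain \<sigma> where \<sigma>: "has_ty [] s (\<sigma> \<Rrightarrow> \<tau>)" "has_ty [] t \<sigma>" using App.prems by auto
      have ty: "ty_of t = \<sigma>" "ty_of (s \<cdot> t) = \<tau>" using \<sigma> App.prems has_ty_ty_of by blast+
      have "eval [] \<rho> (lam v s) \<in> D (snd v \<Rrightarrow> \<sigma> \<Rrightarrow> \<tau>)" "eval [] \<rho> (lam v t) \<in> D (snd v \<Rrightarrow> \<sigma>)"
        using \<sigma> assms(1) by (auto intro!: eval_D simp: has_ty_lam)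
      then show ?thesis using True App.IH(1)[OF \<sigma>(1)] App.IH(2)[OF \<sigma>(2)] assms(3)
        by (simp add: S_app ty del: ty_of.simps)
    next
      case False
      then show ?thesis using K[OF False App.prems] has_ty_ty_of[OF App.prems] by simp
    qed
  qed simp
qed

lemma arithmetic_valid:
  assumes "A \<in> arithmetic_axioms" "wff [] A" "a \<in> D N" "b \<in> D N" "c \<in> D N" "d \<in> D N"
  shows "sat [] (\<rho>0((''x'', N) := a, (''y'', N) := b, (''z'', N) := c, (''u'', N) := d)) A"
  by (rule axiom_valid) (use assms in \<open>auto simp: RCA0\<omega>_def\<close>)

lemma recursor_valid:
  assumes "f \<in> D (N \<Rrightarrow> N \<Rrightarrow> N)" "m \<in> D N" "n \<in> D N"
  shows "cst (CRec N) \<odot> f \<odot> m \<odot> cst CZero = m"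
    "cst (CRec N) \<odot> f \<odot> m \<odot> (cst CPlus \<odot> n \<odot> cst COne) = f \<odot> n \<odot> (cst (CRec N) \<odot> f \<odot> m \<odot> n)"
proof -
  let ?\<rho> = "\<rho>0((''f'', N \<Rrightarrow> N \<Rrightarrow> N) := f, (''m'', N) := m, (''n'', N) := n)"
  have *: "sat [] ?\<rho> A" if "A \<in> recursor_axioms" "wff [] A" for A
    by (rule axiom_valid) (use that assms in \<open>auto simp: RCA0\<omega>_def\<close>)
  let ?f = "Fv (''f'', N \<Rrightarrow> N \<Rrightarrow> N)" and ?m = "Fv (''m'', N)" and ?n = "Fv (''n'', N)"
  let ?R = "Con (CRec N)"
  show "cst (CRec N) \<odot> f \<odot> m \<odot> cst CZero = m"
    using *[of "?R \<cdot> ?f \<cdot> ?m \<cdot> \<^bold>0 \<^bold>= ?m"] by (simp add: recursor_axioms_def Let_def)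
  show "cst (CRec N) \<odot> f \<odot> m \<odot> (cst CPlus \<odot> n \<odot> cst COne) = f \<odot> n \<odot> (cst (CRec N) \<odot> f \<odot> m \<odot> n)"
    using *[of "?R \<cdot> ?f \<cdot> ?m \<cdot> (?n \<^bold>+ \<^bold>1) \<^bold>= ?f \<cdot> ?n \<cdot> (?R \<cdot> ?f \<cdot> ?m \<cdot> ?n)"]
    by (simp add: recursor_axioms_def Let_def)
qed

lemma QF_induct_D:
  assumes "quantifier_free A" "wff [] A" "typed \<rho>"
    and "sat [] (\<rho>((x, N) := cst CZero)) A"
    and "\<And>n. n \<in> D N \<Longrightarrow> sat [] (\<rho>((x, N) := n)) A \<Longrightarrow>
      sat [] (\<rho>((x, N) := cst CPlus \<odot> n \<odot> cst COne)) A"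
    and n: "n \<in> D N"
  shows "sat [] (\<rho>((x, N) := n)) A"
proof -
  let ?v = "(x, N)"
  let ?s = "subst ?v (Fv ?v \<^bold>+ \<^bold>1) A"
  let ?B = "subst ?v \<^bold>0 A \<^bold>\<longrightarrow> all x N (\<lambda>_. A \<^bold>\<longrightarrow> ?s) \<^bold>\<longrightarrow> all x N (\<lambda>_. A)"
  have wff: "wff [] ?s" "wff [] (subst ?v \<^bold>0 A)" using assms(2) by (auto intro!: wff_subst)
  have "?B \<in> RCA0\<omega>" using assms(1,2) unfolding RCA0\<omega>_def QF_IND_def by blast
  moreover have "wff [] ?B"
    using assms(2) wff wff_bind0[of A ?v] wff_bind0[of ?s ?v] by (simp add: all_def)
  ultimately have "sat [] \<rho> ?B" using assms(3) axiom_valid by blast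
  then show ?thesis
    using assms(2,4,5) wff n
    by (simp add: all_def sat_bind0 sat_subst[of _ N])
qed

lemma QF_AC_D:
  assumes "quantifier_free A" "wff [] A" "typed \<rho>" "(Y, ty2) \<notin> fv A"
    and ex: "\<And>a. a \<in> D ty1 \<Longrightarrow> \<exists>b\<in>D N. sat [] (\<rho>((x, ty1) := a, (y, N) := b)) A"
  shows "\<exists>F\<in>D ty2. \<forall>a\<in>D ty1. sat [] (\<rho>((x, ty1) := a, (y, N) := F \<odot> a)) A"
proof -
  let ?s = "subst (y, N) (Fv (Y, ty2) \<cdot> Fv (x, ty1)) A"
  let ?P = "all x ty1 (\<lambda>_. ex y N (\<lambda>_. A))"
  let ?Q = "ex Y ty2 (\<lambda>Y. all x ty1 (\<lambda>x. subst (y, N) (Y \<cdot> x) A))"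
  have wff: "wff [] ?s" using assms(2) by (auto intro!: wff_subst)
  have wffe: "wff [] (ex y N (\<lambda>_. A))" using wff_bind0[of A "(y, N)"] assms(2) by (simp add: ex_def)
  have wffP: "wff [] ?P" using wff_bind0[OF wffe, of "(x, ty1)"] by (simp add: all_def)
  have wffa: "wff [] (all x ty1 (\<lambda>x. subst (y, N) (Fv (Y, ty2) \<cdot> x) A))"
    using wff_bind0[OF wff, of "(x, ty1)"] by (simp add: all_def)
  have wffQ: "wff [] ?Q" using wff_bind0[OF wffa, of "(Y, ty2)"] by (simp add: ex_def)
  have "(?P \<^bold>\<longrightarrow> ?Q) \<in> RCA0\<omega>" using assms(1,2,4) unfolding RCA0\<omega>_def QF_AC_10_def by blast
  then have "sat [] \<rho> (?P \<^bold>\<longrightarrow> ?Q)" using axiom_valid[OF _ _ assms(3)] wffP wffQ by (simp only: wff.simps)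
  moreover have "sat [] \<rho> ?P"
  proof -
    have "sat [a] \<rho> (bind (x, ty1) 0 (ex y N (\<lambda>_. A)))" if "a \<in> D ty1" for a
    proof -
      have "sat [] (\<rho>((x, ty1) := a)) (ex y N (\<lambda>_. A))"
        using ex[OF that] assms(2) by (simp add: ex_def sat_bind0)
      then show ?thesis using sat_bind0[OF wffe] by blast
    qed
    then show ?thesis by (simp add: all_def)
  qed
  ultimately have "sat [] \<rho> ?Q" by simp
  then obtain F where F: "F \<in> D ty2" and
    "sat [F] \<rho> (bind (Y, ty2) 0 (all x ty1 (\<lambda>x. subst (y, N) (Fv (Y, ty2) \<cdot> x) A)))"
    by (auto simp: ex_def)
  then have *: "sat [] (\<rho>((Y, ty2) := F)) (all x ty1 (\<lambda>x. subst (y, N) (Fv (Y, ty2) \<cdot> x) A))"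
    using sat_bind0[OF wffa] by blast
  have "sat [] (\<rho>((x, ty1) := a, (y, N) := F \<odot> a)) A" if a: "a \<in> D ty1" for a
  proof -
    let ?\<rho> = "\<rho>((Y, ty2) := F, (x, ty1) := a)"
    have "sat [] ?\<rho> ?s" 
      using * a sat_bind0[OF wff] by (simp add: all_def)
    then have "sat [] (?\<rho>((y, N) := eval [] ?\<rho> (Fv (Y, ty2) \<cdot> Fv (x, ty1)))) A"
      by (subst (asm) sat_subst[of _ N]) auto
    then have "sat [] (?\<rho>((y, N) := F \<odot> a)) A" by simp
    moreover have "sat [] (?\<rho>((y, N) := F \<odot> a)) A = sat [] (\<rho>((x, ty1) := a, (y, N) := F \<odot> a)) A"
      by (rule sat_cong) (use assms(4) in \<open>auto simp: fun_upd_apply\<close>)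
    ultimately show ?thesis by simp
  qed
  then show ?thesis using F by blast
qed

text \<open>The values of the standard numerals strictly increase. Together with countability this
  supplies a bijection with a whole type.\<close>

lemma infinite_numbers: "infinite (D N)"
proof -
  let ?x = "Fv (''x'', N)" and ?y = "Fv (''y'', N)" and ?z = "Fv (''z'', N)"
  define f where "f = rec_nat (cst CZero) (\<lambda>_ a. cst CPlus \<odot> a \<odot> cst COne)"
  have one: "cst COne \<in> D N" and zero: "cst CZero \<in> D N" using cst_D[of COne] cst_D[of CZero] by auto
  have plus: "cst CPlus \<odot> a \<odot> b \<in> D N" if "a \<in> D N" "b \<in> D N" for a b
    using cst_D[of CPlus] that by (auto intro: ap_D)
  have f: "f n \<in> D N" for n
    by (induction n) (use one zero plus in \<open>auto simp: f_def\<close>)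
  have less: "lt (f n) (f (Suc n))" for n
  proof -
    have z1: "lt (cst CZero) (cst COne)"
      using arithmetic_valid[of "\<^bold>0 \<^bold>< \<^bold>1", OF _ _ zero zero zero zero]
      by (simp add: arithmetic_axioms_def Let_def)
    have "lt (cst CPlus \<odot> cst CZero \<odot> f n) (cst CPlus \<odot> cst COne \<odot> f n)"
      using arithmetic_valid[of "?x \<^bold>< ?y \<^bold>\<longrightarrow> ?x \<^bold>+ ?z \<^bold>< ?y \<^bold>+ ?z", OF _ _ zero one f[of n] zero] z1
      by (simp add: arithmetic_axioms_def Let_def)
    moreover have comm: "cst CPlus \<odot> a \<odot> f n = cst CPlus \<odot> f n \<odot> a" if "a \<in> D N" for a
      using arithmetic_valid[of "?x \<^bold>+ ?y \<^bold>= ?y \<^bold>+ ?x", OF _ _ that f[of n] zero zero]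
      by (simp add: arithmetic_axioms_def Let_def)
    moreover have "cst CPlus \<odot> f n \<odot> cst CZero = f n"
      using arithmetic_valid[of "?x \<^bold>+ \<^bold>0 \<^bold>= ?x", OF _ _ f[of n] zero zero zero]
      by (simp add: arithmetic_axioms_def Let_def)
    ultimately show ?thesis using comm[OF zero] comm[OF one] by (simp add: f_def)
  qed
  have trans: "lt a c" if "lt a b" "lt b c" "a \<in> D N" "b \<in> D N" "c \<in> D N" for a b c
    using arithmetic_valid[of "?x \<^bold>< ?y \<^bold>\<longrightarrow> ?y \<^bold>< ?z \<^bold>\<longrightarrow> ?x \<^bold>< ?z", OF _ _ that(3,4,5) zero] that
    by (simp add: arithmetic_axioms_def Let_def)
  have irrefl: "\<not> lt a a" if "a \<in> D N" for a
    using arithmetic_valid[of "\<^bold>\<not> ?x \<^bold>< ?x", OF _ _ that zero zero zero]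
    by (simp add: arithmetic_axioms_def Let_def)
  have "lt (f m) (f n)" if "m < n" for m n
    using that
  proof (induction n)
    case (Suc n)
    show ?case
    proof (cases "m = n")
      case False
      then show ?thesis using Suc trans[OF _ less] f by auto
    qed (use less in simp)
  qed simp
  then have "inj f" by (metis f injI irrefl linorder_neqE_nat)
  then show ?thesis using f by (meson image_subsetI infinite_super range_inj_infinite)
qed

end

section \<open>Numbers\<close>

lemma ty_of_lam [simp]: "ty_of (lam v t) = snd v \<Rrightarrow> ty_of t"
  by (induction t) (auto simp: Let_def)

lemma has_ty_Bar_iff [simp]: "has_ty \<Delta> Bar \<tau> \<longleftrightarrow> \<tau> = ty1 \<Rrightarrow> N \<Rrightarrow> N"
  using has_ty_Bar has_ty_unique by blast

lemma has_ty_Pow2_iff [simp]: "has_ty \<Delta> Pow2 \<tau> \<longleftrightarrow> \<tau> = N \<Rrightarrow> N"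
  using has_ty_Pow2 has_ty_unique by blast

lemma ty_of_Bar [simp]: "ty_of Bar = ty1 \<Rrightarrow> N \<Rrightarrow> N"
  by (rule has_ty_ty_of) simp

lemma ty_of_Pow2 [simp]: "ty_of Pow2 = N \<Rrightarrow> N"
  by (rule has_ty_ty_of) simp

lemma fv_Bar [simp]: "fv_tm Bar = {}" and fv_Pow2 [simp]: "fv_tm Pow2 = {}"
  by (simp_all add: Bar_def Pow2_def Let_def)

declare lam.simps [simp del] has_ty_lam [simp]

text \<open>The numbers of the model are transferred to a whole type \<open>'n\<close>, so that arithmetic needs no
  membership conditions.\<close>

locale numbered_model = rca_model D ap cst lt
  for D :: "ty \<Rightarrow> 'a set" and ap (infixl "\<odot>" 90) and cst lt +
  fixes nu :: "'n \<Rightarrow> 'a"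
  assumes nu_bij: "bij_betw nu UNIV (D N)"
begin

definition num :: "'a \<Rightarrow> 'n" where "num = inv nu"

lemma num_nu [simp]: "num (nu n) = n"
  using nu_bij by (simp add: num_def bij_betw_def inv_f_f)

lemma nu_num: "a \<in> D N \<Longrightarrow> nu (num a) = a"
  using nu_bij by (simp add: num_def bij_betw_def f_inv_into_f)

lemma nu_D [simp]: "nu n \<in> D N"
  using nu_bij by (auto simp: bij_betw_def)

lemma nu_eq [simp]: "nu m = nu n \<longleftrightarrow> m = n"
  by (metis num_nu)

lemma ball_N [simp]: "(\<forall>a\<in>D N. P a) \<longleftrightarrow> (\<forall>n. P (nu n))"
  by (metis nu_num nu_D)

lemma bex_N [simp]: "(\<exists>a\<in>D N. P a) \<longleftrightarrow> (\<exists>n. P (nu n))"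
  by (metis nu_num nu_D)

definition zero ("\<zero>") where "\<zero> = num (cst CZero)"
definition one ("\<one>") where "\<one> = num (cst COne)"
definition plus (infixl "\<oplus>" 65) where "a \<oplus> b = num (cst CPlus \<odot> nu a \<odot> nu b)"
definition times (infixl "\<otimes>" 70) where "a \<otimes> b = num (cst CTimes \<odot> nu a \<odot> nu b)"
definition less (infix "\<prec>" 50) where "a \<prec> b \<longleftrightarrow> lt (nu a) (nu b)"
definition less_eq (infix "\<preceq>" 50) where "a \<preceq> b \<longleftrightarrow> a \<prec> b \<or> a = b"
definition app (infixl "\<bullet>" 90) where "f \<bullet> n = num (f \<odot> nu n)"
definition app2 (infixl "\<star>" 90) where "F \<star> f = num (F \<odot> f)"

lemma ap1_D [simp]: "f \<in> D (N \<Rrightarrow> \<tau>) \<Longrightarrow> f \<odot> nu n \<in> D \<tau>"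
  by (rule ap_D) auto

lemma ap2_D [simp]: "F \<in> D (ty1 \<Rrightarrow> \<tau>) \<Longrightarrow> f \<in> D ty1 \<Longrightarrow> F \<odot> f \<in> D \<tau>"
  by (rule ap_D)

lemma cst_zero [simp]: "cst CZero = nu \<zero>"
  using cst_D[of CZero] by (simp add: zero_def nu_num)

lemma cst_one [simp]: "cst COne = nu \<one>"
  using cst_D[of COne] by (simp add: one_def nu_num)

lemma cst_plus [simp]: "cst CPlus \<odot> nu a \<odot> nu b = nu (a \<oplus> b)"
  using cst_D[of CPlus] by (simp add: plus_def nu_num)

lemma cst_times [simp]: "cst CTimes \<odot> nu a \<odot> nu b = nu (a \<otimes> b)"
  using cst_D[of CTimes] by (simp add: times_def nu_num)

lemma lt_nu [simp]: "lt (nu a) (nu b) \<longleftrightarrow> a \<prec> b"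
  by (simp add: less_def)

lemma app_nu [simp]: "f \<in> D ty1 \<Longrightarrow> f \<odot> nu n = nu (f \<bullet> n)"
  by (simp add: app_def nu_num)

lemma app2_nu [simp]: "F \<in> D ty2 \<Longrightarrow> f \<in> D ty1 \<Longrightarrow> F \<odot> f = nu (F \<star> f)"
  by (simp add: app2_def nu_num)

lemma fun_eqI: "f \<in> D ty1 \<Longrightarrow> g \<in> D ty1 \<Longrightarrow> (\<And>n. f \<bullet> n = g \<bullet> n) \<Longrightarrow> f = g"
  by (rule extensional) (auto simp flip: ball_simps dest!: nu_num[symmetric], metis app_nu nu_num)

text \<open>Naming the type by \<open>ty_of t\<close> leaves no type variable open, so the
  simplifier can discharge the typing premise.\<close>

lemma eval_lam_nu [simp]:
  "typed \<rho> \<Longrightarrow> a \<in> D (snd v) \<Longrightarrow> has_ty [] t (ty_of t) \<Longrightarrow>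
    eval [] \<rho> (lam v t) \<odot> a = eval [] (\<rho>(v := a)) t"
  by (rule eval_lam)

text \<open>\<open>Leq\<close> is a disjunction coded as an implication; evaluating a formula leaves
  this form behind.\<close>

lemma leq_iff [simp]: "(\<not> a \<prec> b \<longrightarrow> a = b) \<longleftrightarrow> a \<preceq> b"
  by (auto simp: less_eq_def)

text \<open>As the numbers may be nonstandard, \<open>P\<close> has to be presented as the truth set
  of a quantifier-free formula with parameters in \<open>\<rho>\<close>.\<close>

lemma QF_induct:
  assumes "quantifier_free A" "wff [] A" "typed \<rho>"
    and P: "\<And>n. P n \<longleftrightarrow> sat [] (\<rho>((x, N) := nu n)) A"
    and "P \<zero>" and "\<And>n. P n \<Longrightarrow> P (n \<oplus> \<one>)"
  shows "P n"
proof -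
  have "sat [] (\<rho>((x, N) := nu n)) A"
  proof (rule QF_induct_D[OF assms(1-3)])
    fix a assume "a \<in> D N" "sat [] (\<rho>((x, N) := a)) A"
    then show "sat [] (\<rho>((x, N) := cst CPlus \<odot> a \<odot> cst COne)) A"
      using assms(6)[unfolded P] nu_num[of a] by (metis cst_one cst_plus)
  qed (use assms(5)[unfolded P] in auto)
  then show ?thesis by (simp add: P)
qed

lemma QF_AC:
  assumes "quantifier_free A" "wff [] A" "typed \<rho>" "(Y, ty2) \<notin> fv A"
    and "\<And>f. f \<in> D ty1 \<Longrightarrow> \<exists>n. sat [] (\<rho>((x, ty1) := f, (y, N) := nu n)) A"
  shows "\<exists>F\<in>D ty2. \<forall>f\<in>D ty1. sat [] (\<rho>((x, ty1) := f, (y, N) := nu (F \<star> f))) A"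
  using QF_AC_D[OF assms(1-4), of x y] assms(5) by simp

lemma axiom_nu:
  assumes "A \<in> arithmetic_axioms" "wff [] A"
  shows "sat [] (\<rho>0((''x'', N) := nu a, (''y'', N) := nu b, (''z'', N) := nu c, (''u'', N) := nu d)) A"
  using arithmetic_valid[OF assms] by simp

lemma semiring_axioms:
  "a \<oplus> (b \<oplus> c) = (a \<oplus> b) \<oplus> c" "a \<oplus> b = b \<oplus> a" "a \<oplus> \<zero> = a"
  "a \<otimes> (b \<otimes> c) = (a \<otimes> b) \<otimes> c" "a \<otimes> b = b \<otimes> a" "a \<otimes> \<one> = a" "a \<otimes> \<zero> = \<zero>"
  "a \<otimes> (b \<oplus> c) = a \<otimes> b \<oplus> a \<otimes> c"
  "\<not> a \<prec> a" "a \<prec> b \<Longrightarrow> b \<prec> c \<Longrightarrow> a \<prec> c" "a \<prec> b \<or> a = b \<or> b \<prec> a"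
  "a \<prec> b \<Longrightarrow> a \<oplus> c \<prec> b \<oplus> c" "\<zero> \<prec> c \<Longrightarrow> a \<prec> b \<Longrightarrow> a \<otimes> c \<prec> b \<otimes> c"
  "\<zero> \<prec> \<one>" "\<zero> \<preceq> a" "\<zero> \<prec> a \<Longrightarrow> \<one> \<preceq> a"
proof -
  let ?x = "Fv (''x'', N)" and ?y = "Fv (''y'', N)" and ?z = "Fv (''z'', N)"
  note A = axiom_nu[of _ a b c a]
  note [simp] = arithmetic_axioms_def Let_def
  show "a \<oplus> (b \<oplus> c) = (a \<oplus> b) \<oplus> c" using A[of "?x \<^bold>+ (?y \<^bold>+ ?z) \<^bold>= (?x \<^bold>+ ?y) \<^bold>+ ?z"] by simp
  show "a \<oplus> b = b \<oplus> a" using A[of "?x \<^bold>+ ?y \<^bold>= ?y \<^bold>+ ?x"] by simp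
  show "a \<oplus> \<zero> = a" using A[of "?x \<^bold>+ \<^bold>0 \<^bold>= ?x"] by simp
  show "a \<otimes> (b \<otimes> c) = (a \<otimes> b) \<otimes> c" using A[of "?x \<^bold>* (?y \<^bold>* ?z) \<^bold>= (?x \<^bold>* ?y) \<^bold>* ?z"] by simp
  show "a \<otimes> b = b \<otimes> a" using A[of "?x \<^bold>* ?y \<^bold>= ?y \<^bold>* ?x"] by simp
  show "a \<otimes> \<one> = a" using A[of "?x \<^bold>* \<^bold>1 \<^bold>= ?x"] by simp
  show "a \<otimes> \<zero> = \<zero>" using A[of "?x \<^bold>* \<^bold>0 \<^bold>= \<^bold>0"] by simp
  show "a \<otimes> (b \<oplus> c) = a \<otimes> b \<oplus> a \<otimes> c"
    using A[of "?x \<^bold>* (?y \<^bold>+ ?z) \<^bold>= ?x \<^bold>* ?y \<^bold>+ ?x \<^bold>* ?z"] by simp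
  show "\<not> a \<prec> a" using A[of "\<^bold>\<not> ?x \<^bold>< ?x"] by simp
  show "a \<prec> b \<Longrightarrow> b \<prec> c \<Longrightarrow> a \<prec> c"
    using A[of "?x \<^bold>< ?y \<^bold>\<longrightarrow> ?y \<^bold>< ?z \<^bold>\<longrightarrow> ?x \<^bold>< ?z"] by simp
  show "a \<prec> b \<or> a = b \<or> b \<prec> a"
    using A[of "?x \<^bold>< ?y \<^bold>\<or> ?x \<^bold>= ?y \<^bold>\<or> ?y \<^bold>< ?x"] by auto
  show "a \<prec> b \<Longrightarrow> a \<oplus> c \<prec> b \<oplus> c"
    using A[of "?x \<^bold>< ?y \<^bold>\<longrightarrow> ?x \<^bold>+ ?z \<^bold>< ?y \<^bold>+ ?z"] by simp
  show "\<zero> \<prec> c \<Longrightarrow> a \<prec> b \<Longrightarrow> a \<otimes> c \<prec> b \<otimes> c"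
    using A[of "\<^bold>0 \<^bold>< ?z \<^bold>\<longrightarrow> ?x \<^bold>< ?y \<^bold>\<longrightarrow> ?x \<^bold>* ?z \<^bold>< ?y \<^bold>* ?z"] by simp
  show "\<zero> \<prec> \<one>" using A[of "\<^bold>0 \<^bold>< \<^bold>1"] by simp
  show "\<zero> \<preceq> a" using A[of "\<^bold>0 \<^bold>\<le> ?x"] by simp
  show "\<zero> \<prec> a \<Longrightarrow> \<one> \<preceq> a" using A[of "\<^bold>0 \<^bold>< ?x \<^bold>\<longrightarrow> \<^bold>1 \<^bold>\<le> ?x"] by simp
qed

lemma rec_D [simp]:
  assumes "f \<in> D (N \<Rrightarrow> N \<Rrightarrow> N)" shows "cst (CRec N) \<odot> f \<odot> nu m \<in> D ty1"
  using cst_D[of "CRec N"] assms by (auto intro: ap_D)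

lemma rec_zero [simp]: "f \<in> D (N \<Rrightarrow> ty1) \<Longrightarrow> cst (CRec N) \<odot> f \<odot> nu m \<bullet> \<zero> = m"
  using recursor_valid(1)[of f "nu m" "nu \<zero>"] by simp

lemma rec_Suc [simp]:
  assumes "f \<in> D (N \<Rrightarrow> ty1)"
  shows "cst (CRec N) \<odot> f \<odot> nu m \<bullet> (n \<oplus> \<one>) = f \<odot> nu n \<bullet> (cst (CRec N) \<odot> f \<odot> nu m \<bullet> n)"
  using recursor_valid(2)[OF assms, of "nu m" "nu n"] assms by simp

text \<open>The existential claim is not quantifier-free. So the recursor first defines a
  predecessor function, and the induction concerns an equation for it.\<close>

lemma pred_exists: "n = \<zero> \<or> (\<exists>m. n = m \<oplus> \<one>)"
proof -
  let ?R = "Con (CRec N) \<cdot> lam (''k'', N) (lam (''c'', N) (Fv (''k'', N))) \<cdot> \<^bold>0"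
  define f where "f = eval [] \<rho>0 (lam (''k'', N) (lam (''c'', N) (Fv (''k'', N))))"
  have f: "f \<in> D (N \<Rrightarrow> N \<Rrightarrow> N)" by (auto simp: f_def intro!: eval_D)
  have f_app: "f \<odot> nu a \<odot> nu b = nu a" for a b by (simp add: f_def)
  let ?p = "cst (CRec N) \<odot> f \<odot> nu \<zero>"
  have "f \<odot> nu a \<bullet> b = a" for a b using f_app[of a b] f by simp
  then have p: "?p \<bullet> (n \<oplus> \<one>) = n" for n using f by simp
  have "n = \<zero> \<or> ?p \<bullet> n \<oplus> \<one> = n"
    by (rule QF_induct[where A = "Fv (''n'', N) \<^bold>= \<^bold>0 \<^bold>\<or> Fv (''p'', ty1) \<cdot> Fv (''n'', N) \<^bold>+ \<^bold>1 \<^bold>= Fv (''n'', N)"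
          and \<rho> = "\<rho>0((''p'', ty1) := ?p)" and x = "''n''"])
      (use f p in auto)
  then show ?thesis by metis
qed

text \<open>Cancellation and discreteness of the order are not among the axioms. Both follow from
  subtraction, which iterates the predecessor function.\<close>

lemma le_imp_ex_add:
  assumes "y \<preceq> x"
  shows "\<exists>d. d \<oplus> y = x"
proof -
  note ax = semiring_axioms
  let ?t = "lam (''k'', N) (lam (''c'', N) (Fv (''k'', N)))"
  define f where "f = eval [] \<rho>0 ?t"
  have f: "f \<in> D (N \<Rrightarrow> ty1)" by (auto simp: f_def intro!: eval_D)
  have "f \<odot> nu a \<odot> nu b = nu a" for a b by (simp add: f_def)
  then have f_app: "f \<odot> nu a \<bullet> b = a" for a b using f by simp
  define p where "p = cst (CRec N) \<odot> f \<odot> nu \<zero>"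
  have p: "p \<in> D ty1" "p \<bullet> (n \<oplus> \<one>) = n" for n using f f_app by (simp_all add: p_def)
  let ?\<rho> = "\<rho>0((''p'', ty1) := p)"
  let ?g = "lam (''k'', N) (lam (''c'', N) (Fv (''p'', ty1) \<cdot> Fv (''c'', N)))"
  define g where "g = eval [] ?\<rho> ?g"
  have g: "g \<in> D (N \<Rrightarrow> ty1)" using p by (auto simp: g_def intro!: eval_D)
  have "g \<odot> nu a \<odot> nu b = nu (p \<bullet> b)" for a b using p by (simp add: g_def)
  then have g_app: "g \<odot> nu a \<bullet> b = p \<bullet> b" for a b using g by simp
  \<comment> \<open>\<open>d \<bullet> n\<close> is \<open>x\<close> reduced \<open>n\<close> times
    by the predecessor, that is, truncated subtraction.\<close>
  define d where "d = cst (CRec N) \<odot> g \<odot> nu x"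
  have d: "d \<in> D ty1" "d \<bullet> \<zero> = x" "d \<bullet> (n \<oplus> \<one>) = p \<bullet> (d \<bullet> n)" for n
    using g g_app by (simp_all add: d_def)
  have less_Suc: "n \<prec> n \<oplus> \<one>" for n using ax(12)[OF ax(14), of n] ax(2,3) by metis
  have "n \<preceq> x \<longrightarrow> d \<bullet> n \<oplus> n = x" for n
  proof (rule QF_induct[where P = "\<lambda>n. n \<preceq> x \<longrightarrow> d \<bullet> n \<oplus> n = x" and x = "''n''" and \<rho> = "\<rho>0((''x'', N) := nu x, (''d'', ty1) := d)" and
      A = "Fv (''n'', N) \<^bold>\<le> Fv (''x'', N) \<^bold>\<longrightarrow> Fv (''d'', ty1) \<cdot> Fv (''n'', N) \<^bold>+ Fv (''n'', N) \<^bold>= Fv (''x'', N)"])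
    fix n assume IH: "n \<preceq> x \<longrightarrow> d \<bullet> n \<oplus> n = x"
    show "n \<oplus> \<one> \<preceq> x \<longrightarrow> d \<bullet> (n \<oplus> \<one>) \<oplus> (n \<oplus> \<one>) = x"
    proof
      assume "n \<oplus> \<one> \<preceq> x"
      then have nx: "n \<prec> x" using less_Suc[of n] ax(10) by (auto simp: less_eq_def)
      then have eq: "d \<bullet> n \<oplus> n = x" using IH by (simp add: less_eq_def)
      have "d \<bullet> n \<noteq> \<zero>" using eq nx ax(2,3,9) by metis
      then obtain m where m: "d \<bullet> n = m \<oplus> \<one>" using pred_exists by blast
      then show "d \<bullet> (n \<oplus> \<one>) \<oplus> (n \<oplus> \<one>) = x" using eq d(3) p(2) ax(1,2) by metis
    qed
  qed (use d(1,2) ax(3) in auto)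
  then show ?thesis using assms by blast
qed

definition minus (infixl "\<ominus>" 65) where
  "a \<ominus> b = (if b \<preceq> a then THE d. d \<oplus> b = a else \<zero>)"

lemma less_imp_Suc_le: assumes "a \<prec> b" shows "a \<oplus> \<one> \<preceq> b"
proof -
  note ax = semiring_axioms
  obtain d where d: "d \<oplus> a = b" using le_imp_ex_add assms by (auto simp: less_eq_def)
  have "\<zero> \<prec> d" using d assms ax(15)[of d] ax(2,3,9) by (metis less_eq_def)
  then have "\<one> \<prec> d \<or> \<one> = d" using ax(16) by (auto simp: less_eq_def)
  then show ?thesis using d ax(2) ax(12)[of \<one> d a] by (auto simp: less_eq_def)
qed

lemma add_right_less_iff: "a \<oplus> c \<prec> b \<oplus> c \<longleftrightarrow> a \<prec> b"
  using semiring_axioms(9,10,11,12) by metis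

lemma add_right_eq_iff: "a \<oplus> c = b \<oplus> c \<longleftrightarrow> a = b"
  using semiring_axioms(9,11,12) by metis

lemma minus_eq: "d \<oplus> b = a \<Longrightarrow> a \<ominus> b = d"
proof -
  assume d: "d \<oplus> b = a"
  have "\<zero> \<oplus> b = b" using semiring_axioms(2,3) by metis
  then have "b \<preceq> d \<oplus> b"
    using semiring_axioms(15)[of d] semiring_axioms(12)[of \<zero> d b] by (auto simp: less_eq_def)
  moreover have "(THE d. d \<oplus> b = a) = d"
    using d by (intro the_equality) (auto simp: add_right_eq_iff)
  ultimately show ?thesis using d by (simp add: minus_def)
qed

lemma minus_zero: "\<not> b \<preceq> a \<Longrightarrow> a \<ominus> b = \<zero>"
  by (simp add: minus_def)

text \<open>Hands the arithmetic of the model over to the library classes. Truncated subtraction is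
  part of the class, which is why \<open>minus\<close> has the default value zero.\<close>

sublocale num: linordered_semidom plus minus less_eq less zero times one
proof -
  note ax = semiring_axioms
  have zero_add: "\<zero> \<oplus> a = a" for a using ax(2,3) by metis
  have order: "class.linorder less_eq less"
  proof
    show "a \<prec> b \<longleftrightarrow> a \<preceq> b \<and> \<not> b \<preceq> a" for a b
      using ax(9,10) unfolding less_eq_def by blast
    show "a \<preceq> b \<or> b \<preceq> a" for a b using ax(11) unfolding less_eq_def by blast
    show "a \<preceq> b \<Longrightarrow> b \<preceq> c \<Longrightarrow> a \<preceq> c" for a b c using ax(10) unfolding less_eq_def by blast
    show "a \<preceq> b \<Longrightarrow> b \<preceq> a \<Longrightarrow> a = b" for a b using ax(9,10) unfolding less_eq_def by blast
  qed (simp add: less_eq_def)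
  interpret o: linorder less_eq less by (rule order)
  have le_add: "b \<preceq> d \<oplus> b" for b d
    using ax(15)[of d] ax(12)[of \<zero> d b] zero_add by (auto simp: less_eq_def)
  have mcases: "(\<exists>d. a = d \<oplus> b \<and> a \<ominus> b = d) \<or> (a \<prec> b \<and> a \<ominus> b = \<zero>)" for a b
    using le_imp_ex_add[of b a] minus_eq minus_zero[of b a] by (metis o.not_le)
  have add_mono: "a \<oplus> c \<preceq> b \<oplus> c" if "a \<preceq> b" for a b c
    using that add_right_less_iff by (auto simp: less_eq_def)
  have mult_mono: "c \<otimes> a \<preceq> c \<otimes> b" if "a \<preceq> b" for a b c
    using that ax(13)[of c a b] ax(15)[of c] ax(5,7) by (auto simp: less_eq_def)
  have mult_less: "c \<otimes> a \<prec> c \<otimes> b" if "a \<prec> b" "\<zero> \<prec> c" for a b c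
    using that ax(13)[of c a b] ax(5) by metis
  show "class.linordered_semidom plus minus less_eq less zero times one"
  proof unfold_locales
    fix a b c
    show "a \<oplus> b \<oplus> c = a \<oplus> (b \<oplus> c)" by (rule ax(1)[symmetric])
    show "a \<oplus> b = b \<oplus> a" by (rule ax(2))
    show "a \<oplus> b \<ominus> a = b" by (rule minus_eq) (rule ax(2))
    show "a \<ominus> b \<ominus> c = a \<ominus> (b \<oplus> c)"
    proof (cases "b \<oplus> c \<preceq> a")
      case True
      then obtain d where d: "d \<oplus> (b \<oplus> c) = a" using le_imp_ex_add by blast
      then have "a \<ominus> b = d \<oplus> c" using ax(1,2) by (intro minus_eq) metis
      then show ?thesis using d minus_eq by metis
    next
      case False
      consider d where "a = d \<oplus> b" "a \<ominus> b = d" | "a \<prec> b" "a \<ominus> b = \<zero>" using mcases by blast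
      then show ?thesis
      proof cases
        case 1
        then have "\<not> c \<preceq> d" using False add_mono[of c d b] ax(2) by metis
        then show ?thesis using 1(2) False minus_zero by simp
      next
        case 2
        have "\<zero> \<ominus> c = \<zero>" using mcases[of \<zero> c] ax(15) le_add by (metis o.order.antisym zero_add ax(2))
        then show ?thesis using 2 False minus_zero by simp
      qed
    qed
    show "\<zero> \<oplus> a = a" by (rule zero_add)
    show "a \<otimes> b \<otimes> c = a \<otimes> (b \<otimes> c)" by (rule ax(4)[symmetric])
    show "a \<otimes> b = b \<otimes> a" by (rule ax(5))
    show "\<one> \<otimes> a = a" using ax(5,6) by metis
    show "(a \<oplus> b) \<otimes> c = a \<otimes> c \<oplus> b \<otimes> c" using ax(5,8) by metis
    show "\<zero> \<otimes> a = \<zero>" using ax(5,7) by metis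
    show "a \<otimes> \<zero> = \<zero>" by (rule ax(7))
    show "\<zero> \<noteq> \<one>" using ax(9,14) by metis
    show "a \<otimes> (b \<ominus> c) = a \<otimes> b \<ominus> a \<otimes> c"
    proof -
      consider d where "b = d \<oplus> c" "b \<ominus> c = d" | "b \<prec> c" "b \<ominus> c = \<zero>" using mcases by blast
      then show ?thesis
      proof cases
        case 1
        then show ?thesis using ax(8) minus_eq by metis
      next
        case 2
        have "a \<otimes> b \<preceq> a \<otimes> c" using 2(1) mult_mono by (simp add: less_eq_def)
        then have "a \<otimes> b \<ominus> a \<otimes> c = \<zero>" using minus_zero minus_eq zero_add o.order.antisym by metis
        then show ?thesis using 2 ax(7) by simp
      qed
    qed
    show "a \<otimes> b \<noteq> \<zero>" if "a \<noteq> \<zero>" "b \<noteq> \<zero>"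
      using that mult_less[of \<zero> b a] ax(7,9,15) by (metis less_eq_def)
    show "c \<oplus> a \<preceq> c \<oplus> b" if "a \<preceq> b" using add_mono[OF that, of c] ax(2) by metis
    show "c \<otimes> a \<prec> c \<otimes> b" if "a \<prec> b" "\<zero> \<prec> c" using mult_less that .
    show "\<zero> \<prec> \<one>" by (rule ax(14))
    show "a \<ominus> b \<oplus> b = a" if "b \<preceq> a" using that le_imp_ex_add minus_eq by metis
    show "a \<otimes> (b \<oplus> c) = a \<otimes> b \<oplus> a \<otimes> c" by (rule ax(8))
  qed
qed

sublocale num: ordered_cancel_comm_monoid_diff plus zero less_eq less minus
proof
  have "a \<preceq> a \<oplus> c" for a c
    using semiring_axioms(15)[of c] num.add_left_mono[of \<zero> c a] by simp
  then show "a \<preceq> b \<longleftrightarrow> (\<exists>c. b = a \<oplus> c)" for a b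
    using le_imp_ex_add[of a b] by (metis num.add.commute)
  then show "\<zero> \<ominus> a = \<zero>" for a
    using minus_zero[of a \<zero>] minus_eq[of \<zero> \<zero> \<zero>] semiring_axioms(15)[of a] num.order.antisym
    by (metis num.add_0)
qed

end

lemma fv_tm_lam: "fv_tm (lam v t) = fv_tm t - {v}"
  by (induction t) (auto simp: lam.simps Let_def)

context numbered_model
begin

section \<open>Discrete order and choice for quantifier-free properties\<close>

lemma less_Suc_iff [simp]: "a \<prec> b \<oplus> \<one> \<longleftrightarrow> a \<preceq> b"
  using less_imp_Suc_le[of b a] num.add_strict_left_mono[OF num.zero_less_one, of b]
  by (metis num.add_0_right num.le_less_trans num.not_le)

lemma Suc_le_iff: "a \<oplus> \<one> \<preceq> b \<longleftrightarrow> a \<prec> b"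
  using less_Suc_iff[of b a] by (metis num.not_le)

lemma le_one_iff: "a \<preceq> \<one> \<longleftrightarrow> a = \<zero> \<or> a = \<one>"
  using Suc_le_iff[of \<zero> a] by (metis num.add_0 num.le_less num.not_less num.zero_less_one num.zero_le)

text \<open>Contraposition of induction. It stands in for the least number principle, whose usual
  proof needs a bounded quantifier.\<close>

lemma QF_switch:
  assumes "quantifier_free A" "wff [] A" "typed \<rho>"
    and P: "\<And>n. P n \<longleftrightarrow> sat [] (\<rho>((x, N) := nu n)) A"
    and "\<not> P \<zero>" "P m"
  shows "\<exists>k. \<not> P k \<and> P (k \<oplus> \<one>)"
proof (rule ccontr)
  assume *: "\<not> ?thesis"
  have "\<not> P n" for n
    by (rule QF_induct[where P = "\<lambda>n. \<not> P n" and A = "\<^bold>\<not> A" and \<rho> = \<rho> and x = x])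
      (use assms * in auto)
  then show False using assms by blast
qed

text \<open>Choice over type \<open>1\<close> gives choice over pairs of numbers by coding \<open>m, n\<close> as a function \<open>x\<close>
  with \<open>x(0) = m\<close> and \<open>x(1) = n\<close>.\<close>

lemma QF_choice2:
  assumes A: "quantifier_free A" "wff [] A" and \<rho>: "typed \<rho>"
    and fresh: "(''x'', ty1) \<notin> fv A" "(''Y'', ty2) \<notin> fv A"
    and P: "\<And>m n k. P m n k \<longleftrightarrow> sat [] (\<rho>((''m'', N) := nu m, (''n'', N) := nu n, (''k'', N) := nu k)) A"
    and ex: "\<And>m n. \<exists>k. P m n k"
  shows "\<exists>q\<in>D (N \<Rrightarrow> ty1). \<forall>m n. P m n (q \<odot> nu m \<bullet> n)"
proof -
  let ?x = "Fv (''x'', ty1)"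
  let ?A' = "subst (''m'', N) (?x \<cdot> \<^bold>0) (subst (''n'', N) (?x \<cdot> \<^bold>1) A)"
  have sat: "sat [] (\<rho>((''x'', ty1) := f, (''k'', N) := nu k)) ?A' \<longleftrightarrow> P (f \<bullet> \<zero>) (f \<bullet> \<one>) k"
    if "f \<in> D ty1" for f k
  proof -
    have "sat [] (\<rho>((''x'', ty1) := f, (''k'', N) := nu k)) ?A' \<longleftrightarrow>
      sat [] (\<rho>((''x'', ty1) := f, (''k'', N) := nu k, (''m'', N) := nu (f \<bullet> \<zero>), (''n'', N) := nu (f \<bullet> \<one>))) A"
      using that by (simp add: sat_subst[of _ N])
    also have "\<dots> \<longleftrightarrow> sat [] (\<rho>((''m'', N) := nu (f \<bullet> \<zero>), (''n'', N) := nu (f \<bullet> \<one>), (''k'', N) := nu k)) A"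
      by (rule sat_cong) (use fresh in \<open>auto simp: fun_upd_apply\<close>)
    finally show ?thesis by (simp add: P)
  qed
  have "fv ?A' \<subseteq> fv A \<union> {(''x'', ty1)}"
    using fv_subst[of "(''m'', N)" "?x \<cdot> \<^bold>0" "subst (''n'', N) (?x \<cdot> \<^bold>1) A"]
      fv_subst[of "(''n'', N)" "?x \<cdot> \<^bold>1" A] by auto
  then have "\<exists>F\<in>D ty2. \<forall>f\<in>D ty1. sat [] (\<rho>((''x'', ty1) := f, (''k'', N) := nu (F \<star> f))) ?A'"
    using A \<rho> fresh ex by (intro QF_AC[where Y = "''Y''"]) (auto simp: quantifier_free_subst sat intro!: wff_subst)
  then obtain F where F: "F \<in> D ty2" "\<And>f. f \<in> D ty1 \<Longrightarrow> P (f \<bullet> \<zero>) (f \<bullet> \<one>) (F \<star> f)"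
    using sat by blast
  \<comment> \<open>Recursion with start value \<open>m\<close> and constant step value
    \<open>n\<close> takes the value \<open>m\<close> at zero and \<open>n\<close> at one.\<close>
  let ?pair = "lam (''m'', N) (lam (''n'', N)
    (Con (CRec N) \<cdot> lam (''i'', N) (lam (''c'', N) (Fv (''n'', N))) \<cdot> Fv (''m'', N)))"
  define pair where "pair = eval [] \<rho>0 ?pair"
  have pair: "pair \<odot> nu m \<odot> nu n \<in> D ty1 \<and> pair \<odot> nu m \<odot> nu n \<bullet> \<zero> = m \<and> pair \<odot> nu m \<odot> nu n \<bullet> \<one> = n"
    for m n
  proof -
    let ?\<rho> = "\<rho>0((''m'', N) := nu m, (''n'', N) := nu n)"
    define g where "g = eval [] ?\<rho> (lam (''i'', N) (lam (''c'', N) (Fv (''n'', N))))"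
    have g: "g \<in> D (N \<Rrightarrow> ty1)" by (auto simp: g_def intro!: eval_D)
    have "g \<odot> nu a \<odot> nu b = nu n" for a b by (simp add: g_def)
    then have g_app: "g \<odot> nu a \<bullet> b = n" for a b using g by simp
    have eq: "pair \<odot> nu m \<odot> nu n = cst (CRec N) \<odot> g \<odot> nu m" by (simp add: pair_def g_def)
    show ?thesis
      using rec_zero[OF g, of m] rec_Suc[OF g, of m \<zero>] g g_app by (simp add: eq)
  qed
  define q where "q = eval [] (\<rho>0((''F'', ty2) := F, (''p'', N \<Rrightarrow> N \<Rrightarrow> ty1) := pair))
    (lam (''m'', N) (lam (''n'', N)
      (Fv (''F'', ty2) \<cdot> (Fv (''p'', N \<Rrightarrow> N \<Rrightarrow> ty1) \<cdot> Fv (''m'', N) \<cdot> Fv (''n'', N)))))"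
  have pairD: "pair \<in> D (N \<Rrightarrow> N \<Rrightarrow> ty1)" by (auto simp: pair_def intro!: eval_D)
  have q: "q \<in> D (N \<Rrightarrow> ty1)" using F pairD by (auto simp: q_def intro!: eval_D)
  have "q \<odot> nu m \<odot> nu n = nu (F \<star> (pair \<odot> nu m \<odot> nu n))" for m n
    using F pairD by (simp add: q_def)
  then have "q \<odot> nu m \<bullet> n = F \<star> (pair \<odot> nu m \<odot> nu n)" for m n using q by simp
  then show ?thesis using q F(2) pair by (intro bexI[of _ q]) metis+
qed

lemma QF_choice1:
  assumes A: "quantifier_free A" "wff [] A" and \<rho>: "typed \<rho>"
    and fresh: "(''x'', ty1) \<notin> fv A" "(''Y'', ty2) \<notin> fv A" "(''m'', N) \<notin> fv A"
    and P: "\<And>n k. P n k \<longleftrightarrow> sat [] (\<rho>((''n'', N) := nu n, (''k'', N) := nu k)) A"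
    and ex: "\<And>n. \<exists>k. P n k"
  shows "\<exists>q\<in>D ty1. \<forall>n. P n (q \<bullet> n)"
proof -
  have "sat [] (\<rho>((''m'', N) := nu m, (''n'', N) := nu n, (''k'', N) := nu k)) A \<longleftrightarrow> P n k" for m n k
    unfolding P by (rule sat_cong) (use fresh in \<open>auto simp: fun_upd_apply\<close>)
  then obtain q where "q \<in> D (N \<Rrightarrow> ty1)" "\<And>n. P n (q \<odot> nu \<zero> \<bullet> n)"
    using QF_choice2[OF A \<rho> fresh(1,2), of "\<lambda>m n k. P n k"] ex by auto
  then show ?thesis by (intro bexI[of _ "q \<odot> nu \<zero>"]) auto
qed

text \<open>A truth value is a choice: the graph of the characteristic function is quantifier-free
  when \<open>A\<close> is. The freshness conditions protect the names reserved for this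
  choice.\<close>

lemma QF_char2:
  assumes A: "quantifier_free A" "wff [] A" and \<rho>: "typed \<rho>"
    and fresh: "(''x'', ty1) \<notin> fv A" "(''Y'', ty2) \<notin> fv A" "(''k'', N) \<notin> fv A"
    and P: "\<And>m n. P m n \<longleftrightarrow> sat [] (\<rho>((''m'', N) := nu m, (''n'', N) := nu n)) A"
  shows "\<exists>q\<in>D (N \<Rrightarrow> ty1). \<forall>m n. q \<odot> nu m \<bullet> n = (if P m n then \<one> else \<zero>)"
proof -
  have *: "sat [] (\<rho>((''m'', N) := nu m, (''n'', N) := nu n, (''k'', N) := nu k)) A \<longleftrightarrow> P m n" for m n k
    unfolding P by (rule sat_cong) (use fresh in \<open>auto simp: fun_upd_apply\<close>)
  show ?thesis
    by (rule QF_choice2[where P = "\<lambda>m n k. k = (if P m n then \<one> else \<zero>)" and \<rho> = \<rho> and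
      A = "(A \<^bold>\<longrightarrow> Fv (''k'', N) \<^bold>= \<^bold>1) \<^bold>\<and> (\<^bold>\<not> A \<^bold>\<longrightarrow> Fv (''k'', N) \<^bold>= \<^bold>0)"])
      (use A \<rho> fresh * in auto)
qed

lemma QF_char1:
  assumes A: "quantifier_free A" "wff [] A" and \<rho>: "typed \<rho>"
    and fresh: "(''x'', ty1) \<notin> fv A" "(''Y'', ty2) \<notin> fv A" "(''k'', N) \<notin> fv A" "(''m'', N) \<notin> fv A"
    and P: "\<And>n. P n \<longleftrightarrow> sat [] (\<rho>((''n'', N) := nu n)) A"
  shows "\<exists>q\<in>D ty1. \<forall>n. q \<bullet> n = (if P n then \<one> else \<zero>)"
proof -
  have *: "sat [] (\<rho>((''n'', N) := nu n, (''k'', N) := nu k)) A \<longleftrightarrow> P n" for n k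
    unfolding P by (rule sat_cong) (use fresh in \<open>auto simp: fun_upd_apply\<close>)
  show ?thesis
    by (rule QF_choice1[where P = "\<lambda>n k. k = (if P n then \<one> else \<zero>)" and \<rho> = \<rho> and
      A = "(A \<^bold>\<longrightarrow> Fv (''k'', N) \<^bold>= \<^bold>1) \<^bold>\<and> (\<^bold>\<not> A \<^bold>\<longrightarrow> Fv (''k'', N) \<^bold>= \<^bold>0)"])
      (use A \<rho> fresh * in auto)
qed

section \<open>Codes of finite binary sequences\<close>

definition Barc where "Barc = eval [] \<rho>0 Bar"
definition Powc where "Powc = eval [] \<rho>0 Pow2"

abbreviation br :: "'a \<Rightarrow> 'n \<Rightarrow> 'n" where "br f n \<equiv> Barc \<odot> f \<bullet> n"
abbreviation pw :: "'n \<Rightarrow> 'n" where "pw n \<equiv> Powc \<bullet> n"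

lemma eval_Bar [simp]: "eval e \<rho> Bar = Barc"
  unfolding Barc_def eval_closed[OF has_ty_Bar[of "[]"], of e]
  by (rule eval_cong) simp

lemma eval_Pow2 [simp]: "eval e \<rho> Pow2 = Powc"
  unfolding Powc_def eval_closed[OF has_ty_Pow2[of "[]"], of e]
  by (rule eval_cong) simp

lemma Barc_D [simp]: "Barc \<in> D (ty1 \<Rrightarrow> ty1)"
  unfolding Barc_def by (rule eval_D) auto

lemma Powc_D [simp]: "Powc \<in> D ty1"
  unfolding Powc_def by (rule eval_D) auto

lemma br_zero [simp]: "f \<in> D ty1 \<Longrightarrow> br f \<zero> = \<one>"
  and br_Suc [simp]: "f \<in> D ty1 \<Longrightarrow> br f (n \<oplus> \<one>) = br f n \<oplus> br f n \<oplus> f \<bullet> n"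
proof -
  assume f: "f \<in> D ty1"
  let ?t = "lam (''k'', N) (lam (''c'', N)
    (Fv (''c'', N) \<^bold>+ Fv (''c'', N) \<^bold>+ Fv (''f'', ty1) \<cdot> Fv (''k'', N)))"
  define g where "g = eval [] (\<rho>0((''f'', ty1) := f)) ?t"
  have g: "g \<in> D (N \<Rrightarrow> ty1)" using f by (auto simp: g_def intro!: eval_D)
  have "g \<odot> nu a \<odot> nu b = nu (b \<oplus> b \<oplus> f \<bullet> a)" for a b using f by (simp add: g_def)
  then have g_app: "g \<odot> nu a \<bullet> b = b \<oplus> b \<oplus> f \<bullet> a" for a b using g by simp
  have "Barc \<odot> f \<odot> nu n = cst (CRec N) \<odot> g \<odot> nu \<one> \<odot> nu n" for n
  proof -
    have "eval [] (\<rho>0((''f'', ty1) := f, (''n'', N) := nu n)) ?t = g"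
      unfolding g_def by (rule eval_cong) (auto simp: fv_tm_lam fun_upd_apply)
    then show ?thesis using f by (simp add: Barc_def Bar_def Let_def)
  qed
  then have eq: "br f n = cst (CRec N) \<odot> g \<odot> nu \<one> \<bullet> n" for n using f g by simp
  show "br f \<zero> = \<one>" "br f (n \<oplus> \<one>) = br f n \<oplus> br f n \<oplus> f \<bullet> n"
    using g g_app by (simp_all add: eq)
qed

lemma pw_zero [simp]: "pw \<zero> = \<one>" and pw_Suc [simp]: "pw (n \<oplus> \<one>) = pw n \<oplus> pw n"
proof -
  let ?t = "lam (''k'', N) (lam (''c'', N) (Fv (''c'', N) \<^bold>+ Fv (''c'', N)))"
  define g where "g = eval [] \<rho>0 ?t"
  have g: "g \<in> D (N \<Rrightarrow> ty1)" by (auto simp: g_def intro!: eval_D)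
  have "g \<odot> nu a \<odot> nu b = nu (b \<oplus> b)" for a b by (simp add: g_def)
  then have g_app: "g \<odot> nu a \<bullet> b = b \<oplus> b" for a b using g by simp
  have eq: "Powc = cst (CRec N) \<odot> g \<odot> nu \<one>" by (simp add: Powc_def Pow2_def Let_def g_def)
  show "pw \<zero> = \<one>" "pw (n \<oplus> \<one>) = pw n \<oplus> pw n" using g g_app by (simp_all add: eq)
qed

end

abbreviation nv :: "string \<Rightarrow> tm" where "nv s \<equiv> Fv (s, N)"
abbreviation fn :: "string \<Rightarrow> tm" where "fn s \<equiv> Fv (s, ty1)"

context numbered_model
begin

section \<open>Powers of two and the codes of initial segments\<close>

lemmas add_ac = num.add.assoc num.add.commute num.add.left_commute

lemma pw_pos [simp]: "\<zero> \<prec> pw n"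
proof (rule QF_induct[where P = "\<lambda>n. \<zero> \<prec> pw n" and \<rho> = \<rho>0 and x = "''n''" and
      A = "\<^bold>0 \<^bold>< Pow2 \<cdot> nv ''n''"])
  show "\<zero> \<prec> pw (n \<oplus> \<one>)" if "\<zero> \<prec> pw n" for n
    using that num.add_pos_pos by simp
qed auto

lemma pw_add: "pw (i \<oplus> j) = pw i \<otimes> pw j"
proof (rule QF_induct[where P = "\<lambda>j. pw (i \<oplus> j) = pw i \<otimes> pw j" and x = "''n''" and
      \<rho> = "\<rho>0((''i'', N) := nu i)" and
      A = "Pow2 \<cdot> (nv ''i'' \<^bold>+ nv ''n'') \<^bold>= Pow2 \<cdot> nv ''i'' \<^bold>* (Pow2 \<cdot> nv ''n'')"])
  show "pw (i \<oplus> (n \<oplus> \<one>)) = pw i \<otimes> pw (n \<oplus> \<one>)" if "pw (i \<oplus> n) = pw i \<otimes> pw n" for n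
    using that by (simp flip: num.add.assoc add: num.distrib_left)
qed auto

lemma Suc_le_pw: "n \<oplus> \<one> \<preceq> pw n"
proof (rule QF_induct[where P = "\<lambda>n. n \<oplus> \<one> \<preceq> pw n" and \<rho> = \<rho>0 and x = "''n''" and
      A = "nv ''n'' \<^bold>+ \<^bold>1 \<^bold>\<le> Pow2 \<cdot> nv ''n''"])
  show "n \<oplus> \<one> \<oplus> \<one> \<preceq> pw (n \<oplus> \<one>)" if "n \<oplus> \<one> \<preceq> pw n" for n
    using that pw_pos[of n] by (simp add: num.add_mono Suc_le_iff[of \<zero>, simplified])
qed auto

lemma less_pw: "n \<prec> pw n"
  using Suc_le_pw Suc_le_iff by blast

lemma pw_mono: "i \<preceq> j \<Longrightarrow> pw i \<preceq> pw j"
proof -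
  assume "i \<preceq> j"
  then obtain d where "j = i \<oplus> d" using num.le_iff_add by blast
  moreover have "\<one> \<preceq> pw d" using pw_pos[of d] Suc_le_iff[of \<zero>] by simp
  ultimately show ?thesis using num.mult_left_mono[of \<one> "pw d" "pw i"] by (simp add: pw_add)
qed

lemma less_Suc_pw: "pw i \<prec> pw (j \<oplus> \<one>) \<Longrightarrow> i \<preceq> j"
  using pw_mono[of "j \<oplus> \<one>" i] Suc_le_iff num.not_le by metis

definition cantor :: "'a \<Rightarrow> bool" where
  "cantor f \<longleftrightarrow> f \<in> D ty1 \<and> (\<forall>n. f \<bullet> n \<preceq> \<one>)"

lemma cantor_D [simp]: "cantor f \<Longrightarrow> f \<in> D ty1"
  by (simp add: cantor_def)

lemma pw_le_br: "f \<in> D ty1 \<Longrightarrow> pw n \<preceq> br f n"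
proof (rule QF_induct[where P = "\<lambda>n. pw n \<preceq> br f n" and x = "''n''" and
      \<rho> = "\<rho>0((''f'', ty1) := f)" and A = "Pow2 \<cdot> nv ''n'' \<^bold>\<le> Bar \<cdot> fn ''f'' \<cdot> nv ''n''"])
  show "pw (n \<oplus> \<one>) \<preceq> br f (n \<oplus> \<one>)" if "pw n \<preceq> br f n" "f \<in> D ty1" for n
    using that num.add_mono[of "pw n \<oplus> pw n" "br f n \<oplus> br f n" \<zero> "f \<bullet> n"] by (simp add: num.add_mono)
qed auto

lemma br_less_pw:
  assumes "cantor f"
  shows "br f n \<prec> pw (n \<oplus> \<one>)"
proof -
  \<comment> \<open>The strict bound is proved in the form with \<open>+ 1\<close>: adding two
    copies of it leaves exactly the room that a new bit may take.\<close>
  have "br f n \<oplus> \<one> \<preceq> pw n \<oplus> pw n"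
  proof (rule QF_induct[where P = "\<lambda>n. br f n \<oplus> \<one> \<preceq> pw n \<oplus> pw n" and x = "''n''" and
      \<rho> = "\<rho>0((''f'', ty1) := f)" and
      A = "Bar \<cdot> fn ''f'' \<cdot> nv ''n'' \<^bold>+ \<^bold>1 \<^bold>\<le> Pow2 \<cdot> nv ''n'' \<^bold>+ Pow2 \<cdot> nv ''n''"])
    fix n assume IH: "br f n \<oplus> \<one> \<preceq> pw n \<oplus> pw n"
    have "br f (n \<oplus> \<one>) \<oplus> \<one> \<preceq> br f n \<oplus> br f n \<oplus> \<one> \<oplus> \<one>"
      using assms by (simp add: cantor_def)
    also have "\<dots> = (br f n \<oplus> \<one>) \<oplus> (br f n \<oplus> \<one>)" by (simp add: add_ac)
    also have "\<dots> \<preceq> pw (n \<oplus> \<one>) \<oplus> pw (n \<oplus> \<one>)" using num.add_mono[OF IH IH] by simp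
    finally show "br f (n \<oplus> \<one>) \<oplus> \<one> \<preceq> pw (n \<oplus> \<one>) \<oplus> pw (n \<oplus> \<one>)" .
  qed (use assms in auto)
  then show ?thesis by (simp add: Suc_le_iff)
qed

lemma br_pos: "f \<in> D ty1 \<Longrightarrow> \<zero> \<prec> br f n"
  using pw_le_br pw_pos num.less_le_trans by blast

text \<open>Because of its leading one, a code of length \<open>n\<close> is at least 2^n and below
  2^(n+1), so it determines its length.\<close>

lemma br_length_unique: "cantor f \<Longrightarrow> cantor g \<Longrightarrow> br f m = br g n \<Longrightarrow> m = n"
proof -
  have "m \<preceq> n" if "cantor f" "cantor g" "br f m = br g n" for f g m n
    using pw_le_br[of f m] br_less_pw[of g n] that
    by (intro less_Suc_pw) (auto intro: num.le_less_trans)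
  then show "cantor f \<Longrightarrow> cantor g \<Longrightarrow> br f m = br g n \<Longrightarrow> m = n"
    using num.order.antisym by metis
qed

text \<open>Uniqueness of halving with remainder: a code determines its last bit and the code
  without that bit.\<close>

lemma double_unique:
  assumes "a \<oplus> a \<oplus> b = c \<oplus> c \<oplus> d" "b \<preceq> \<one>" "d \<preceq> \<one>"
  shows "a = c \<and> b = d"
proof -
  have "c \<preceq> a" if eq: "a \<oplus> a \<oplus> b = c \<oplus> c \<oplus> d" and b: "b \<preceq> \<one>" for a b c d
  proof (rule num.leI, rule notI)
    assume "a \<prec> c"
    then have "a \<oplus> \<one> \<preceq> c" by (simp add: Suc_le_iff)
    from num.add_mono[OF this this] have "a \<oplus> a \<oplus> \<one> \<oplus> \<one> \<preceq> c \<oplus> c" by (simp add: add_ac)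
    moreover have "c \<oplus> c \<preceq> a \<oplus> a \<oplus> \<one>"
      using eq b num.add_left_mono[OF b, of "a \<oplus> a"] num.le_add_same_cancel1[of "c \<oplus> c" d]
        num.order_trans by (metis num.zero_le)
    ultimately show False using Suc_le_iff num.not_less num.order_trans by metis
  qed
  then have "a = c" using assms num.order.antisym by metis
  then show ?thesis using assms by simp
qed

text \<open>The last bits are removed one at a time. With \<open>j\<close> fixed, the induction on
  the number \<open>d\<close> of removed bits is quantifier-free.\<close>

lemma br_agree:
  assumes f: "cantor f" and g: "cantor g" and eq: "br f n = br g n" and j: "j \<preceq> n"
  shows "br f j = br g j"
proof -
  obtain d where n: "n = j \<oplus> d" using j num.le_iff_add by blast
  have "br f (j \<oplus> d) = br g (j \<oplus> d) \<longrightarrow> br f j = br g j" for d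
  proof (rule QF_induct[where P = "\<lambda>d. br f (j \<oplus> d) = br g (j \<oplus> d) \<longrightarrow> br f j = br g j" and
      x = "''n''" and \<rho> = "\<rho>0((''f'', ty1) := f, (''g'', ty1) := g, (''j'', N) := nu j)" and
      A = "Bar \<cdot> fn ''f'' \<cdot> (nv ''j'' \<^bold>+ nv ''n'') \<^bold>= Bar \<cdot> fn ''g'' \<cdot> (nv ''j'' \<^bold>+ nv ''n'') \<^bold>\<longrightarrow>
        Bar \<cdot> fn ''f'' \<cdot> nv ''j'' \<^bold>= Bar \<cdot> fn ''g'' \<cdot> nv ''j''"])
    fix n assume IH: "br f (j \<oplus> n) = br g (j \<oplus> n) \<longrightarrow> br f j = br g j"
    have "br f (j \<oplus> (n \<oplus> \<one>)) = br g (j \<oplus> (n \<oplus> \<one>)) \<Longrightarrow> br f (j \<oplus> n) = br g (j \<oplus> n)"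
      using f g double_unique[of "br f (j \<oplus> n)" "f \<bullet> (j \<oplus> n)" "br g (j \<oplus> n)" "g \<bullet> (j \<oplus> n)"]
      by (simp add: cantor_def flip: num.add.assoc)
    then show "br f (j \<oplus> (n \<oplus> \<one>)) = br g (j \<oplus> (n \<oplus> \<one>)) \<longrightarrow> br f j = br g j" using IH by blast
  qed (use f g in auto)
  then show ?thesis using eq n by blast
qed

lemma bits_agree:
  assumes "cantor f" "cantor g" "br f n = br g n" "j \<prec> n"
  shows "f \<bullet> j = g \<bullet> j"
proof -
  have "br f (j \<oplus> \<one>) = br g (j \<oplus> \<one>)" using br_agree assms Suc_le_iff by blast
  then show ?thesis
    using assms double_unique[of "br f j" "f \<bullet> j" "br g j" "g \<bullet> j"] by (simp add: cantor_def)
qed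

lemma quotient_unique:
  assumes "q \<otimes> d \<preceq> x" "x \<prec> (q \<oplus> \<one>) \<otimes> d" "r \<otimes> d \<preceq> x" "x \<prec> (r \<oplus> \<one>) \<otimes> d"
  shows "q = r"
proof -
  have "q \<preceq> r" if "q \<otimes> d \<preceq> x" "x \<prec> (r \<oplus> \<one>) \<otimes> d" for q r
    using that num.mult_right_mono[of "r \<oplus> \<one>" q d] Suc_le_iff[of r q]
    by (metis num.le_less_trans num.not_less num.order.strict_trans1 num.zero_le)
  then show ?thesis using assms num.order.antisym by metis
qed

lemma quotient_exists:
  assumes "\<zero> \<prec> d"
  shows "\<exists>q. q \<otimes> d \<preceq> x \<and> x \<prec> (q \<oplus> \<one>) \<otimes> d"
proof -
  have "x \<oplus> \<one> \<preceq> (x \<oplus> \<one>) \<otimes> d"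
    using num.mult_left_mono[of \<one> d "x \<oplus> \<one>"] assms Suc_le_iff[of \<zero> d] by simp
  then have "x \<prec> (x \<oplus> \<one>) \<otimes> d" by (simp add: Suc_le_iff)
  \<comment> \<open>The quotient is the place where \<open>x \<prec> q \<otimes> d\<close> becomes
    true; at \<open>x \<oplus> \<one>\<close> it has done so.\<close>
  then have "\<exists>q. \<not> x \<prec> q \<otimes> d \<and> x \<prec> (q \<oplus> \<one>) \<otimes> d"
    by (intro QF_switch[where P = "\<lambda>q. x \<prec> q \<otimes> d" and x = "''n''" and
      \<rho> = "\<rho>0((''x'', N) := nu x, (''d'', N) := nu d)" and A = "nv ''x'' \<^bold>< nv ''n'' \<^bold>* nv ''d''"]) auto
  then show ?thesis by (simp add: num.not_less)
qed

text \<open>Removing the last \<open>d\<close> bits is division by 2^d with rounding down. The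
  strict bound is again carried in the form with \<open>+ 1\<close>, which survives
  doubling.\<close>

lemma br_quotient:
  assumes f: "cantor f"
  shows "br f j \<otimes> pw d \<preceq> br f (j \<oplus> d)" "br f (j \<oplus> d) \<prec> (br f j \<oplus> \<one>) \<otimes> pw d"
proof -
  let ?P = "\<lambda>d. br f j \<otimes> pw d \<preceq> br f (j \<oplus> d) \<and> br f (j \<oplus> d) \<oplus> \<one> \<preceq> (br f j \<oplus> \<one>) \<otimes> pw d"
  have "?P d"
  proof (rule QF_induct[where P = ?P and x = "''n''" and
      \<rho> = "\<rho>0((''f'', ty1) := f, (''j'', N) := nu j)" and
      A = "Bar \<cdot> fn ''f'' \<cdot> nv ''j'' \<^bold>* (Pow2 \<cdot> nv ''n'') \<^bold>\<le> Bar \<cdot> fn ''f'' \<cdot> (nv ''j'' \<^bold>+ nv ''n'') \<^bold>\<and>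
        Bar \<cdot> fn ''f'' \<cdot> (nv ''j'' \<^bold>+ nv ''n'') \<^bold>+ \<^bold>1 \<^bold>\<le> (Bar \<cdot> fn ''f'' \<cdot> nv ''j'' \<^bold>+ \<^bold>1) \<^bold>* (Pow2 \<cdot> nv ''n'')"])
    fix n assume IH: "?P n"
    let ?b = "br f (j \<oplus> n)"
    have b: "br f (j \<oplus> (n \<oplus> \<one>)) = ?b \<oplus> ?b \<oplus> f \<bullet> (j \<oplus> n)"
      using f by (simp flip: num.add.assoc)
    have "br f j \<otimes> pw (n \<oplus> \<one>) \<preceq> ?b \<oplus> ?b"
      using num.add_mono[OF conjunct1[OF IH] conjunct1[OF IH]] by (simp add: num.distrib_left)
    also have "\<dots> \<preceq> br f (j \<oplus> (n \<oplus> \<one>))" unfolding b by simp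
    finally have 1: "br f j \<otimes> pw (n \<oplus> \<one>) \<preceq> br f (j \<oplus> (n \<oplus> \<one>))" .
    have "br f (j \<oplus> (n \<oplus> \<one>)) \<oplus> \<one> \<preceq> ?b \<oplus> ?b \<oplus> \<one> \<oplus> \<one>"
      unfolding b using f by (simp add: cantor_def)
    also have "\<dots> = (?b \<oplus> \<one>) \<oplus> (?b \<oplus> \<one>)" by (simp add: add_ac)
    also have "\<dots> \<preceq> (br f j \<oplus> \<one>) \<otimes> pw (n \<oplus> \<one>)"
      using num.add_mono[OF conjunct2[OF IH] conjunct2[OF IH]]
      by (simp add: num.distrib_left[of "br f j \<oplus> \<one>"])
    finally show "?P (n \<oplus> \<one>)" using 1 by blast
  qed (use f in auto)
  then show "br f j \<otimes> pw d \<preceq> br f (j \<oplus> d)" "br f (j \<oplus> d) \<prec> (br f j \<oplus> \<one>) \<otimes> pw d"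
    by (simp_all add: Suc_le_iff)
qed

end

section \<open>Length, truncation and decoding of arbitrary codes\<close>

lemma bex_some:
  assumes "\<exists>x\<in>A. P x"
  shows "(SOME x. x \<in> A \<and> P x) \<in> A \<and> P (SOME x. x \<in> A \<and> P x)"
  by (rule someI_ex) (use assms in blast)

context numbered_model
begin

declare num.one_add_one [simp del]

text \<open>The length function comes from choice, not from recursion on codes. Zero codes nothing,
  and the value there is left open.\<close>

definition Lenc where
  "Lenc = (SOME q. q \<in> D ty1 \<and> (\<forall>s. s = \<zero> \<or> pw (q \<bullet> s) \<preceq> s \<and> s \<prec> pw (q \<bullet> s \<oplus> \<one>)))"

abbreviation len where "len s \<equiv> Lenc \<bullet> s"

lemma Lenc: "Lenc \<in> D ty1 \<and> (\<forall>s. s = \<zero> \<or> pw (len s) \<preceq> s \<and> s \<prec> pw (len s \<oplus> \<one>))"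
proof -
  have ex: "\<exists>k. s = \<zero> \<or> pw k \<preceq> s \<and> s \<prec> pw (k \<oplus> \<one>)" for s
  proof (cases "s = \<zero>")
    case False
    then have "\<not> s \<prec> pw \<zero>" using Suc_le_iff[of \<zero> s] num.zero_less_iff_neq_zero[of s] by (simp add: num.not_less)
    then have "\<exists>k. \<not> s \<prec> pw k \<and> s \<prec> pw (k \<oplus> \<one>)"
      by (intro QF_switch[where P = "\<lambda>k. s \<prec> pw k" and x = "''n''" and m = s and
        \<rho> = "\<rho>0((''s'', N) := nu s)" and A = "nv ''s'' \<^bold>< Pow2 \<cdot> nv ''n''"]) (auto simp: less_pw)
    then show ?thesis by (auto simp: num.not_less)
  qed simp
  have "\<exists>q\<in>D ty1. \<forall>s. s = \<zero> \<or> pw (q \<bullet> s) \<preceq> s \<and> s \<prec> pw (q \<bullet> s \<oplus> \<one>)"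
    by (rule QF_choice1[where P = "\<lambda>s k. s = \<zero> \<or> pw k \<preceq> s \<and> s \<prec> pw (k \<oplus> \<one>)" and \<rho> = \<rho>0 and
      A = "nv ''n'' \<^bold>= \<^bold>0 \<^bold>\<or> (Pow2 \<cdot> nv ''k'' \<^bold>\<le> nv ''n'' \<^bold>\<and> nv ''n'' \<^bold>< Pow2 \<cdot> (nv ''k'' \<^bold>+ \<^bold>1))"])
      (use ex in auto)
  from bex_some[OF this] show ?thesis unfolding Lenc_def[symmetric] .
qed

lemma Lenc_D [simp]: "Lenc \<in> D ty1"
  using Lenc by blast

lemma len_bounds: "s \<noteq> \<zero> \<Longrightarrow> pw (len s) \<preceq> s" "s \<noteq> \<zero> \<Longrightarrow> s \<prec> pw (len s \<oplus> \<one>)"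
  using Lenc by blast+

lemma len_unique: "pw k \<preceq> s \<Longrightarrow> s \<prec> pw (k \<oplus> \<one>) \<Longrightarrow> len s = k"
proof -
  assume k: "pw k \<preceq> s" "s \<prec> pw (k \<oplus> \<one>)"
  then have "s \<noteq> \<zero>" using pw_pos[of k] by auto
  then show ?thesis
    using k len_bounds[of s] less_Suc_pw[of k "len s"] less_Suc_pw[of "len s" k]
    by (meson num.order.antisym num.le_less_trans)
qed

lemma len_br: "cantor f \<Longrightarrow> len (br f n) = n"
  using pw_le_br br_less_pw by (intro len_unique) auto

text \<open>\<open>pre s i\<close> codes the initial segment of length \<open>i\<close> of \<open>s\<close>, padded by zeros if \<open>s\<close> is
  shorter: it is $\lfloor s \cdot 2^i / 2^{|s|} \rfloor$.\<close>

definition Prec where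
  "Prec = (SOME q. q \<in> D (N \<Rrightarrow> ty1) \<and> (\<forall>s i. q \<odot> nu s \<bullet> i \<otimes> pw (len s) \<preceq> s \<otimes> pw i \<and>
    s \<otimes> pw i \<prec> (q \<odot> nu s \<bullet> i \<oplus> \<one>) \<otimes> pw (len s)))"

abbreviation pre where "pre s i \<equiv> Prec \<odot> nu s \<bullet> i"

lemma Prec: "Prec \<in> D (N \<Rrightarrow> ty1) \<and> (\<forall>s i. pre s i \<otimes> pw (len s) \<preceq> s \<otimes> pw i \<and>
    s \<otimes> pw i \<prec> (pre s i \<oplus> \<one>) \<otimes> pw (len s))"
proof -
  let ?m = "nv ''m''" and ?n = "nv ''n''" and ?k = "nv ''k''" and ?l = "fn ''l'' \<cdot> nv ''m''"
  have "\<exists>q\<in>D (N \<Rrightarrow> ty1). \<forall>s i. q \<odot> nu s \<bullet> i \<otimes> pw (len s) \<preceq> s \<otimes> pw i \<and>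
    s \<otimes> pw i \<prec> (q \<odot> nu s \<bullet> i \<oplus> \<one>) \<otimes> pw (len s)"
    by (rule QF_choice2[where P = "\<lambda>s i k. k \<otimes> pw (len s) \<preceq> s \<otimes> pw i \<and>
        s \<otimes> pw i \<prec> (k \<oplus> \<one>) \<otimes> pw (len s)" and \<rho> = "\<rho>0((''l'', ty1) := Lenc)" and
      A = "?k \<^bold>* (Pow2 \<cdot> ?l) \<^bold>\<le> ?m \<^bold>* (Pow2 \<cdot> ?n) \<^bold>\<and> ?m \<^bold>* (Pow2 \<cdot> ?n) \<^bold>< (?k \<^bold>+ \<^bold>1) \<^bold>* (Pow2 \<cdot> ?l)"])
      (use quotient_exists in auto)
  from bex_some[OF this] show ?thesis unfolding Prec_def[symmetric] .
qed

lemma Prec_D [simp]: "Prec \<in> D (N \<Rrightarrow> ty1)"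
  using Prec by blast

lemma pre_unique: "q \<otimes> pw (len s) \<preceq> s \<otimes> pw i \<Longrightarrow> s \<otimes> pw i \<prec> (q \<oplus> \<one>) \<otimes> pw (len s) \<Longrightarrow> pre s i = q"
  using Prec quotient_unique by metis

lemma less_Suc_times: "\<zero> \<prec> d \<Longrightarrow> q \<otimes> d \<prec> (q \<oplus> \<one>) \<otimes> d"
  by (simp add: num.distrib_right num.zero_less_iff_neq_zero)

lemma pre_zero: "s \<noteq> \<zero> \<Longrightarrow> pre s \<zero> = \<one>"
  using len_bounds[of s] by (intro pre_unique) (simp_all add: num.distrib_right)

lemma pre_len: "pre s (len s) = s"
  using less_Suc_times[of "pw (len s)" s] by (intro pre_unique) simp_all

lemma pre_beyond: "pre s (len s \<oplus> e) = s \<otimes> pw e"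
proof (rule pre_unique)
  have eq: "s \<otimes> pw e \<otimes> pw (len s) = s \<otimes> pw (len s \<oplus> e)"
    by (simp add: pw_add num.mult.assoc num.mult.commute)
  then show "s \<otimes> pw e \<otimes> pw (len s) \<preceq> s \<otimes> pw (len s \<oplus> e)" by simp
  show "s \<otimes> pw (len s \<oplus> e) \<prec> (s \<otimes> pw e \<oplus> \<one>) \<otimes> pw (len s)"
    using less_Suc_times[of "pw (len s)" "s \<otimes> pw e"] by (simp add: eq)
qed

text \<open>Rounding down twice a number gives twice its rounded value plus 0 or 1; this difference
  is the next bit.\<close>

lemma pre_Suc: "\<exists>b. pre s (i \<oplus> \<one>) = pre s i \<oplus> pre s i \<oplus> b \<and> b \<preceq> \<one>"
proof -
  let ?q = "pre s i" and ?r = "pre s (i \<oplus> \<one>)" and ?p = "pw (len s)" and ?x = "s \<otimes> pw i"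
  have x: "s \<otimes> pw (i \<oplus> \<one>) = ?x \<oplus> ?x" by (simp add: num.distrib_left)
  have q: "?q \<otimes> ?p \<preceq> ?x" "?x \<prec> (?q \<oplus> \<one>) \<otimes> ?p" using Prec by blast+
  have r: "?r \<otimes> ?p \<preceq> ?x \<oplus> ?x" "?x \<oplus> ?x \<prec> (?r \<oplus> \<one>) \<otimes> ?p" using Prec x by metis+
  have "(?q \<oplus> ?q) \<otimes> ?p \<preceq> ?x \<oplus> ?x" using num.add_mono[OF q(1) q(1)] by (simp add: num.distrib_right)
  then have "(?q \<oplus> ?q) \<otimes> ?p \<prec> (?r \<oplus> \<one>) \<otimes> ?p" using r(2) num.le_less_trans by blast
  then have "?q \<oplus> ?q \<prec> ?r \<oplus> \<one>" by (rule num.mult_right_less_imp_less) simp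
  then have "?q \<oplus> ?q \<preceq> ?r" by simp
  then obtain b where b: "?r = ?q \<oplus> ?q \<oplus> b" using num.le_iff_add by blast
  have "?x \<oplus> ?x \<prec> ((?q \<oplus> \<one>) \<oplus> (?q \<oplus> \<one>)) \<otimes> ?p"
    using num.add_strict_mono[OF q(2) q(2)] by (simp only: num.distrib_right)
  then have "?r \<otimes> ?p \<prec> ((?q \<oplus> \<one>) \<oplus> (?q \<oplus> \<one>)) \<otimes> ?p" using r(1) num.le_less_trans by blast
  then have "?r \<prec> (?q \<oplus> \<one>) \<oplus> (?q \<oplus> \<one>)" by (rule num.mult_right_less_imp_less) simp
  also have "\<dots> = ?q \<oplus> ?q \<oplus> (\<one> \<oplus> \<one>)" by (simp add: add_ac)
  finally have "b \<preceq> \<one>" by (simp add: b)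
  then show ?thesis using b by blast
qed

text \<open>The sequence coded by \<open>s\<close>, continued by zeros.\<close>

definition Decc where
  "Decc = (SOME q. q \<in> D (N \<Rrightarrow> ty1) \<and>
    (\<forall>s i. pre s (i \<oplus> \<one>) = pre s i \<oplus> pre s i \<oplus> q \<odot> nu s \<bullet> i \<and> q \<odot> nu s \<bullet> i \<preceq> \<one>))"

abbreviation dec where "dec s \<equiv> Decc \<odot> nu s"

lemma Decc: "Decc \<in> D (N \<Rrightarrow> ty1) \<and>
  (\<forall>s i. pre s (i \<oplus> \<one>) = pre s i \<oplus> pre s i \<oplus> dec s \<bullet> i \<and> dec s \<bullet> i \<preceq> \<one>)"
proof -
  let ?p = "Fv (''p'', N \<Rrightarrow> ty1)" and ?m = "nv ''m''" and ?n = "nv ''n''" and ?k = "nv ''k''"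
  have "\<exists>q\<in>D (N \<Rrightarrow> ty1).
    \<forall>s i. pre s (i \<oplus> \<one>) = pre s i \<oplus> pre s i \<oplus> q \<odot> nu s \<bullet> i \<and> q \<odot> nu s \<bullet> i \<preceq> \<one>"
    by (rule QF_choice2[where P = "\<lambda>s i k. pre s (i \<oplus> \<one>) = pre s i \<oplus> pre s i \<oplus> k \<and> k \<preceq> \<one>" and
      \<rho> = "\<rho>0((''p'', N \<Rrightarrow> ty1) := Prec)" and
      A = "?p \<cdot> ?m \<cdot> (?n \<^bold>+ \<^bold>1) \<^bold>= ?p \<cdot> ?m \<cdot> ?n \<^bold>+ ?p \<cdot> ?m \<cdot> ?n \<^bold>+ ?k \<^bold>\<and> ?k \<^bold>\<le> \<^bold>1"])
      (use pre_Suc in auto)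
  from bex_some[OF this] show ?thesis unfolding Decc_def[symmetric] .
qed

lemma Decc_D [simp]: "Decc \<in> D (N \<Rrightarrow> ty1)"
  using Decc by blast

lemma cantor_dec [simp]: "cantor (dec s)"
  using Decc by (simp add: cantor_def)

lemma br_dec: "s \<noteq> \<zero> \<Longrightarrow> br (dec s) i = pre s i"
proof (rule QF_induct[where P = "\<lambda>i. br (dec s) i = pre s i" and x = "''n''" and
      \<rho> = "\<rho>0((''p'', ty1) := Prec \<odot> nu s, (''d'', ty1) := dec s)" and
      A = "Bar \<cdot> fn ''d'' \<cdot> nv ''n'' \<^bold>= fn ''p'' \<cdot> nv ''n''"])
  show "br (dec s) (i \<oplus> \<one>) = pre s (i \<oplus> \<one>)" if "br (dec s) i = pre s i" for i
    using that Decc by simp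
qed (auto simp: pre_zero)

lemma br_dec_len: "s \<noteq> \<zero> \<Longrightarrow> br (dec s) (len s) = s"
  by (simp add: br_dec pre_len)

lemma dec_beyond:
  assumes "len s \<preceq> i"
  shows "dec s \<bullet> i = \<zero>"
proof -
  obtain e where i: "i = len s \<oplus> e" using assms num.le_iff_add by blast
  have "pre s (i \<oplus> \<one>) = pre s i \<oplus> pre s i"
    using pre_beyond[of s e] pre_beyond[of s "e \<oplus> \<one>"] by (simp add: i num.add.assoc num.distrib_left)
  then show ?thesis using Decc by (metis num.add_cancel_left_right num.add_0_right num.add_left_cancel)
qed

lemma br_nonzero [simp]: "f \<in> D ty1 \<Longrightarrow> br f n \<noteq> \<zero>"
  using br_pos[of f n] by auto

lemma dec_br: "cantor f \<Longrightarrow> dec (br f i) \<bullet> j = (if j \<prec> i then f \<bullet> j else \<zero>)"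
  using bits_agree[of "dec (br f i)" f i j] br_dec_len[of "br f i"] dec_beyond[of "br f i" j]
  by (simp add: len_br num.not_less)

lemma pre_br: "cantor f \<Longrightarrow> i \<preceq> n \<Longrightarrow> pre (br f n) i = br f i"
  using br_agree[of "dec (br f n)" f n i] br_dec_len[of "br f n"] br_dec[of "br f n" i]
  by (simp add: len_br)

text \<open>\<open>is_initial_seg\<close> evaluated in the model: the purely arithmetical relation
  in which the definition of trees is phrased.\<close>

definition init where
  "init s t \<longleftrightarrow> \<one> \<preceq> s \<and> \<one> \<preceq> t \<and> (\<exists>k r. r \<prec> pw k \<and> t = s \<otimes> pw k \<oplus> r)"

lemma one_le_iff: "\<one> \<preceq> s \<longleftrightarrow> s \<noteq> \<zero>"
  using Suc_le_iff[of \<zero> s] num.zero_less_iff_neq_zero[of s] by simp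

lemma init_br: 
  assumes f: "cantor f" and j: "j \<preceq> n"
  shows "init (br f j) (br f n)"
proof -
  obtain d where n: "n = j \<oplus> d" using j num.le_iff_add by blast
  obtain r where r: "br f n = br f j \<otimes> pw d \<oplus> r"
    using br_quotient(1)[OF f, of j d] num.le_iff_add n by blast
  then have "r \<prec> pw d" using br_quotient(2)[OF f, of j d] n by (simp add: num.distrib_right)
  then show ?thesis using r f by (auto simp: init_def one_le_iff)
qed

text \<open>Both \<open>s\<close> and the truncation of \<open>t\<close> by \<open>k\<close> bits
  are the quotient of \<open>t\<close> by 2^k. This links the arithmetical relation to decoded
  sequences.\<close>

lemma initD:
  assumes "init s t"
  shows "s = br (dec t) (len s)" "len s \<preceq> len t" "s \<noteq> \<zero>" "t \<noteq> \<zero>"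
proof -
  obtain k r where k: "r \<prec> pw k" "t = s \<otimes> pw k \<oplus> r" and nz: "s \<noteq> \<zero>" "t \<noteq> \<zero>"
    using assms by (auto simp: init_def one_le_iff)
  let ?n = "len t"
  have t: "br (dec t) ?n = t" using nz br_dec_len by simp
  have s: "\<one> \<preceq> s" using nz by (simp add: one_le_iff)
  have "pw k \<preceq> s \<otimes> pw k" using num.mult_right_mono[OF s, of "pw k"] by simp
  also have "\<dots> \<preceq> t" by (simp add: k)
  also have "\<dots> \<prec> pw (?n \<oplus> \<one>)" using len_bounds nz by simp
  finally have "k \<preceq> ?n" by (rule less_Suc_pw)
  then obtain j where j: "?n = j \<oplus> k" using num.le_iff_add num.add.commute by metis
  have "s = br (dec t) j"
  proof (rule quotient_unique)
    show "s \<otimes> pw k \<preceq> t" by (simp add: k)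
    show "t \<prec> (s \<oplus> \<one>) \<otimes> pw k" using k by (simp add: num.distrib_right)
    show "br (dec t) j \<otimes> pw k \<preceq> t" "t \<prec> (br (dec t) j \<oplus> \<one>) \<otimes> pw k"
      using br_quotient[of "dec t" j k] j t by simp_all
  qed
  moreover from this have "len s = j" using len_br[of "dec t" j] by simp
  ultimately show "s = br (dec t) (len s)" "len s \<preceq> len t" using j by simp_all
qed (use assms in \<open>auto simp: init_def one_le_iff\<close>)

end

section \<open>The two implications\<close>

lemma bind_tm_closed: "v \<notin> fv_tm t \<Longrightarrow> bind_tm v k t = t"
  by (induction t) auto

lemma bind_Bar [simp]: "bind_tm v k Bar = Bar" and bind_Pow2 [simp]: "bind_tm v k Pow2 = Pow2"
  by (simp_all add: bind_tm_closed)

context numbered_model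
begin

lemma app2_D [simp]: "F \<in> D (ty1 \<Rrightarrow> N \<Rrightarrow> \<tau>) \<Longrightarrow> f \<in> D ty1 \<Longrightarrow> F \<odot> f \<odot> nu n \<in> D \<tau>"
  by (rule ap1_D) (rule ap2_D)

lemma less_or_eq_iff [simp]:
  "a \<prec> b \<or> a = b \<longleftrightarrow> a \<preceq> b" "\<not> a \<prec> b \<and> a \<noteq> b \<or> P \<longleftrightarrow> \<not> a \<preceq> b \<or> P"
  by (auto simp: less_eq_def)

section \<open>The three principles read in a model\<close>

definition is_tree where
  "is_tree T \<longleftrightarrow> cantor T \<and> (\<forall>s. T \<bullet> s = \<one> \<longrightarrow> \<one> \<preceq> s) \<and>
    (\<forall>t. T \<bullet> t = \<one> \<longrightarrow> (\<forall>s. init s t \<longrightarrow> T \<bullet> s = \<one>))"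

lemma sat_WKL:
  "sat [] \<rho> WKL \<longleftrightarrow> (\<forall>T\<in>D ty1. is_tree T \<and> (\<forall>k. \<exists>n. k \<prec> n \<and> T \<bullet> n = \<one>) \<longrightarrow>
    (\<exists>f\<in>D ty1. cantor f \<and> (\<forall>n. T \<bullet> (br f n) = \<one>)))"
  by (simp add: principle_defs is_tree_def cantor_def init_def cong: ball_cong bex_cong)
    (rule ball_cong[OF refl], blast)

lemma sat_PIT:
  "sat [] \<rho> PIT\<^sub>o \<longleftrightarrow> (\<forall>F\<in>D ty2. \<forall>G\<in>D ty2.
    (\<forall>f\<in>D ty1. cantor f \<longrightarrow> (\<forall>g\<in>D ty1. cantor g \<longrightarrow> (\<exists>n. br g n = br f (G \<star> f)) \<longrightarrow> F \<star> g \<preceq> G \<star> f)) \<longrightarrow>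
    (\<exists>n. \<forall>g\<in>D ty1. cantor g \<longrightarrow> F \<star> g \<preceq> n))"
  by (simp add: principle_defs cantor_def cong: ball_cong bex_cong)
    (rule ball_cong[OF refl], blast)

lemma sat_NCC:
  "sat [] \<rho> NCC \<longleftrightarrow> (\<forall>Y\<in>D (ty1 \<Rrightarrow> N \<Rrightarrow> ty1).
    (\<forall>n. \<exists>m. \<exists>f\<in>D ty1. cantor f \<and> Y \<odot> f \<odot> nu m \<bullet> n = \<zero>) \<longrightarrow>
    (\<exists>g\<in>D ty1. \<forall>n. \<exists>f\<in>D ty1. cantor f \<and> Y \<odot> f \<odot> nu (g \<bullet> n) \<bullet> n = \<zero>))"
  by (simp add: principle_defs cantor_def cong: ball_cong bex_cong)

text \<open>A retraction of all functions onto Cantor space: \<open>QF_AC\<close> asks for a value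
  at every function, although trees only concern binary ones. It also makes an arbitrary function
  binary without changing its zeros.\<close>

lemma truncation_exists:
  "\<exists>t\<in>D (ty1 \<Rrightarrow> ty1). \<forall>f\<in>D ty1. \<forall>i. t \<odot> f \<bullet> i = (if f \<bullet> i = \<zero> then \<zero> else \<one>)"
proof -
  obtain s where s: "s \<in> D ty1" "\<And>n. s \<bullet> n = (if n \<noteq> \<zero> then \<one> else \<zero>)"
    using QF_char1[of "\<^bold>\<not> nv ''n'' \<^bold>= \<^bold>0" \<rho>0 "\<lambda>n. n \<noteq> \<zero>"] by auto
  define t where "t = eval [] (\<rho>0((''s'', ty1) := s))
    (lam (''f'', ty1) (lam (''i'', N) (fn ''s'' \<cdot> (fn ''f'' \<cdot> nv ''i''))))"
  have t: "t \<in> D (ty1 \<Rrightarrow> ty1)" using s by (auto simp: t_def intro!: eval_D)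
  have "t \<odot> f \<odot> nu i = nu (s \<bullet> (f \<bullet> i))" if "f \<in> D ty1" for f i
    using s that by (simp add: t_def)
  then have "t \<odot> f \<bullet> i = s \<bullet> (f \<bullet> i)" if "f \<in> D ty1" for f i
    using that t by simp
  then show ?thesis using s t by (intro bexI[of _ t]) auto
qed

lemma PIT_imp_WKL:
  assumes PIT: "sat [] \<rho> PIT\<^sub>o"
  shows "sat [] \<rho> WKL"
  unfolding sat_WKL
proof (intro ballI impI, elim conjE, rule ccontr)
  fix T assume T: "T \<in> D ty1" and tree: "is_tree T" and inf: "\<forall>k. \<exists>n. k \<prec> n \<and> T \<bullet> n = \<one>"
  assume nopath: "\<not> (\<exists>f\<in>D ty1. cantor f \<and> (\<forall>n. T \<bullet> br f n = \<one>))"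
  have down: "T \<bullet> br f j = \<one>" if "T \<bullet> br f n = \<one>" "cantor f" "j \<preceq> n" for f j n
    using tree that init_br unfolding is_tree_def by blast
  have downs: "T \<bullet> br (dec s) j = \<one>" if "T \<bullet> s = \<one>" "s \<noteq> \<zero>" "j \<preceq> len s" for s j
    using down[of "dec s" "len s" j] that by (simp add: br_dec_len)
  have root: "T \<bullet> \<one> = \<one>"
  proof -
    obtain s where "\<zero> \<prec> s" "T \<bullet> s = \<one>" using inf by blast
    then show ?thesis using downs[of s \<zero>] by auto
  qed
  obtain t where t: "t \<in> D (ty1 \<Rrightarrow> ty1)"
    and t_app: "\<And>f i. f \<in> D ty1 \<Longrightarrow> t \<odot> f \<bullet> i = (if f \<bullet> i = \<zero> then \<zero> else \<one>)"
    using truncation_exists by blast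
  have t_cantor: "cantor (t \<odot> f)" if "f \<in> D ty1" for f
    using t t_app that by (simp add: cantor_def le_one_iff)
  have t_id: "t \<odot> f = f" if "cantor f" for f
    using t t_app that le_one_iff by (intro fun_eqI) (auto simp: cantor_def)
  have "\<exists>n. T \<bullet> br (t \<odot> f) n = \<one> \<and> T \<bullet> br (t \<odot> f) (n \<oplus> \<one>) \<noteq> \<one>" if f: "f \<in> D ty1" for f
  proof -
    obtain m where "T \<bullet> br (t \<odot> f) m \<noteq> \<one>" using nopath t_cantor[OF f] t f by fastforce
    \<comment> \<open>The tree contains the empty sequence and misses some segment of
      \<open>t \<odot> f\<close>, so membership switches along this sequence.\<close>
    then have "\<exists>n. \<not> T \<bullet> br (t \<odot> f) n \<noteq> \<one> \<and> T \<bullet> br (t \<odot> f) (n \<oplus> \<one>) \<noteq> \<one>"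
      using T t f root
      by (intro QF_switch[where P = "\<lambda>n. T \<bullet> br (t \<odot> f) n \<noteq> \<one>" and x = "''n''" and
        \<rho> = "\<rho>0((''T'', ty1) := T, (''g'', ty1) := t \<odot> f)" and
        A = "\<^bold>\<not> (fn ''T'' \<cdot> (Bar \<cdot> fn ''g'' \<cdot> nv ''n'') \<^bold>= \<^bold>1)"]) auto
    then show ?thesis by blast
  qed
  then have "\<exists>F\<in>D ty2. \<forall>f\<in>D ty1. sat [] ((\<rho>0((''T'', ty1) := T, (''t'', ty1 \<Rrightarrow> ty1) := t))
      ((''x'', ty1) := f, (''k'', N) := nu (F \<star> f)))
    (fn ''T'' \<cdot> (Bar \<cdot> (Fv (''t'', ty1 \<Rrightarrow> ty1) \<cdot> fn ''x'') \<cdot> nv ''k'') \<^bold>= \<^bold>1 \<^bold>\<and>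
      \<^bold>\<not> (fn ''T'' \<cdot> (Bar \<cdot> (Fv (''t'', ty1 \<Rrightarrow> ty1) \<cdot> fn ''x'') \<cdot> (nv ''k'' \<^bold>+ \<^bold>1)) \<^bold>= \<^bold>1))"
    using T t by (intro QF_AC[where Y = "''Y''"]) auto
  then obtain F where F: "F \<in> D ty2"
    and F_in: "\<And>f. f \<in> D ty1 \<Longrightarrow> T \<bullet> br (t \<odot> f) (F \<star> f) = \<one>"
    and F_out: "\<And>f. f \<in> D ty1 \<Longrightarrow> T \<bullet> br (t \<odot> f) (F \<star> f \<oplus> \<one>) \<noteq> \<one>"
    using T t by auto
  define G where "G = eval [] (\<rho>0((''F'', ty2) := F)) (lam (''x'', ty1) (Fv (''F'', ty2) \<cdot> fn ''x'' \<^bold>+ \<^bold>1))"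
  have G: "G \<in> D ty2" using F by (auto simp: G_def intro!: eval_D)
  have "G \<odot> f = nu (F \<star> f \<oplus> \<one>)" if "f \<in> D ty1" for f using F that by (simp add: G_def)
  then have G_app: "G \<star> f = F \<star> f \<oplus> \<one>" if "f \<in> D ty1" for f using G that by simp
  have "F \<star> g \<preceq> G \<star> f" if f: "cantor f" and g: "cantor g" and eq: "br g n = br f (G \<star> f)" for f g n
  proof -
    \<comment> \<open>The neighbourhood leaves its length open; equal codes force it to be
      \<open>F \<star> f \<oplus> \<one>\<close>, the first length at which \<open>f\<close> is
      outside \<open>T\<close>.\<close>
    have n: "n = F \<star> f \<oplus> \<one>" using br_length_unique[OF g f eq] f by (simp add: G_app)
    then have "T \<bullet> br g n \<noteq> \<one>" using F_out[of f] t_id[OF f] eq f by (simp add: G_app)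
    then have "\<not> n \<preceq> F \<star> g" using down[OF _ g] F_in[of g] t_id[OF g] g by auto
    then show ?thesis using f n by (simp add: G_app num.not_le num.less_imp_le)
  qed
  then obtain B where B: "\<And>g. cantor g \<Longrightarrow> F \<star> g \<preceq> B"
    using PIT[unfolded sat_PIT] F G by (metis cantor_D)
  \<comment> \<open>Infinity speaks of codes, not of lengths: a code beyond 2^(B+1) has length at
    least \<open>B \<oplus> \<one>\<close>.\<close>
  obtain s where s: "pw (B \<oplus> \<one>) \<prec> s" "T \<bullet> s = \<one>" using inf by blast
  then have nz: "s \<noteq> \<zero>" by auto
  let ?g = "dec s"
  have "B \<oplus> \<one> \<preceq> len s"
    using less_Suc_pw num.less_trans[OF s(1) len_bounds(2)[OF nz]] by blast
  moreover have "F \<star> ?g \<oplus> \<one> \<preceq> B \<oplus> \<one>" using B by simp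
  ultimately have "T \<bullet> br ?g (F \<star> ?g \<oplus> \<one>) = \<one>" using downs s(2) nz num.order_trans by blast
  then show False using F_out[of ?g] t_id[of ?g] by simp
qed

text \<open>Quantifier-free formulas exclude bounded quantifiers too; a product of values of
  \<open>h\<close> replaces one, uniformly in \<open>h\<close>.\<close>

lemma bounded_all_exists:
  "\<exists>b\<in>D (ty1 \<Rrightarrow> ty1). \<forall>h\<in>D ty1. (\<forall>i. h \<bullet> i \<preceq> \<one>) \<longrightarrow>
    (\<forall>n. b \<odot> h \<bullet> n = (if \<forall>i. i \<prec> n \<longrightarrow> h \<bullet> i = \<one> then \<one> else \<zero>))"
proof -
  let ?t = "lam (''k'', N) (lam (''c'', N) (fn ''h'' \<cdot> nv ''k'' \<^bold>* nv ''c''))"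
  define b where "b = eval [] \<rho>0 (lam (''h'', ty1) (Con (CRec N) \<cdot> ?t \<cdot> \<^bold>1))"
  have b: "b \<in> D (ty1 \<Rrightarrow> ty1)" by (auto simp: b_def intro!: eval_D)
  have b_zero: "b \<odot> h \<bullet> \<zero> = \<one>" and b_Suc: "b \<odot> h \<bullet> (n \<oplus> \<one>) = h \<bullet> n \<otimes> (b \<odot> h \<bullet> n)"
    if h: "h \<in> D ty1" for h n
  proof -
    define g where "g = eval [] (\<rho>0((''h'', ty1) := h)) ?t"
    have g: "g \<in> D (N \<Rrightarrow> ty1)" using h by (auto simp: g_def intro!: eval_D)
    have "g \<odot> nu a \<odot> nu b = nu (h \<bullet> a \<otimes> b)" for a b using h by (simp add: g_def)
    then have g_app: "g \<odot> nu a \<bullet> b = h \<bullet> a \<otimes> b" for a b using g by simp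
    have eq: "b \<odot> h = cst (CRec N) \<odot> g \<odot> nu \<one>" using h by (simp add: b_def g_def)
    show "b \<odot> h \<bullet> \<zero> = \<one>" "b \<odot> h \<bullet> (n \<oplus> \<one>) = h \<bullet> n \<otimes> (b \<odot> h \<bullet> n)"
      using g g_app by (simp_all add: eq)
  qed
  have "b \<odot> h \<bullet> n = (if \<forall>i. i \<prec> n \<longrightarrow> h \<bullet> i = \<one> then \<one> else \<zero>)"
    if h: "h \<in> D ty1" and le: "\<And>i. h \<bullet> i \<preceq> \<one>" for h n
  proof (cases "\<forall>i. i \<prec> n \<longrightarrow> h \<bullet> i = \<one>")
    case True
    have "m \<preceq> n \<longrightarrow> b \<odot> h \<bullet> m = \<one>" for m
    proof (rule QF_induct[where P = "\<lambda>m. m \<preceq> n \<longrightarrow> b \<odot> h \<bullet> m = \<one>" and x = "''m''" and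
        \<rho> = "\<rho>0((''n'', N) := nu n, (''b'', ty1) := b \<odot> h)" and
        A = "nv ''m'' \<^bold>\<le> nv ''n'' \<^bold>\<longrightarrow> fn ''b'' \<cdot> nv ''m'' \<^bold>= \<^bold>1"])
      show "m \<oplus> \<one> \<preceq> n \<longrightarrow> b \<odot> h \<bullet> (m \<oplus> \<one>) = \<one>" if "m \<preceq> n \<longrightarrow> b \<odot> h \<bullet> m = \<one>" for m
        using that True b_Suc[OF h] by (simp add: Suc_le_iff num.less_imp_le)
    qed (use b h b_zero in auto)
    then show ?thesis using True by simp
  next
    case False
    then obtain i where i: "i \<prec> n" "h \<bullet> i = \<zero>" using le le_one_iff by blast
    have "i \<prec> m \<longrightarrow> b \<odot> h \<bullet> m = \<zero>" for m
    proof (rule QF_induct[where P = "\<lambda>m. i \<prec> m \<longrightarrow> b \<odot> h \<bullet> m = \<zero>" and x = "''m''" and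
        \<rho> = "\<rho>0((''i'', N) := nu i, (''b'', ty1) := b \<odot> h)" and
        A = "nv ''i'' \<^bold>< nv ''m'' \<^bold>\<longrightarrow> fn ''b'' \<cdot> nv ''m'' \<^bold>= \<^bold>0"])
      show "i \<prec> m \<oplus> \<one> \<longrightarrow> b \<odot> h \<bullet> (m \<oplus> \<one>) = \<zero>" if "i \<prec> m \<longrightarrow> b \<odot> h \<bullet> m = \<zero>" for m
        using that i b_Suc[OF h] by (cases "i = m") (auto dest: num.le_neq_trans)
    qed (use b h in auto)
    then show ?thesis using i False by auto
  qed
  then show ?thesis using b by (intro bexI[of _ b]) auto
qed

text \<open>Grilliot's trick: a discontinuity of \<open>G\<close> at \<open>f\<close> yields a functional that decides
  $\exists n\, h(n) = 0$.\<close>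

lemma zero_test_exists:
  assumes G: "G \<in> D ty2" and f: "cantor f" and disc: "\<And>i. i \<prec> G \<star> dec (br f i)"
  shows "\<exists>z\<in>D (ty1 \<Rrightarrow> ty1). \<forall>h\<in>D ty1. G \<star> f \<prec> G \<star> (z \<odot> h) \<longleftrightarrow> (\<exists>n. h \<bullet> n = \<zero>)"
proof -
  let ?K = "G \<star> f"
  obtain t where t: "t \<in> D (ty1 \<Rrightarrow> ty1)"
    and t_app: "\<And>f i. f \<in> D ty1 \<Longrightarrow> t \<odot> f \<bullet> i = (if f \<bullet> i = \<zero> then \<zero> else \<one>)"
    using truncation_exists by blast
  obtain b where b: "b \<in> D (ty1 \<Rrightarrow> ty1)"
    and b_app: "\<And>h n. h \<in> D ty1 \<Longrightarrow> (\<And>i. h \<bullet> i \<preceq> \<one>) \<Longrightarrow>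
      b \<odot> h \<bullet> n = (if \<forall>i. i \<prec> n \<longrightarrow> h \<bullet> i = \<one> then \<one> else \<zero>)"
    using bounded_all_exists by blast
  \<comment> \<open>For \<open>j\<close> below \<open>?K\<close> the value is one whatever
    \<open>c\<close> is: the first \<open>?K\<close> bits of \<open>f\<close> are never
    erased.\<close>
  obtain s where s: "s \<in> D (N \<Rrightarrow> ty1)"
    and s_app: "\<And>j c. s \<odot> nu j \<bullet> c = (if j \<prec> ?K \<or> c = \<one> then \<one> else \<zero>)"
    using QF_char2[of "nv ''m'' \<^bold>< nv ''K'' \<^bold>\<or> nv ''n'' \<^bold>= \<^bold>1" "\<rho>0((''K'', N) := nu ?K)"
        "\<lambda>j c. j \<prec> ?K \<or> c = \<one>"] by (auto simp: imp_conv_disj)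
  have bt: "b \<odot> (t \<odot> h) \<bullet> n = (if \<forall>i. i \<prec> n \<longrightarrow> h \<bullet> i \<noteq> \<zero> then \<one> else \<zero>)" if h: "h \<in> D ty1" for h n
    using b_app[of "t \<odot> h" n] t t_app h by simp blast
  let ?b = "Fv (''b'', ty1 \<Rrightarrow> ty1)" and ?t = "Fv (''t'', ty1 \<Rrightarrow> ty1)" and ?s = "Fv (''s'', N \<Rrightarrow> ty1)"
  define z where "z = eval []
    (\<rho>0((''b'', ty1 \<Rrightarrow> ty1) := b, (''t'', ty1 \<Rrightarrow> ty1) := t, (''s'', N \<Rrightarrow> ty1) := s, (''f'', ty1) := f))
    (lam (''h'', ty1) (lam (''j'', N)
      (fn ''f'' \<cdot> nv ''j'' \<^bold>* (?s \<cdot> nv ''j'' \<cdot> (?b \<cdot> (?t \<cdot> fn ''h'') \<cdot> (nv ''j'' \<^bold>+ \<^bold>1))))))"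
  have z: "z \<in> D (ty1 \<Rrightarrow> ty1)" using b t s f by (auto simp: z_def intro!: eval_D)
  have "z \<odot> h \<odot> nu j = nu (f \<bullet> j \<otimes> (s \<odot> nu j \<bullet> (b \<odot> (t \<odot> h) \<bullet> (j \<oplus> \<one>))))" if "h \<in> D ty1" for h j
    using b t s f that by (simp add: z_def)
  \<comment> \<open>So \<open>z \<odot> h\<close> is \<open>f\<close> itself if \<open>h\<close> has
    no zero; otherwise it is an initial segment of \<open>f\<close> continued by zeros.\<close>
  then have z_app: "z \<odot> h \<bullet> j = (if j \<prec> ?K \<or> (\<forall>i. i \<preceq> j \<longrightarrow> h \<bullet> i \<noteq> \<zero>) then f \<bullet> j else \<zero>)"
    if "h \<in> D ty1" for h j
    using z that by (simp add: s_app bt) blast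
  have "?K \<prec> G \<star> (z \<odot> h) \<longleftrightarrow> (\<exists>n. h \<bullet> n = \<zero>)" if h: "h \<in> D ty1" for h
  proof (cases "\<exists>n. h \<bullet> n = \<zero>")
    case False
    then have "z \<odot> h = f" using z h f by (intro fun_eqI) (auto simp: z_app)
    then show ?thesis using False by simp
  next
    case True
    then obtain m where m: "h \<bullet> m = \<zero>" by blast
    let ?P = "\<lambda>n. b \<odot> (t \<odot> h) \<bullet> n = \<zero>"
    have "?P (m \<oplus> \<one>)" using m h by (auto simp: bt)
    then have "\<exists>n. \<not> ?P n \<and> ?P (n \<oplus> \<one>)"
      using b t h by (intro QF_switch[where P = ?P and x = "''n''" and m = "m \<oplus> \<one>" and
        \<rho> = "\<rho>0((''p'', ty1) := b \<odot> (t \<odot> h))" and A = "fn ''p'' \<cdot> nv ''n'' \<^bold>= \<^bold>0"]) (auto simp: bt)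
    then obtain n where n: "\<And>i. i \<prec> n \<Longrightarrow> h \<bullet> i \<noteq> \<zero>" "\<exists>i. i \<preceq> n \<and> h \<bullet> i = \<zero>"
      using h by (auto simp: bt split: if_splits)
    then have hn: "h \<bullet> n = \<zero>" using num.le_neq_trans by blast
    have before: "(\<forall>i. i \<preceq> j \<longrightarrow> h \<bullet> i \<noteq> \<zero>) \<longleftrightarrow> j \<prec> n" for j
      using n(1) hn num.le_less_trans num.not_le by blast
    \<comment> \<open>The cut is made at the first zero of \<open>h\<close>, but not below
      \<open>?K\<close>. There \<open>disc\<close> makes \<open>G\<close> exceed \<open>i\<close>,
      hence also \<open>?K\<close>, its value at \<open>f\<close>.\<close>
    define i where "i = (if ?K \<preceq> n then n else ?K)"
    have i: "j \<prec> ?K \<or> j \<prec> n \<longleftrightarrow> j \<prec> i" for j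
      using num.less_le_trans num.less_trans num.not_le by (auto simp: i_def)
    have "z \<odot> h = dec (br f i)"
      using z h f by (intro fun_eqI) (auto simp: z_app before i dec_br)
    moreover have "?K \<preceq> i" by (simp add: i_def)
    ultimately have "?K \<prec> G \<star> (z \<odot> h)" using disc[of i] num.le_less_trans by simp
    then show ?thesis using True by simp
  qed
  then show ?thesis using z by blast
qed

text \<open>\<open>g\<close> shares its first \<open>i\<close> bits with the padded segment
  \<open>?x\<close>. As the neighbourhood of \<open>?x\<close> fixes at most \<open>i\<close> bits,
  it contains \<open>g\<close>, so \<open>F\<close> at \<open>g\<close> is at most \<open>G\<close>
  at \<open>?x\<close>, hence at most \<open>i\<close>.\<close>

lemma bound_of_finite_tree:
  assumes nbhd: "\<And>f g n. cantor f \<Longrightarrow> cantor g \<Longrightarrow> br g n = br f (G \<star> f) \<Longrightarrow> F \<star> g \<preceq> G \<star> f"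
    and "cantor g" and i: "i \<preceq> K" "G \<star> dec (br g i) \<preceq> i"
  shows "F \<star> g \<preceq> K"
proof -
  let ?x = "dec (br g i)"
  have "br ?x i = br g i" using br_dec_len[of "br g i"] assms(2) by (simp add: len_br)
  then have "br ?x (G \<star> ?x) = br g (G \<star> ?x)" using br_agree[of ?x g] i(2) assms(2) by simp
  then have "F \<star> g \<preceq> G \<star> ?x" using nbhd[of ?x g] assms(2) by simp
  then show ?thesis using i num.order_trans by blast
qed

text \<open>Comparing \<open>G \<star> (z \<odot> h)\<close> with \<open>K\<close> is
  quantifier-free, yet it decides the unbounded existential statement that defines the tree of
  approximations.\<close>

lemma bound_of_zero_test:
  assumes WKL: "sat [] \<rho> WKL" and NCC: "sat [] \<rho> NCC"
    and F: "F \<in> D ty2" and G: "G \<in> D ty2"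
    and nbhd: "\<And>f g n. cantor f \<Longrightarrow> cantor g \<Longrightarrow> br g n = br f (G \<star> f) \<Longrightarrow> F \<star> g \<preceq> G \<star> f"
    and z: "z \<in> D (ty1 \<Rrightarrow> ty1)" "\<And>h. h \<in> D ty1 \<Longrightarrow> K \<prec> G \<star> (z \<odot> h) \<longleftrightarrow> (\<exists>n. h \<bullet> n = \<zero>)"
  shows "\<exists>n. \<forall>g\<in>D ty1. cantor g \<longrightarrow> F \<star> g \<preceq> n"
proof (rule ccontr)
  assume "\<not> ?thesis"
  then have unbounded: "\<exists>f. cantor f \<and> n \<prec> F \<star> f" for n using num.not_le by blast
  obtain neq where neq: "neq \<in> D (N \<Rrightarrow> ty1)" "\<And>a b. neq \<odot> nu a \<bullet> b = (if a \<noteq> b then \<one> else \<zero>)"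
    using QF_char2[of "\<^bold>\<not> nv ''m'' \<^bold>= nv ''n''" \<rho>0 "\<lambda>a b. a \<noteq> b"] by auto
  obtain geq where geq: "geq \<in> D (N \<Rrightarrow> ty1)" "\<And>a b. geq \<odot> nu a \<bullet> b = (if \<not> a \<prec> b then \<one> else \<zero>)"
    using QF_char2[of "\<^bold>\<not> nv ''m'' \<^bold>< nv ''n''" \<rho>0 "\<lambda>a b. \<not> a \<prec> b"] by auto
  let ?neq = "Fv (''q'', N \<Rrightarrow> ty1)" and ?geq = "Fv (''r'', N \<Rrightarrow> ty1)" and ?F = "Fv (''F'', ty2)"
  \<comment> \<open>The sum vanishes exactly if \<open>m\<close> codes the first \<open>n\<close>
    bits of \<open>f\<close> and \<open>n \<prec> F \<star> f\<close>; this is the single equation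
    that \<open>NCC\<close> requires.\<close>
  define Y where "Y = eval []
    (\<rho>0((''q'', N \<Rrightarrow> ty1) := neq, (''r'', N \<Rrightarrow> ty1) := geq, (''F'', ty2) := F))
    (lam (''f'', ty1) (lam (''m'', N) (lam (''n'', N)
      (?neq \<cdot> (Bar \<cdot> fn ''f'' \<cdot> nv ''n'') \<cdot> nv ''m'' \<^bold>+ ?geq \<cdot> nv ''n'' \<cdot> (?F \<cdot> fn ''f'')))))"
  have Y: "Y \<in> D (ty1 \<Rrightarrow> N \<Rrightarrow> ty1)" using neq geq F by (auto simp: Y_def intro!: eval_D)
  have "Y \<odot> f \<odot> nu m \<odot> nu n = nu (neq \<odot> nu (br f n) \<bullet> m \<oplus> geq \<odot> nu n \<bullet> (F \<star> f))"
    if "f \<in> D ty1" for f m n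
    using neq(1) geq(1) F that by (simp add: Y_def)
  then have "Y \<odot> f \<odot> nu m \<bullet> n = neq \<odot> nu (br f n) \<bullet> m \<oplus> geq \<odot> nu n \<bullet> (F \<star> f)"
    if "f \<in> D ty1" for f m n
    using Y that by simp
  then have Y_zero: "Y \<odot> f \<odot> nu m \<bullet> n = \<zero> \<longleftrightarrow> br f n = m \<and> n \<prec> F \<star> f" if "f \<in> D ty1" for f m n
    using that neq(2) geq(2) by simp
  have "\<exists>m. \<exists>f\<in>D ty1. cantor f \<and> Y \<odot> f \<odot> nu m \<bullet> n = \<zero>" for n
    using unbounded[of n] Y_zero by (metis cantor_D)
  then obtain g where g: "g \<in> D ty1" "\<And>n. \<exists>f\<in>D ty1. cantor f \<and> Y \<odot> f \<odot> nu (g \<bullet> n) \<bullet> n = \<zero>"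
    using NCC[unfolded sat_NCC] Y by blast
  then have approx: "\<exists>f. cantor f \<and> br f n = g \<bullet> n \<and> n \<prec> F \<star> f" for n
    using Y_zero by blast
  let ?l = "fn ''l'' \<cdot> nv ''m''" and ?p = "Fv (''p'', N \<Rrightarrow> ty1)"
  \<comment> \<open>\<open>h \<odot> nu s\<close> vanishes exactly at those \<open>n\<close> that
    witness membership of \<open>s\<close>, the form that \<open>z\<close> tests.\<close>
  obtain h where h: "h \<in> D (N \<Rrightarrow> ty1)" "\<And>s n. h \<odot> nu s \<bullet> n =
      (if \<not> (len s \<preceq> n \<and> pre (g \<bullet> n) (len s) = s) then \<one> else \<zero>)"
    using QF_char2[of "\<^bold>\<not> (?l \<^bold>\<le> nv ''n'' \<^bold>\<and> ?p \<cdot> (fn ''g'' \<cdot> nv ''n'') \<cdot> ?l \<^bold>= nv ''m'')"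
        "\<rho>0((''l'', ty1) := Lenc, (''p'', N \<Rrightarrow> ty1) := Prec, (''g'', ty1) := g)"
        "\<lambda>s n. \<not> (len s \<preceq> n \<and> pre (g \<bullet> n) (len s) = s)"] g(1) by auto
  obtain T where T: "T \<in> D ty1"
    and "\<And>s. T \<bullet> s = (if s \<noteq> \<zero> \<and> K \<prec> G \<star> (z \<odot> (h \<odot> nu s)) then \<one> else \<zero>)"
    using QF_char1[of "\<^bold>\<not> nv ''n'' \<^bold>= \<^bold>0 \<^bold>\<and> nv ''K'' \<^bold>< Fv (''G'', ty2) \<cdot>
        (Fv (''z'', ty1 \<Rrightarrow> ty1) \<cdot> (Fv (''h'', N \<Rrightarrow> ty1) \<cdot> nv ''n''))"
        "\<rho>0((''K'', N) := nu K, (''G'', ty2) := G, (''z'', ty1 \<Rrightarrow> ty1) := z, (''h'', N \<Rrightarrow> ty1) := h)"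
        "\<lambda>s. s \<noteq> \<zero> \<and> K \<prec> G \<star> (z \<odot> (h \<odot> nu s))"] G z(1) h(1) by auto
  then have T_app: "T \<bullet> s = (if s \<noteq> \<zero> \<and> (\<exists>n. len s \<preceq> n \<and> pre (g \<bullet> n) (len s) = s) then \<one> else \<zero>)" for s
    using z(2)[of "h \<odot> nu s"] h by simp
  then have T_iff: "T \<bullet> s = \<one> \<longleftrightarrow> s \<noteq> \<zero> \<and> (\<exists>n. len s \<preceq> n \<and> pre (g \<bullet> n) (len s) = s)"
    and T_le: "T \<bullet> s \<preceq> \<one>" for s
    by simp_all
  have "is_tree T"
    unfolding is_tree_def
  proof (intro conjI allI impI)
    show "cantor T" using T T_le by (simp add: cantor_def)
    show "\<one> \<preceq> s" if "T \<bullet> s = \<one>" for s using that by (simp add: T_iff one_le_iff)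
    fix s t assume "T \<bullet> t = \<one>" and init: "init s t"
    then obtain n where n: "len t \<preceq> n" "pre (g \<bullet> n) (len t) = t" unfolding T_iff by blast
    obtain f where f: "cantor f" "br f n = g \<bullet> n" using approx by blast
    then have "br (dec t) (len t) = br f (len t)"
      using n pre_br[of f "len t" n] br_dec_len[of t] initD(4)[OF init] by simp
    then have "s = br f (len s)" using br_agree[of "dec t" f] f(1) initD(1,2)[OF init] by simp
    moreover have "len s \<preceq> n" using initD(2)[OF init] n(1) num.order_trans by blast
    moreover from this have "pre (g \<bullet> n) (len s) = br f (len s)" using f pre_br[of f "len s" n] by simp
    ultimately show "T \<bullet> s = \<one>" unfolding T_iff using initD(3)[OF init] by metis
  qed
  moreover have "\<exists>s. k \<prec> s \<and> T \<bullet> s = \<one>" for k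
  proof -
    obtain f where f: "cantor f" "br f k = g \<bullet> k" using approx by blast
    then have "T \<bullet> br f k = \<one>" using pre_br[of f k k] len_br[of f k] by (auto simp: T_iff intro!: exI[of _ k])
    \<comment> \<open>Codes exceed lengths, so arbitrarily long segments are arbitrarily large
      elements of the tree.\<close>
    moreover have "k \<prec> br f k" by (rule num.less_le_trans[OF less_pw pw_le_br]) (simp add: f)
    ultimately show ?thesis by blast
  qed
  ultimately obtain q where q: "cantor q" "\<And>n. T \<bullet> br q n = \<one>"
    using WKL[unfolded sat_WKL] T by blast
  let ?K = "G \<star> q"
  \<comment> \<open>Membership of this segment of \<open>q\<close> yields an \<open>n\<close> not
    below \<open>G \<star> q\<close>; the bound on \<open>n\<close> in the definition of the tree
    serves this purpose.\<close>
  obtain n where n: "?K \<preceq> n" "pre (g \<bullet> n) ?K = br q ?K"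
    using q(2)[of ?K] q(1) by (auto simp: T_iff len_br)
  obtain f where f: "cantor f" "br f n = g \<bullet> n" "n \<prec> F \<star> f" using approx by blast
  then have "br f ?K = br q ?K" using n pre_br[of f ?K n] by simp
  then have "F \<star> f \<preceq> ?K" using nbhd q(1) f(1) by blast
  then show False using f(3) n(1) num.not_le num.order_trans by blast
qed

lemma WKL_imp_PIT:
  assumes WKL: "sat [] \<rho> WKL" and NCC: "sat [] \<rho> NCC"
  shows "sat [] \<rho> PIT\<^sub>o"
  unfolding sat_PIT
proof (intro ballI impI)
  fix F G assume F: "F \<in> D ty2" and G: "G \<in> D ty2"
    and "\<forall>f\<in>D ty1. cantor f \<longrightarrow> (\<forall>g\<in>D ty1. cantor g \<longrightarrow>
      (\<exists>n. br g n = br f (G \<star> f)) \<longrightarrow> F \<star> g \<preceq> G \<star> f)"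
  then have nbhd: "\<And>f g n. cantor f \<Longrightarrow> cantor g \<Longrightarrow> br g n = br f (G \<star> f) \<Longrightarrow> F \<star> g \<preceq> G \<star> f"
    using cantor_D by blast
  obtain b where b: "b \<in> D (ty1 \<Rrightarrow> ty1)"
    and b_app: "\<And>h n. h \<in> D ty1 \<Longrightarrow> (\<And>i. h \<bullet> i \<preceq> \<one>) \<Longrightarrow>
      b \<odot> h \<bullet> n = (if \<forall>i. i \<prec> n \<longrightarrow> h \<bullet> i = \<one> then \<one> else \<zero>)"
    using bounded_all_exists by blast
  \<comment> \<open>\<open>p\<close> decides the condition for a single initial segment.
    \<open>b\<close> then combines it over all lengths up to and including \<open>len s\<close>,
    hence its later argument \<open>len s \<oplus> \<one>\<close>.\<close>
  obtain p where p: "p \<in> D (N \<Rrightarrow> ty1)"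
    "\<And>s i. p \<odot> nu s \<bullet> i = (if i \<prec> G \<star> dec (pre s i) then \<one> else \<zero>)"
    using QF_char2[of "nv ''n'' \<^bold>< Fv (''G'', ty2) \<cdot> (Fv (''d'', N \<Rrightarrow> ty1) \<cdot>
        (Fv (''p'', N \<Rrightarrow> ty1) \<cdot> nv ''m'' \<cdot> nv ''n''))"
        "\<rho>0((''G'', ty2) := G, (''d'', N \<Rrightarrow> ty1) := Decc, (''p'', N \<Rrightarrow> ty1) := Prec)"
        "\<lambda>s i. i \<prec> G \<star> dec (pre s i)"] G by auto
  obtain T where T: "T \<in> D ty1"
    and "\<And>s. T \<bullet> s = (if s \<noteq> \<zero> \<and> b \<odot> (p \<odot> nu s) \<bullet> (len s \<oplus> \<one>) = \<one> then \<one> else \<zero>)"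
    using QF_char1[of "\<^bold>\<not> nv ''n'' \<^bold>= \<^bold>0 \<^bold>\<and>
        Fv (''b'', ty1 \<Rrightarrow> ty1) \<cdot> (Fv (''p'', N \<Rrightarrow> ty1) \<cdot> nv ''n'') \<cdot> (fn ''l'' \<cdot> nv ''n'' \<^bold>+ \<^bold>1) \<^bold>= \<^bold>1"
        "\<rho>0((''b'', ty1 \<Rrightarrow> ty1) := b, (''p'', N \<Rrightarrow> ty1) := p, (''l'', ty1) := Lenc)"
        "\<lambda>s. s \<noteq> \<zero> \<and> b \<odot> (p \<odot> nu s) \<bullet> (len s \<oplus> \<one>) = \<one>"] b p(1) by auto
  then have T_app: "T \<bullet> s = (if s \<noteq> \<zero> \<and> (\<forall>i. i \<preceq> len s \<longrightarrow> i \<prec> G \<star> dec (pre s i)) then \<one> else \<zero>)" for s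
    using b_app[of "p \<odot> nu s"] p by simp blast
  then have T_iff: "T \<bullet> s = \<one> \<longleftrightarrow> s \<noteq> \<zero> \<and> (\<forall>i. i \<preceq> len s \<longrightarrow> i \<prec> G \<star> dec (pre s i))"
    and T_le: "T \<bullet> s \<preceq> \<one>" for s
    by simp_all
  have T_br: "T \<bullet> br f n = \<one> \<longleftrightarrow> (\<forall>i. i \<preceq> n \<longrightarrow> i \<prec> G \<star> dec (br f i))" if "cantor f" for f n
    using that by (auto simp: T_iff len_br pre_br)
  have tree: "is_tree T"
    unfolding is_tree_def
  proof (intro conjI allI impI)
    show "cantor T" using T T_le by (simp add: cantor_def)
    show "\<one> \<preceq> s" if "T \<bullet> s = \<one>" for s using that unfolding T_iff one_le_iff by blast
    fix s t assume t: "T \<bullet> t = \<one>" and init: "init s t"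
    have "T \<bullet> br (dec t) (len t) = \<one>" using t br_dec_len initD(4)[OF init] by simp
    then have "T \<bullet> br (dec t) (len s) = \<one>"
      using initD(2)[OF init] num.order_trans unfolding T_br[OF cantor_dec] by blast
    then show "T \<bullet> s = \<one>" using initD(1)[OF init] by simp
  qed
  show "\<exists>n. \<forall>g\<in>D ty1. cantor g \<longrightarrow> F \<star> g \<preceq> n"
  proof (cases "\<forall>k. \<exists>s. k \<prec> s \<and> T \<bullet> s = \<one>")
    case False
    then obtain K where K: "\<And>s. K \<prec> s \<Longrightarrow> T \<bullet> s \<noteq> \<one>" by blast
    have "F \<star> g \<preceq> K" if g: "cantor g" for g
    proof -
      \<comment> \<open>A code exceeds its length, so the segment of \<open>g\<close> of length
        \<open>K\<close> is outside \<open>T\<close>, and some initial segment of it violates the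
        condition.\<close>
      have "K \<prec> br g K" by (rule num.less_le_trans[OF less_pw pw_le_br]) (simp add: g)
      then obtain i where "i \<preceq> K" "G \<star> dec (br g i) \<preceq> i" using K T_br[OF g] num.not_le by blast
      then show ?thesis by (rule bound_of_finite_tree[OF _ g, rotated]) (rule nbhd)
    qed
    then show ?thesis by blast
  next
    case True
    then obtain f where f: "cantor f" "\<And>n. T \<bullet> br f n = \<one>"
      using WKL[unfolded sat_WKL] T tree by blast
    then have "i \<prec> G \<star> dec (br f i)" for i using T_br by blast
    then obtain z where z: "z \<in> D (ty1 \<Rrightarrow> ty1)"
      "\<And>h. h \<in> D ty1 \<Longrightarrow> G \<star> f \<prec> G \<star> (z \<odot> h) \<longleftrightarrow> (\<exists>n. h \<bullet> n = \<zero>)"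
      using zero_test_exists[OF G f(1)] by blast
    show ?thesis by (rule bound_of_zero_test[OF WKL NCC F G _ z]) (rule nbhd)
  qed
qed

end

theorem theorem3p2:
  shows "RCA0\<omega> \<union> {NCC} \<turnstile> (WKL \<^bold>\<longleftrightarrow> PIT\<^sub>o)"
proof (rule completeness)
  show "arithmetic_axioms \<subseteq> RCA0\<omega> \<union> {NCC}" "extensionality_axioms \<subseteq> RCA0\<omega> \<union> {NCC}"
    by (auto simp: RCA0\<omega>_def)
  show "wff [] (WKL \<^bold>\<longleftrightarrow> PIT\<^sub>o)" by (simp add: sentences)
  fix D :: "ty \<Rightarrow> tm set set" and ap cst lt \<rho>
  assume model: "ext_model D ap cst" and countable: "countable (D N)"
    and valid: "\<And>B \<rho>. B \<in> RCA0\<omega> \<union> {NCC} \<Longrightarrow> wff [] B \<Longrightarrow> ext_model.typed D \<rho> \<Longrightarrow>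
      ext_model.sat D ap cst lt [] \<rho> B"
    and typed: "ext_model.typed D \<rho>"
  interpret ext_model D ap cst lt by (rule model)
  interpret rca_model D ap cst lt
    by unfold_locales (rule valid, rule UnI1)
  \<comment> \<open>Only the set of natural numbers is borrowed for indexing; the arithmetic on it
    is carried over from the model and may be nonstandard.\<close>
  obtain e :: "tm set \<Rightarrow> nat" where "bij_betw e (D N) UNIV"
    using countableE_infinite[OF countable infinite_numbers] .
  then interpret numbered_model D ap cst lt "inv_into (D N) e"
    by unfold_locales (rule bij_betw_inv_into)
  have "sat [] \<rho> NCC" using valid typed sentences(3) by simp
  then show "sat [] \<rho> (WKL \<^bold>\<longleftrightarrow> PIT\<^sub>o)"
    using PIT_imp_WKL[of \<rho>] WKL_imp_PIT[of \<rho>] by simp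
qed

end
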